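(* Let $G$ be a connected Lie group with Lie algebra $\mathfrak{g}$ such that the generic stabilizer of the coadjoint action of $G$ on $\mathfrak{g}^*$ is connected and has dimension not more than $1$. Let $H: T^*G\to\mathbb{R}$ be a smooth left-invariant Hamiltonian, and let $\sigma:\mathfrak{g}\to\mathfrak{g}$ be a linear operator whose dual operator $\sigma^*:\mathfrak{g}^*\to\mathfrak{g}^*$ preserves the Hamiltonian $H$ (i.e. $H\circ\sigma^*=H$ on $\mathfrak{g}^*$) and such that one of the following two conditions holds: (a) $\sigma^*(\vec{H}_{\mathrm{vert}})=\vec{H}_{\mathrm{vert}}$ and $\sigma$ is an automorphism of the Lie algebra $\mathfrak{g}$; (b) $\sigma^*(\vec{H}_{\mathrm{vert}})=-\vec{H}_{\mathrm{vert}}$ and $\sigma$ is an anti-automorphism of the Lie algebra $\mathfrak{g}$. Let $S:G\to G$ be the automorphism (in case (a)), respectively anti-automorphism (in case (b)), of the Lie group $G$ with $d_{\mathrm{id}}S=\sigma$. Define $$s(p,t)=\begin{cases}(\sigma^*p,\,t) & \text{in case (a)},\\ (\sigma^* e^{t\vec{H}_{\mathrm{vert}}}p,\,t) & \text{in case (b)}.\end{cases}$$ Then the pair $(s,S^{-1})$ is a symmetry of the exponential map; that is, there is an open dense subset $\mathcal{W}\subset\mathfrak{g}^*$ such that $s$ is a diffeomorphism of $\mathcal{W}\times\mathbb{R}_+$ onto itself, $S^{-1}$ is a diffeomorphism of $G$, and $\mathrm{Exp}\circ s=S^{-1}\circ\mathrm{Exp}$ on $\mathcal{W}\times\mathbb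{R}_+$.
   Context: $\mathfrak{g}=T_{\mathrm{id}}G$, $\mathfrak{g}^*=T^*_{\mathrm{id}}G$, $\pi:T^*G\to G$ is the projection, $L_g$ is the left shift by $g$. The left trivialization is $\tau:G\times\mathfrak{g}^*\to T^*G$, $\tau(g,p)=(dL_{g^{-1}})^*p\in T^*_gG$. A left-invariant Hamiltonian $H:T^*G\to\mathbb{R}$ satisfies $H(\tau(g,p))=H(p)$ and is identified with a function $H\in C^\infty(\mathfrak{g}^* )$. The Hamiltonian vector field $\vec{H}$ on $T^*G$ (canonical symplectic structure) has the form $\vec{H}(\tau(g,p))=d_{(g,p)}\tau\,(\vec{H}_{\mathrm{hor}}(g,p)+\vec{H}_{\mathrm{vert}}(p))$ with horizontal part $\vec{H}_{\mathrm{hor}}(g,p)=dL_g\,d_pH$ and vertical part $\vec{H}_{\mathrm{vert}}(p)=(\mathrm{ad}^*d_pH)p$, where $d_pH\in T^*_p\mathfrak{g}^*\simeq\mathfrak{g}$ and $(\mathrm{ad}^*\xi)p=p\circ\mathrm{ad}\,\xi$. Thus $\vec{H}_{\mathrm{vert}}$ is a vector field on $\mathfrak{g}^*$. $e^{t\vec{V}}$ denotes the flow of a vector field $\vec{V}$; the flow of $\vec{H}$ is assumed to be defined for all positive times. The exponential map is $\mathrm{Exp}:\mathfrak{g}^*\times\mathbb{R}_+\to G$, $\mathrm{Exp}(p,t)=\pi\circ e^{t\vec{H}}(\mathrm{id},p)$. A symmetry of the exponential map is a pair of diffeomorphisms $s:\mathcal{W}\times\mathbb{R}_+\to\mathcal{W}\times\mathbb{R}_+$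 and $S':G\to G$, where $\mathcal{W}\subset\mathfrak{g}^*$ is an open dense subset, such that $\mathrm{Exp}\circ s=S'\circ\mathrm{Exp}$. $\sigma^*(\vec{H}_{\mathrm{vert}})=\pm\vec{H}_{\mathrm{vert}}$ refers to the push-forward of the vector field by the linear map $\sigma^*$, i.e. $\sigma^*(\vec{H}_{\mathrm{vert}}(p))=\pm\vec{H}_{\mathrm{vert}}(\sigma^*p)$ for all $p$. An anti-automorphism of $\mathfrak{g}$ is a linear isomorphism with $\sigma[\xi,\eta]=-[\sigma\xi,\sigma\eta]$; an anti-automorphism of $G$ is a diffeomorphism with $S(gh)=S(h)S(g)$. The stabilizer of $p\in\mathfrak{g}^*$ is $G_p=\{g\in G\mid (\mathrm{Ad}^*g)p=p\}$, where $(\mathrm{Ad}^*g)p=p\circ\mathrm{Ad}(g^{-1})$. "Generic" means: for all $p$ in some open dense subset of $\mathfrak{g}^*$. *)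

theory Defs
  imports "HOL-Analysis.Analysis" "HOL-Algebra.Group"
begin

section \<open>Smooth maps between normed spaces\<close>

text \<open>
  These notions are only used on open subsets of finite-dimensional spaces, where continuity
  of all iterated directional derivatives (together with differentiability at every stage)
  is the usual notion of class \<open>C\<^sup>k\<close>.
\<close>

primrec Ck_on :: "nat \<Rightarrow> 'a::real_normed_vector set \<Rightarrow> ('a \<Rightarrow> 'b::real_normed_vector) \<Rightarrow> bool" where
  "Ck_on 0 S f \<longleftrightarrow> continuous_on S f"
| "Ck_on (Suc k) S f \<longleftrightarrow>
     (\<forall>x\<in>S. f differentiable at x) \<and> (\<forall>v. Ck_on k S (\<lambda>x. frechet_derivative f (at x) v))"

definition smooth_on :: "'a::real_normed_vector set \<Rightarrow> ('a \<Rightarrow> 'b::real_normed_vector) \<Rightarrow> bool" where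
  "smooth_on S f \<longleftrightarrow> (\<forall>k. Ck_on k S f)"

definition diffeomorphism_onto_self :: "'a::real_normed_vector set \<Rightarrow> ('a \<Rightarrow> 'a) \<Rightarrow> bool" where
  "diffeomorphism_onto_self X f \<longleftrightarrow>
     bij_betw f X X \<and> smooth_on X f \<and> smooth_on X (inv_into X f)"


section \<open>Manifolds given by atlases\<close>

text \<open>
  A chart is a pair of its domain and its coordinate map; the values of the coordinate map
  outside the domain are irrelevant.
\<close>

type_synonym ('m, 'e) chart = "'m set \<times> ('m \<Rightarrow> 'e)"

abbreviation chart_inv :: "('m, 'e) chart \<Rightarrow> 'e \<Rightarrow> 'm" where
  "chart_inv c \<equiv> inv_into (fst c) (snd c)"

definition topological_chart ::
    "('m::topological_space, 'e::real_normed_vector) chart \<Rightarrow> bool" where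
  "topological_chart c \<longleftrightarrow> open (fst c) \<and> open (snd c ` fst c) \<and>
     homeomorphism (fst c) (snd c ` fst c) (snd c) (chart_inv c)"

definition smooth_transition ::
    "('m, 'e::real_normed_vector) chart \<Rightarrow> ('m, 'e) chart \<Rightarrow> bool" where
  "smooth_transition c d \<longleftrightarrow>
     smooth_on (snd c ` (fst c \<inter> fst d)) (snd d \<circ> chart_inv c)"

definition smooth_atlas ::
    "('m::topological_space, 'e::real_normed_vector) chart set \<Rightarrow> bool" where
  "smooth_atlas A \<longleftrightarrow> (\<forall>c\<in>A. topological_chart c) \<and> (\<Union>c\<in>A. fst c) = UNIV \<and>
     (\<forall>c\<in>A. \<forall>d\<in>A. smooth_transition c d)"

definition maximal_atlas ::
    "('m::topological_space, 'e::real_normed_vector) chart set \<Rightarrow> ('m, 'e) chart set" where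
  "maximal_atlas A = {c. topological_chart c \<and>
     (\<forall>d\<in>A. smooth_transition c d \<and> smooth_transition d c)}"

definition prod_atlas ::
    "('m, 'e) chart set \<Rightarrow> ('n, 'f) chart set \<Rightarrow> ('m \<times> 'n, 'e \<times> 'f) chart set" where
  "prod_atlas A B = {(fst c \<times> fst d, map_prod (snd c) (snd d)) | c d. c \<in> A \<and> d \<in> B}"

abbreviation vector_space_atlas :: "('e, 'e) chart set" where
  "vector_space_atlas \<equiv> {(UNIV, id)}"

text \<open>
  The openness requirement expresses continuity in the topology defined by the atlases. This
  matters for the cotangent bundle below, whose topology is not the product topology of the
  type that represents it.
\<close>

definition smooth_map :: "('m, 'e::real_normed_vector) chart set \<Rightarrow>
    ('n, 'f::real_normed_vector) chart set \<Rightarrow> ('m \<Rightarrow> 'n) \<Rightarrow> bool" where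
  "smooth_map A B f \<longleftrightarrow> (\<forall>c\<in>A. \<forall>d\<in>B.
     open (snd c ` (fst c \<inter> f -` fst d)) \<and>
     smooth_on (snd c ` (fst c \<inter> f -` fst d)) (snd d \<circ> f \<circ> chart_inv c))"

definition diffeomorphism :: "('m, 'e::real_normed_vector) chart set \<Rightarrow> ('m \<Rightarrow> 'm) \<Rightarrow> bool" where
  "diffeomorphism A f \<longleftrightarrow> bij f \<and> smooth_map A A f \<and> smooth_map A A (inv_into UNIV f)"

text \<open>Embedded submanifolds of dimension \<open>k\<close>, by slice charts.\<close>

definition embedded_submanifold ::
    "('m::topological_space, 'e::real_normed_vector) chart set \<Rightarrow> nat \<Rightarrow> 'm set \<Rightarrow> bool" where
  "embedded_submanifold A k N \<longleftrightarrow> (\<forall>x\<in>N. \<exists>c\<in>maximal_atlas A. x \<in> fst c \<and>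
     (\<exists>V. subspace V \<and> dim V = k \<and> snd c ` (fst c \<inter> N) = snd c ` fst c \<inter> V))"


section \<open>Tangent and cotangent vectors\<close>

text \<open>
  At every point \<open>x\<close> one chart of the atlas is chosen, and the tangent space at \<open>x\<close> is
  the model space, read in this chart. A tangent vector \<open>v\<close> at \<open>x\<close> has in a chart \<open>c\<close> the
  coordinates \<open>coord_change (chart_at A x) c x v\<close>.
\<close>

definition chart_at :: "('m, 'e) chart set \<Rightarrow> 'm \<Rightarrow> ('m, 'e) chart" where
  "chart_at A x = (SOME c. c \<in> A \<and> x \<in> fst c)"

definition coord_change :: "('m, 'e::real_normed_vector) chart \<Rightarrow> ('m, 'e) chart \<Rightarrow> 'm \<Rightarrow>
    'e \<Rightarrow>\<^sub>L 'e" where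
  "coord_change c d x = Blinfun (frechet_derivative (snd d \<circ> chart_inv c) (at (snd c x)))"

definition tangent_map :: "('m, 'e::real_normed_vector) chart set \<Rightarrow>
    ('n, 'f::real_normed_vector) chart set \<Rightarrow> ('m \<Rightarrow> 'n) \<Rightarrow> 'm \<Rightarrow> 'e \<Rightarrow>\<^sub>L 'f" where
  "tangent_map A B f x =
     Blinfun (frechet_derivative (snd (chart_at B (f x)) \<circ> f \<circ> chart_inv (chart_at A x))
       (at (snd (chart_at A x) x)))"

definition field_in_chart :: "('m, 'e::real_normed_vector) chart set \<Rightarrow> ('m, 'e) chart \<Rightarrow>
    ('m \<Rightarrow> 'e) \<Rightarrow> 'e \<Rightarrow> 'e" where
  "field_in_chart A c X q =
     (let x = chart_inv c q in blinfun_apply (coord_change (chart_at A x) c x) (X x))"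

definition field_bracket :: "('m, 'e::real_normed_vector) chart set \<Rightarrow>
    ('m \<Rightarrow> 'e) \<Rightarrow> ('m \<Rightarrow> 'e) \<Rightarrow> 'm \<Rightarrow> 'e" where
  "field_bracket A X Y x =
     (let c = chart_at A x; q = snd c x; X' = field_in_chart A c X; Y' = field_in_chart A c Y
      in frechet_derivative Y' (at q) (X' q) - frechet_derivative X' (at q) (Y' q))"

text \<open>
  A cotangent vector is a pair of a base point and a functional on the tangent space there.
  A chart with coordinates \<open>q\<close> induces the canonical coordinates \<open>(q, a)\<close>, the covector being
  \<open>\<Sum>i. a\<^sub>i dq\<^sub>i\<close>.
\<close>

definition cotangent_chart :: "('m, 'e::real_normed_vector) chart set \<Rightarrow> ('m, 'e) chart \<Rightarrow>
    ('m \<times> ('e \<Rightarrow>\<^sub>L real), 'e \<times> ('e \<Rightarrow>\<^sub>L real)) chart" where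
  "cotangent_chart A c =
     (fst c \<times> UNIV, \<lambda>(x, \<alpha>). (snd c x, \<alpha> o\<^sub>L coord_change c (chart_at A x) x))"

definition cotangent_atlas :: "('m, 'e::real_normed_vector) chart set \<Rightarrow>
    ('m \<times> ('e \<Rightarrow>\<^sub>L real), 'e \<times> ('e \<Rightarrow>\<^sub>L real)) chart set" where
  "cotangent_atlas A = cotangent_chart A ` A"


section \<open>Flows and Hamiltonian vector fields\<close>

text \<open>
  In this section a vector field assigns to a chart and a point the coordinates, in that
  chart, of its value at the point. Integral curves are continuous in the topology defined by
  the atlas.
\<close>

definition integral_curve :: "('m, 'e::real_normed_vector) chart set \<Rightarrow>
    (('m, 'e) chart \<Rightarrow> 'm \<Rightarrow> 'e) \<Rightarrow> real set \<Rightarrow> (real \<Rightarrow> 'm) \<Rightarrow> bool" where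
  "integral_curve A X I \<gamma> \<longleftrightarrow> (\<forall>t\<in>I. \<forall>c\<in>A. \<gamma> t \<in> fst c \<longrightarrow>
     (\<forall>\<^sub>F u in at t within I. \<gamma> u \<in> fst c) \<and>
     ((snd c \<circ> \<gamma>) has_vector_derivative X c (\<gamma> t)) (at t within I))"

text \<open>For \<open>t \<ge> 0\<close> this is the flow \<open>e\<^sup>t\<^sup>X\<close>.\<close>

definition flow :: "('m, 'e::real_normed_vector) chart set \<Rightarrow>
    (('m, 'e) chart \<Rightarrow> 'm \<Rightarrow> 'e) \<Rightarrow> real \<Rightarrow> 'm \<Rightarrow> 'm" where
  "flow A X t x = (THE y. \<exists>\<gamma>. integral_curve A X {0..t} \<gamma> \<and> \<gamma> 0 = x \<and> \<gamma> t = y)"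

definition forward_complete :: "('m, 'e::real_normed_vector) chart set \<Rightarrow>
    (('m, 'e) chart \<Rightarrow> 'm \<Rightarrow> 'e) \<Rightarrow> bool" where
  "forward_complete A X \<longleftrightarrow> (\<forall>x. \<exists>\<gamma>. integral_curve A X {0..} \<gamma> \<and> \<gamma> 0 = x)"

text \<open>
  The canonical symplectic form in canonical coordinates \<open>(q, a)\<close>. The sign of the form and of
  \<open>\<omega>(X, \<cdot>) = dF\<close> is the one that gives \<open>q' = \<partial>F/\<partial>a\<close>, \<open>a' = - \<partial>F/\<partial>q\<close>.
\<close>

definition canonical_form ::
    "'e::real_normed_vector \<times> ('e \<Rightarrow>\<^sub>L real) \<Rightarrow> 'e \<times> ('e \<Rightarrow>\<^sub>L real) \<Rightarrow> real" where
  "canonical_form X Y = blinfun_apply (snd Y) (fst X) - blinfun_apply (snd X) (fst Y)"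

definition hamiltonian_field :: "('m \<times> ('e::real_normed_vector \<Rightarrow>\<^sub>L real) \<Rightarrow> real) \<Rightarrow>
    ('m \<times> ('e \<Rightarrow>\<^sub>L real), 'e \<times> ('e \<Rightarrow>\<^sub>L real)) chart \<Rightarrow> 'm \<times> ('e \<Rightarrow>\<^sub>L real) \<Rightarrow>
    'e \<times> ('e \<Rightarrow>\<^sub>L real)" where
  "hamiltonian_field F c z =
     (THE X. \<forall>Y. canonical_form X Y = frechet_derivative (F \<circ> chart_inv c) (at (snd c z)) Y)"


section \<open>Lie groups\<close>

record ('g, 'e) smooth_group = "'g monoid" +
  atlas :: "('g, 'e) chart set"

text \<open>
  The model space is an arbitrary finite-dimensional inner product space rather than a
  \<^class>\<open>euclidean_space\<close>, so that zero-dimensional groups are included. Its inner product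
  plays no role (all norms on it are equivalent).
\<close>

locale lie_group = group G
  for G :: "('g::{t2_space, second_countable_topology}, 'e::{real_inner, banach}) smooth_group"
    (structure) +
  assumes carrier_UNIV: "carrier G = UNIV"
    and finite_dimensional: "\<exists>B::'e set. finite B \<and> span B = UNIV"
    and smooth_atlas: "smooth_atlas (atlas G)"
    and smooth_mult:
      "smooth_map (prod_atlas (atlas G) (atlas G)) (atlas G) (\<lambda>(g, h). g \<otimes> h)"
    and smooth_inverse: "smooth_map (atlas G) (atlas G) (\<lambda>g. m_inv G g)"

text \<open>
  From here on the type \<open>'e\<close> also represents the Lie algebra, that is the tangent space at
  the unit, and \<open>'e \<Rightarrow>\<^sub>L real\<close> represents its dual.
\<close>

definition d_left :: "('g, 'e::real_normed_vector) smooth_group \<Rightarrow> 'g \<Rightarrow> 'g \<Rightarrow> 'e \<Rightarrow>\<^sub>L 'e" where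
  "d_left G g = tangent_map (atlas G) (atlas G) (\<lambda>h. g \<otimes>\<^bsub>G\<^esub> h)"

definition left_invariant_field ::
    "('g, 'e::real_normed_vector) smooth_group \<Rightarrow> 'e \<Rightarrow> 'g \<Rightarrow> 'e" where
  "left_invariant_field G \<xi> g = blinfun_apply (d_left G g \<one>\<^bsub>G\<^esub>) \<xi>"

definition lie_bracket :: "('g, 'e::real_normed_vector) smooth_group \<Rightarrow> 'e \<Rightarrow> 'e \<Rightarrow> 'e" where
  "lie_bracket G \<xi> \<eta> =
     field_bracket (atlas G) (left_invariant_field G \<xi>) (left_invariant_field G \<eta>) \<one>\<^bsub>G\<^esub>"

definition ad :: "('g, 'e::real_normed_vector) smooth_group \<Rightarrow> 'e \<Rightarrow> 'e \<Rightarrow>\<^sub>L 'e" where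
  "ad G \<xi> = Blinfun (lie_bracket G \<xi>)"

definition Ad :: "('g, 'e::real_normed_vector) smooth_group \<Rightarrow> 'g \<Rightarrow> 'e \<Rightarrow>\<^sub>L 'e" where
  "Ad G g = tangent_map (atlas G) (atlas G) (\<lambda>h. g \<otimes>\<^bsub>G\<^esub> h \<otimes>\<^bsub>G\<^esub> m_inv G g) \<one>\<^bsub>G\<^esub>"

definition stabilizer ::
    "('g, 'e::real_normed_vector) smooth_group \<Rightarrow> ('e \<Rightarrow>\<^sub>L real) \<Rightarrow> 'g set" where
  "stabilizer G p = {g. p o\<^sub>L Ad G (m_inv G g) = p}"

text \<open>
  Stabilizers are closed subgroups, hence embedded submanifolds, so the existence of some
  \<open>k \<le> 1\<close> below only restricts the dimension.
\<close>

definition generic_stabilizer_connected_dim_le_1 ::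
    "('g::topological_space, 'e::real_normed_vector) smooth_group \<Rightarrow> bool" where
  "generic_stabilizer_connected_dim_le_1 G \<longleftrightarrow>
     (\<exists>D. open D \<and> closure D = UNIV \<and> (\<forall>p\<in>D. connected (stabilizer G p) \<and>
        (\<exists>k\<le>1. embedded_submanifold (atlas G) k (stabilizer G p))))"

definition lie_algebra_automorphism ::
    "('g, 'e::real_normed_vector) smooth_group \<Rightarrow> ('e \<Rightarrow>\<^sub>L 'e) \<Rightarrow> bool" where
  "lie_algebra_automorphism G \<sigma> \<longleftrightarrow> bij (blinfun_apply \<sigma>) \<and>
     (\<forall>\<xi> \<eta>. blinfun_apply \<sigma> (lie_bracket G \<xi> \<eta>) =
        lie_bracket G (blinfun_apply \<sigma> \<xi>) (blinfun_apply \<sigma> \<eta>))"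

definition lie_algebra_anti_automorphism ::
    "('g, 'e::real_normed_vector) smooth_group \<Rightarrow> ('e \<Rightarrow>\<^sub>L 'e) \<Rightarrow> bool" where
  "lie_algebra_anti_automorphism G \<sigma> \<longleftrightarrow> bij (blinfun_apply \<sigma>) \<and>
     (\<forall>\<xi> \<eta>. blinfun_apply \<sigma> (lie_bracket G \<xi> \<eta>) =
        - lie_bracket G (blinfun_apply \<sigma> \<xi>) (blinfun_apply \<sigma> \<eta>))"

definition lie_group_automorphism ::
    "('g, 'e::real_normed_vector) smooth_group \<Rightarrow> ('g \<Rightarrow> 'g) \<Rightarrow> bool" where
  "lie_group_automorphism G S \<longleftrightarrow> diffeomorphism (atlas G) S \<and>
     (\<forall>g h. S (g \<otimes>\<^bsub>G\<^esub> h) = S g \<otimes>\<^bsub>G\<^esub> S h)"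

definition lie_group_anti_automorphism ::
    "('g, 'e::real_normed_vector) smooth_group \<Rightarrow> ('g \<Rightarrow> 'g) \<Rightarrow> bool" where
  "lie_group_anti_automorphism G S \<longleftrightarrow> diffeomorphism (atlas G) S \<and>
     (\<forall>g h. S (g \<otimes>\<^bsub>G\<^esub> h) = S h \<otimes>\<^bsub>G\<^esub> S g)"


section \<open>Left-invariant Hamiltonians and the exponential map\<close>

definition left_trivialization :: "('g, 'e::real_normed_vector) smooth_group \<Rightarrow>
    'g \<times> ('e \<Rightarrow>\<^sub>L real) \<Rightarrow> 'g \<times> ('e \<Rightarrow>\<^sub>L real)" where
  "left_trivialization G = (\<lambda>(g, p). (g, p o\<^sub>L d_left G (m_inv G g) g))"

definition left_invariant_hamiltonian :: "('g, 'e::real_normed_vector) smooth_group \<Rightarrow>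
    ('g \<times> ('e \<Rightarrow>\<^sub>L real) \<Rightarrow> real) \<Rightarrow> bool" where
  "left_invariant_hamiltonian G H \<longleftrightarrow>
     smooth_map (cotangent_atlas (atlas G)) vector_space_atlas H \<and>
     (\<forall>g p. H (left_trivialization G (g, p)) = H (\<one>\<^bsub>G\<^esub>, p))"

text \<open>
  The derivative of a function on the dual space, as an element of the Lie algebra by
  reflexivity.
\<close>

definition dual_gradient ::
    "(('e::real_normed_vector \<Rightarrow>\<^sub>L real) \<Rightarrow> real) \<Rightarrow> ('e \<Rightarrow>\<^sub>L real) \<Rightarrow> 'e" where
  "dual_gradient h p = (THE \<xi>. \<forall>q. frechet_derivative h (at p) q = blinfun_apply q \<xi>)"

definition vertical_field :: "('g, 'e::real_normed_vector) smooth_group \<Rightarrow>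
    ('g \<times> ('e \<Rightarrow>\<^sub>L real) \<Rightarrow> real) \<Rightarrow> ('e \<Rightarrow>\<^sub>L real) \<Rightarrow> ('e \<Rightarrow>\<^sub>L real)" where
  "vertical_field G H p = p o\<^sub>L ad G (dual_gradient (\<lambda>q. H (\<one>\<^bsub>G\<^esub>, q)) p)"

definition vertical_flow :: "('g, 'e::real_normed_vector) smooth_group \<Rightarrow>
    ('g \<times> ('e \<Rightarrow>\<^sub>L real) \<Rightarrow> real) \<Rightarrow> real \<Rightarrow> ('e \<Rightarrow>\<^sub>L real) \<Rightarrow> ('e \<Rightarrow>\<^sub>L real)" where
  "vertical_flow G H = flow vector_space_atlas (\<lambda>_. vertical_field G H)"

definition Exp :: "('g, 'e::real_normed_vector) smooth_group \<Rightarrow>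
    ('g \<times> ('e \<Rightarrow>\<^sub>L real) \<Rightarrow> real) \<Rightarrow> ('e \<Rightarrow>\<^sub>L real) \<times> real \<Rightarrow> 'g" where
  "Exp G H = (\<lambda>(p, t).
     fst (flow (cotangent_atlas (atlas G)) (hamiltonian_field H) t (\<one>\<^bsub>G\<^esub>, p)))"

definition exp_symmetry :: "('g, 'e::real_normed_vector) smooth_group \<Rightarrow>
    ('g \<times> ('e \<Rightarrow>\<^sub>L real) \<Rightarrow> real) \<Rightarrow>
    (('e \<Rightarrow>\<^sub>L real) \<times> real \<Rightarrow> ('e \<Rightarrow>\<^sub>L real) \<times> real) \<Rightarrow> ('g \<Rightarrow> 'g) \<Rightarrow> bool" where
  "exp_symmetry G H s S' \<longleftrightarrow>
     (\<exists>W. open W \<and> closure W = UNIV \<and>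
        diffeomorphism_onto_self (W \<times> {0<..}) s \<and>
        diffeomorphism (atlas G) S' \<and>
        (\<forall>z \<in> W \<times> {0<..}. Exp G H (s z) = S' (Exp G H z)))"

end

theory Submission
  imports Defs
begin

text \<open>
  In the left trivialization a trajectory of the Hamiltonian field is a pair \<open>(g, p)\<close> with
  \<open>p' = p \<circ> ad \<xi>\<close> and \<open>g' = dL\<^sub>g \<xi>\<close>, where \<open>\<xi>\<close> is the gradient of the fiber Hamiltonian at \<open>p\<close>.
  Let \<open>T\<close> be the inverse of \<open>S\<close>. Invariance of the Hamiltonian under \<open>\<sigma>\<close> means that \<open>dT\<close> maps the
  gradient at \<open>p\<close> to the gradient at \<open>p \<circ> \<sigma>\<close>. In case (a), \<open>(T \<circ> g, p \<circ> \<sigma>)\<close> is therefore again a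
  trajectory. In case (b), the trajectory \<open>(k, q)\<close> that starts at \<open>p(t) \<circ> \<sigma>\<close> has \<open>q(u) = p(t - u) \<circ> \<sigma>\<close>,
  so \<open>k(u)\<close> has left velocity \<open>dT \<xi>(t - u)\<close> while \<open>T(g(t - u))\<close> has the opposite right velocity;
  hence the product \<open>k(u) T(g(t - u))\<close> is constant, and comparing \<open>u = 0\<close> with \<open>u = t\<close> gives
  \<open>k(t) = T(g(t))\<close>. One can take the whole dual space for \<open>W\<close>, because the vertical flow depends
  smoothly on the initial covector and is also defined for negative times: \<open>\<sigma>\<close> reverses it.
\<close>

text \<open>The flows in the statement are definite descriptions over charts of the cotangent
  bundle, so each use of them needs existence and uniqueness of end points. Completeness supplies
  the trajectories. Uniqueness is obtained in triangular order: the momentum obeys an autonomous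
  equation on a vector space, and the group component is then a curve with prescribed left velocity.
  That this determines it rests on the constancy of a product, the same fact that gives case (b).
  Much of the analysis serves one point, the smoothness of \<open>s\<close> in case (b), jointly in
  covector and time. It is derived from Gronwall estimates for curves whose existence is already
  known: difference quotients converge to solutions of the variational equation, and the class of
  differentiability rises by one in each round. Smoothness is phrased by iterated directional
  derivatives on spaces that are not of a Euclidean type, so finite frames carry all coordinate
  computations.\<close>

section \<open>Finite frames\<close>

text \<open>A resolution of the identity by rank-one operators. Independence of the
  \<open>b i\<close> is never asked for, so frames pass to products and to the dual by rearranging
  this identity, and n = 0 covers the zero space.\<close>

definition frame :: "nat \<Rightarrow> (nat \<Rightarrow> 'a::real_normed_vector) \<Rightarrow> (nat \<Rightarrow> 'a \<Rightarrow>\<^sub>L real) \<Rightarrow> bool" where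
  "frame n b \<beta> \<longleftrightarrow> (\<forall>x. (\<Sum>i<n. blinfun_apply (\<beta> i) x *\<^sub>R b i) = x)"

lemma frameD: "frame n b \<beta> \<Longrightarrow> (\<Sum>i<n. blinfun_apply (\<beta> i) x *\<^sub>R b i) = x"
  by (auto simp: frame_def)

lemma frame_exI:
  fixes c :: "'i \<Rightarrow> 'a::real_normed_vector"
  assumes "finite I" and eq: "\<And>x. (\<Sum>i\<in>I. blinfun_apply (\<gamma> i) x *\<^sub>R c i) = x"
  shows "\<exists>n b \<beta>. frame n (b :: nat \<Rightarrow> 'a) \<beta>"
proof -
  obtain h where h: "bij_betw h {..<card I} I"
    using ex_bij_betw_nat_finite[OF \<open>finite I\<close>] by (auto simp: atLeast0LessThan)
  have "frame (card I) (c \<circ> h) (\<gamma> \<circ> h)"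
    unfolding frame_def using sum.reindex_bij_betw[OF h, of "\<lambda>i. blinfun_apply (\<gamma> i) _ *\<^sub>R c i"] eq
    by simp
  then show ?thesis by blast
qed

lemma frame_inner_ex:
  fixes B :: "'e::real_inner set"
  assumes "finite B" "span B = UNIV"
  shows "\<exists>n b \<beta>. frame n (b :: nat \<Rightarrow> 'e) \<beta>"
proof -
  obtain C :: "'e set" where C: "finite C" "span C = UNIV" "pairwise orthogonal C"
    using basis_orthogonal[OF assms(1)] assms(2) by auto
  \<comment> \<open>The orthogonal family may contain 0; by \<open>inverse 0 = 0\<close> that vector
    simply gets the coordinate 0.\<close>
  define \<gamma> where "\<gamma> c = inverse (c \<bullet> c) *\<^sub>R blinfun_inner_left c" for c :: 'e
  have \<gamma>: "blinfun_apply (\<gamma> c) x = (x \<bullet> c) / (c \<bullet> c)" for c x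
    by (simp add: \<gamma>_def scaleR_blinfun.rep_eq divide_inverse inner_commute)
  have "(\<Sum>c\<in>C. blinfun_apply (\<gamma> c) x *\<^sub>R c) = x" for x
  proof -
    \<comment> \<open>The error of the expansion is orthogonal to C and lies in its span, hence is
      orthogonal to itself.\<close>
    let ?y = "x - (\<Sum>c\<in>C. blinfun_apply (\<gamma> c) x *\<^sub>R c)"
    have *: "?y \<bullet> d = 0" if "d \<in> C" for d
    proof -
      have "(\<Sum>c\<in>C. blinfun_apply (\<gamma> c) x *\<^sub>R c) \<bullet> d = (\<Sum>c\<in>C. blinfun_apply (\<gamma> c) x * (c \<bullet> d))"
        by (simp add: inner_sum_left)
      also have "\<dots> = (\<Sum>c\<in>C. if c = d then x \<bullet> d else 0)"
        using C(3) that by (intro sum.cong) (auto simp: \<gamma> pairwise_def orthogonal_def)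
      finally show ?thesis using that C(1) by (simp add: inner_diff_left)
    qed
    have "?y \<in> span C" using C(2) by simp
    then have "orthogonal ?y ?y"
      by (rule orthogonal_to_span) (simp only: orthogonal_def *)
    then show ?thesis by (simp add: orthogonal_def)
  qed
  with \<open>finite C\<close> show ?thesis by (rule frame_exI)
qed

lemma frame_prod_ex:
  assumes "\<exists>n b \<beta>. frame n (b :: nat \<Rightarrow> 'a::real_normed_vector) \<beta>"
    and "\<exists>n b \<beta>. frame n (b :: nat \<Rightarrow> 'b::real_normed_vector) \<beta>"
  shows "\<exists>n b \<beta>. frame n (b :: nat \<Rightarrow> 'a \<times> 'b) \<beta>"
proof -
  obtain n b \<beta> m c \<gamma> where F: "frame n (b :: nat \<Rightarrow> 'a) \<beta>" and G: "frame m (c :: nat \<Rightarrow> 'b) \<gamma>"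
    using assms by blast
  have "(\<Sum>i\<in>{..<n} <+> {..<m}.
      blinfun_apply (case i of Inl i \<Rightarrow> \<beta> i o\<^sub>L fst_blinfun | Inr j \<Rightarrow> \<gamma> j o\<^sub>L snd_blinfun) x *\<^sub>R
      (case i of Inl i \<Rightarrow> (b i, 0) | Inr j \<Rightarrow> (0, c j))) = x" for x
  proof -
    have "(\<Sum>i<n. blinfun_apply (\<beta> i) (fst x) *\<^sub>R (b i, 0 :: 'b)) = (fst x, 0)"
      using frameD[OF F, of "fst x"] by (simp add: sum_prod)
    moreover have "(\<Sum>i<m. blinfun_apply (\<gamma> i) (snd x) *\<^sub>R (0 :: 'a, c i)) = (0, snd x)"
      using frameD[OF G, of "snd x"] by (simp add: sum_prod)
    ultimately show ?thesis by (simp add: sum.Plus)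
  qed
  from frame_exI[OF _ this] show ?thesis by simp
qed

lemma frame_real_ex: "\<exists>n b \<beta>. frame n (b :: nat \<Rightarrow> real) \<beta>"
  by (rule frame_exI[of "{()}" "\<lambda>_. id_blinfun" "\<lambda>_. 1"]) auto

text \<open>Apply p to the expansion of x. Read the other way, evaluations at the \<open>b i\<close>
  are coordinates on the dual, which makes the \<open>\<beta> i\<close> a frame there.\<close>

lemma blinfun_eq_sum_frame:
  assumes "frame n b \<beta>"
  shows "p = (\<Sum>i<n. blinfun_apply p (b i) *\<^sub>R \<beta> i)"
proof (rule blinfun_eqI)
  fix x
  have "blinfun_apply p x = blinfun_apply p (\<Sum>i<n. blinfun_apply (\<beta> i) x *\<^sub>R b i)"
    by (simp add: frameD[OF assms])
  also have "\<dots> = blinfun_apply (\<Sum>i<n. blinfun_apply p (b i) *\<^sub>R \<beta> i) x"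
    by (simp add: blinfun.sum_right blinfun.sum_left blinfun.scaleR_right blinfun.scaleR_left mult.commute)
  finally show "blinfun_apply p x = blinfun_apply (\<Sum>i<n. blinfun_apply p (b i) *\<^sub>R \<beta> i) x" .
qed

lemma frame_dual_ex:
  assumes "frame n (b :: nat \<Rightarrow> 'a::real_normed_vector) \<beta>"
  shows "\<exists>n c \<gamma>. frame n (c :: nat \<Rightarrow> 'a \<Rightarrow>\<^sub>L real) \<gamma>"
proof (rule frame_exI)
  have ev: "bounded_linear (\<lambda>p :: 'a \<Rightarrow>\<^sub>L real. blinfun_apply p v)" for v
    by (rule blinfun.bounded_linear_left)
  show "(\<Sum>i\<in>{..<n}. blinfun_apply (Blinfun (\<lambda>p. blinfun_apply p (b i))) p *\<^sub>R \<beta> i) = p" for p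
    using blinfun_eq_sum_frame[OF assms, of p] by (simp add: bounded_linear_Blinfun_apply[OF ev])
qed simp

text \<open>Separates a moving argument from fixed directions: a derivative applied to a vector that
  depends on the point becomes a sum of scalar functions times directional derivatives, the form
  that \<open>Ck_on\<close> speaks about.\<close>

lemma linear_frame_eq:
  assumes "frame n b \<beta>" "linear f"
  shows "f x = (\<Sum>i<n. blinfun_apply (\<beta> i) x *\<^sub>R f (b i))"
proof -
  have "f x = f (\<Sum>i<n. blinfun_apply (\<beta> i) x *\<^sub>R b i)" by (simp add: frameD[OF assms(1)])
  then show ?thesis by (simp add: linear_sum[OF assms(2)] linear_cmul[OF assms(2)])
qed


section \<open>Calculus of \<open>C\<^sup>k\<close> maps\<close>

text \<open>A derivative at x sees a whole neighbourhood of x, so agreement on S is inherited by the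
  derivatives because S is open.\<close>

lemma Ck_on_transform:
  assumes "open S" "\<And>x. x \<in> S \<Longrightarrow> f x = g x" "Ck_on k S f"
  shows "Ck_on k S g"
  using assms(2,3)
proof (induction k arbitrary: f g)
  case 0
  then show ?case by (auto intro: continuous_on_eq)
next
  case (Suc k)
  have d: "(g has_derivative frechet_derivative f (at x)) (at x)" if "x \<in> S" for x
    using Suc.prems that assms(1)
    by (metis Ck_on.simps(2) frechet_derivative_works[THEN iffD1] has_derivative_transform_within_open)
  have e: "frechet_derivative f (at x) = frechet_derivative g (at x)" if "x \<in> S" for x
    using frechet_derivative_at[OF d[OF that]] by simp
  have "Ck_on k S (\<lambda>x. frechet_derivative g (at x) v)" for v
    by (rule Suc.IH[of "\<lambda>x. frechet_derivative f (at x) v"]) (use Suc.prems e in auto)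
  with d show ?case by (auto simp: differentiable_def)
qed

lemma Ck_on_subset: "Ck_on k T f \<Longrightarrow> S \<subseteq> T \<Longrightarrow> Ck_on k S f"
  by (induction k arbitrary: f) (auto intro: continuous_on_subset)

lemma smooth_on_transform:
  "open S \<Longrightarrow> (\<And>x. x \<in> S \<Longrightarrow> f x = g x) \<Longrightarrow> smooth_on S f \<Longrightarrow> smooth_on S g"
  unfolding smooth_on_def using Ck_on_transform[of S f g] by blast

lemma Ck_on_Suc_imp: "Ck_on (Suc k) S f \<Longrightarrow> Ck_on k S f"
proof (induction k arbitrary: f)
  case 0
  then show ?case
    by (auto intro!: differentiable_imp_continuous_within continuous_at_imp_continuous_on)
next
  case (Suc k)
  then show ?case by (auto simp del: Ck_on.simps(1))
qed

lemma Ck_on_has_derivative: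
  "Ck_on (Suc k) S f \<Longrightarrow> x \<in> S \<Longrightarrow> (f has_derivative frechet_derivative f (at x)) (at x)"
  by (auto intro: frechet_derivative_works[THEN iffD1])

lemma Ck_on_frechet: "Ck_on (Suc k) S f \<Longrightarrow> Ck_on k S (\<lambda>x. frechet_derivative f (at x) v)"
  by auto

text \<open>Induction step with any explicit formula for the derivative in place of
  \<open>frechet_derivative\<close>; uniqueness of derivatives identifies the two on S.\<close>

lemma Ck_on_SucI:
  assumes "open S" "\<And>x. x \<in> S \<Longrightarrow> (f has_derivative f' x) (at x)"
    and "\<And>v. Ck_on k S (\<lambda>x. f' x v)"
  shows "Ck_on (Suc k) S f"
proof -
  have "Ck_on k S (\<lambda>x. frechet_derivative f (at x) v)" for v
    by (rule Ck_on_transform[OF assms(1) _ assms(3)[of v]])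
      (use frechet_derivative_at[OF assms(2)] in metis)
  with assms(2) show ?thesis by (auto simp: differentiable_def)
qed

lemma smooth_on_Ck: "smooth_on S f \<Longrightarrow> Ck_on k S f"
  by (simp add: smooth_on_def)

lemma smooth_on_has_derivative:
  "smooth_on S f \<Longrightarrow> x \<in> S \<Longrightarrow> (f has_derivative frechet_derivative f (at x)) (at x)"
  by (rule Ck_on_has_derivative[OF smooth_on_Ck])

lemma smooth_on_frechet: "smooth_on S f \<Longrightarrow> smooth_on S (\<lambda>x. frechet_derivative f (at x) v)"
  unfolding smooth_on_def using Ck_on_frechet by blast

lemma Ck_on_const: "Ck_on k S (\<lambda>_. c)"
  by (induction k arbitrary: c) auto

lemma Ck_on_bounded_linear_comp:
  assumes "open S" "bounded_linear L" "Ck_on k S f"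
  shows "Ck_on k S (\<lambda>x. L (f x))"
  using assms(3)
proof (induction k arbitrary: f)
  case 0
  then show ?case by (auto intro: bounded_linear.continuous_on[OF assms(2)])
next
  case (Suc k)
  show ?case
    by (rule Ck_on_SucI[OF assms(1) bounded_linear.has_derivative[OF assms(2) Ck_on_has_derivative[OF Suc.prems]]])
      (use Suc in auto)
qed

lemma Ck_on_bounded_linear:
  assumes "open S" "bounded_linear L"
  shows "Ck_on k S L"
proof (cases k)
  case 0
  then show ?thesis by (auto intro: bounded_linear.continuous_on[OF assms(2)])
next
  case (Suc k')
  then show ?thesis
    using Ck_on_SucI[OF assms(1) bounded_linear_imp_has_derivative[OF assms(2)] Ck_on_const] by simp
qed

lemma Ck_on_add:
  assumes "open S" "Ck_on k S f" "Ck_on k S g"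
  shows "Ck_on k S (\<lambda>x. f x + g x)"
  using assms(2,3)
proof (induction k arbitrary: f g)
  case 0
  then show ?case by (auto intro: continuous_intros)
next
  case (Suc k)
  show ?case
    by (rule Ck_on_SucI[OF assms(1) has_derivative_add[OF Ck_on_has_derivative[OF Suc.prems(1)]
            Ck_on_has_derivative[OF Suc.prems(2)]]]) (use Suc in auto)
qed

lemma Ck_on_sum:
  assumes "open S" "\<And>i. i \<in> I \<Longrightarrow> Ck_on k S (f i)"
  shows "Ck_on k S (\<lambda>x. \<Sum>i\<in>I. f i x)"
  using assms(2)
  by (induction I rule: infinite_finite_induct) (auto intro: Ck_on_const Ck_on_add[OF assms(1)])

lemma Ck_on_scaleR:
  fixes a :: "'a::real_normed_vector \<Rightarrow> real"
  assumes "open S" "Ck_on k S a" "Ck_on k S f"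
  shows "Ck_on k S (\<lambda>x. a x *\<^sub>R f x)"
  using assms(2,3)
proof (induction k arbitrary: a f)
  case 0
  then show ?case by (auto intro: continuous_intros)
next
  case (Suc k)
  note ad = Suc.prems(1) and fd = Suc.prems(2)
  show ?case
  proof (rule Ck_on_SucI[OF assms(1) has_derivative_scaleR[OF Ck_on_has_derivative[OF ad] Ck_on_has_derivative[OF fd]]])
    fix v
    show "Ck_on k S (\<lambda>x. a x *\<^sub>R frechet_derivative f (at x) v + frechet_derivative a (at x) v *\<^sub>R f x)"
      using Ck_on_frechet[OF ad, of v] Ck_on_frechet[OF fd, of v] Ck_on_Suc_imp[OF ad] Ck_on_Suc_imp[OF fd]
      by (intro Ck_on_add[OF assms(1)] Suc.IH) auto
  qed
qed

lemma Ck_on_Pair: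
  assumes "open S" "Ck_on k S f" "Ck_on k S g"
  shows "Ck_on k S (\<lambda>x. (f x, g x))"
proof -
  have "Ck_on k S (\<lambda>x. (f x, 0) + (0, g x))"
    using assms
    by (intro Ck_on_add Ck_on_bounded_linear_comp[of S "\<lambda>y. (y, 0)"] Ck_on_bounded_linear_comp[of S "\<lambda>y. (0, y)"])
      (auto intro!: bounded_linear_Pair bounded_linear_ident bounded_linear_zero)
  then show ?thesis by simp
qed

text \<open>In the chain rule the derivative of f at g x acts on a direction that varies with x.
  Expanding that direction in the frame leaves products of a coefficient of the derivative of g with
  a derivative of f in a fixed direction, taken at g x; the latter falls under the induction
  hypothesis, which is general in f.\<close>

lemma Ck_on_compose:
  fixes g :: "'a::real_normed_vector \<Rightarrow> 'b::real_normed_vector" and f :: "'b \<Rightarrow> 'c::real_normed_vector"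
  assumes F: "frame n (b :: nat \<Rightarrow> 'b) \<beta>"
    and "open S" "open T" "\<And>x. x \<in> S \<Longrightarrow> g x \<in> T" "Ck_on k S g" "Ck_on k T f"
  shows "Ck_on k S (\<lambda>x. f (g x))"
  using assms(5,6)
proof (induction k arbitrary: f)
  case 0
  then show ?case using assms(4) by (auto intro: continuous_on_compose2)
next
  case (Suc k)
  note gd = Suc.prems(1) and fd = Suc.prems(2)
  have "((\<lambda>x. f (g x)) has_derivative
      (\<lambda>v. \<Sum>i<n. blinfun_apply (\<beta> i) (frechet_derivative g (at x) v) *\<^sub>R frechet_derivative f (at (g x)) (b i))) (at x)"
    if "x \<in> S" for x
  proof -
    have f': "(f has_derivative frechet_derivative f (at (g x))) (at (g x))"
      using Ck_on_has_derivative[OF fd] assms(4) that by blast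
    have "(\<lambda>v. frechet_derivative f (at (g x)) (frechet_derivative g (at x) v)) =
        (\<lambda>v. \<Sum>i<n. blinfun_apply (\<beta> i) (frechet_derivative g (at x) v) *\<^sub>R frechet_derivative f (at (g x)) (b i))"
      by (intro ext linear_frame_eq[OF F has_derivative_linear[OF f']])
    then show ?thesis
      using has_derivative_compose[OF Ck_on_has_derivative[OF gd that] f'] by simp
  qed
  then show ?case
  proof (rule Ck_on_SucI[OF assms(2)])
    fix v
    show "Ck_on k S (\<lambda>x. \<Sum>i<n. blinfun_apply (\<beta> i) (frechet_derivative g (at x) v) *\<^sub>R
        frechet_derivative f (at (g x)) (b i))"
      using Suc.IH Ck_on_frechet[OF gd] Ck_on_frechet[OF fd] Ck_on_Suc_imp[OF gd]
      by (intro Ck_on_sum[OF assms(2)] Ck_on_scaleR[OF assms(2)]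
          Ck_on_bounded_linear_comp[OF assms(2) blinfun.bounded_linear_right]) auto
  qed
qed

lemma smooth_on_compose:
  fixes g :: "'a::real_normed_vector \<Rightarrow> 'b::real_normed_vector" and f :: "'b \<Rightarrow> 'c::real_normed_vector"
  assumes "frame n (b :: nat \<Rightarrow> 'b) \<beta>"
    and "open S" "open T" "\<And>x. x \<in> S \<Longrightarrow> g x \<in> T" "smooth_on S g" "smooth_on T f"
  shows "smooth_on S (\<lambda>x. f (g x))"
  using assms unfolding smooth_on_def by (blast intro: Ck_on_compose)

text \<open>Both mixed derivatives are the limit of the same second difference quotient.\<close>

lemma second_difference_bound:
  fixes f :: "'a::real_normed_vector \<Rightarrow> 'b::real_normed_vector"
  assumes "open S" "x \<in> S" and f: "\<And>y. y \<in> S \<Longrightarrow> f differentiable at y"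
    and D: "((\<lambda>y. frechet_derivative f (at y) w) has_derivative D) (at x)" and "e > 0"
  shows "\<exists>d>0. \<forall>s. 0 < s \<and> s < d \<longrightarrow>
    norm (f (x + s *\<^sub>R v + s *\<^sub>R w) - f (x + s *\<^sub>R v) - f (x + s *\<^sub>R w) + f x - (s * s) *\<^sub>R D v) \<le> e * (s * s)"
proof -
  \<comment> \<open>For 0 \<le> a, r \<le> s the points x + a v + r w stay within s K of x; the
    added 1 keeps K positive when v = w = 0.\<close>
  define K where "K = norm v + norm w + 1"
  have K: "K > 0" "norm v + norm w \<le> K" unfolding K_def by (auto intro: add_nonneg_pos)
  define k where "k y = frechet_derivative f (at y) w" for y
  have "e / (2 * K) > 0" using \<open>e > 0\<close> K by simp
  then obtain d0 where d0: "d0 > 0"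
    and kd: "\<And>y. norm (y - x) < d0 \<Longrightarrow> norm (k y - k x - D (y - x)) \<le> e / (2 * K) * norm (y - x)"
    using D unfolding has_derivative_at_alt k_def by blast
  obtain d1 where d1: "d1 > 0" "ball x d1 \<subseteq> S"
    using assms(1,2) by (meson openE)
  interpret D: bounded_linear D using D by (rule has_derivative_bounded_linear)
  define d where "d = min d0 d1 / K"
  have "d > 0" using d0 d1 K by (simp add: d_def)
  moreover have "norm (f (x + s *\<^sub>R v + s *\<^sub>R w) - f (x + s *\<^sub>R v) - f (x + s *\<^sub>R w) + f x - (s * s) *\<^sub>R D v) \<le> e * (s * s)"
    if s: "0 < s" "s < d" for s
  proof -
    have sK: "s * K < min d0 d1" using s K by (simp add: d_def field_simps)
    have small: "norm (a *\<^sub>R v + r *\<^sub>R w) \<le> s * K" if "0 \<le> a" "a \<le> s" "0 \<le> r" "r \<le> s" for a r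
    proof -
      have "norm (a *\<^sub>R v + r *\<^sub>R w) \<le> a * norm v + r * norm w"
        by (rule order_trans[OF norm_triangle_ineq]) (use that in simp)
      also have "\<dots> \<le> s * norm v + s * norm w" using that by (intro add_mono mult_right_mono) auto
      also have "\<dots> \<le> s * K" using K s by (metis distrib_left less_imp_le mult_left_mono)
      finally show ?thesis .
    qed
    have inS: "x + a *\<^sub>R v + r *\<^sub>R w \<in> S" if "0 \<le> a" "a \<le> s" "0 \<le> r" "r \<le> s" for a r
    proof -
      have "norm (x - (x + a *\<^sub>R v + r *\<^sub>R w)) = norm (a *\<^sub>R v + r *\<^sub>R w)"
        by (metis add.assoc add_diff_cancel_left' norm_minus_commute)
      also have "\<dots> < d1" using small[OF that] sK by simp
      finally have "x + a *\<^sub>R v + r *\<^sub>R w \<in> ball x d1" by (simp add: dist_norm)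
      then show ?thesis using d1(2) by blast
    qed
    have kb: "norm (k (x + a *\<^sub>R v + r *\<^sub>R w) - k x - D (a *\<^sub>R v + r *\<^sub>R w)) \<le> e / 2 * s"
      if "0 \<le> a" "a \<le> s" "0 \<le> r" "r \<le> s" for a r
    proof -
      have "norm (k (x + (a *\<^sub>R v + r *\<^sub>R w)) - k x - D (a *\<^sub>R v + r *\<^sub>R w)) \<le> e / (2 * K) * norm (a *\<^sub>R v + r *\<^sub>R w)"
        using kd[of "x + (a *\<^sub>R v + r *\<^sub>R w)"] small[OF that] sK by simp
      also have "\<dots> \<le> e / (2 * K) * (s * K)"
        using small[OF that] \<open>e > 0\<close> K by (intro mult_left_mono) auto
      also have "\<dots> = e / 2 * s" using K by simp
      finally show ?thesis by (simp add: add.assoc)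
    qed
    \<comment> \<open>The increment in direction v, as a function of the position r along w, minus
      its expected linear growth. Its derivative has norm at most e s on [0, s], so the mean value
      inequality yields the bound e s^2.\<close>
    define g where "g r = f (x + s *\<^sub>R v + r *\<^sub>R w) - f (x + r *\<^sub>R w) - r *\<^sub>R (s *\<^sub>R D v)" for r
    have fd: "((\<lambda>r. f (x + a *\<^sub>R v + r *\<^sub>R w)) has_derivative (\<lambda>t. t *\<^sub>R k (x + a *\<^sub>R v + r *\<^sub>R w))) (at r)"
      if "0 \<le> a" "a \<le> s" "0 \<le> r" "r \<le> s" for a r
    proof -
      have f': "(f has_derivative frechet_derivative f (at (x + a *\<^sub>R v + r *\<^sub>R w))) (at (x + a *\<^sub>R v + r *\<^sub>R w))"
        using f[OF inS[OF that]] by (rule frechet_derivative_works[THEN iffD1])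
      have "((\<lambda>r. x + a *\<^sub>R v + r *\<^sub>R w) has_derivative (\<lambda>t. t *\<^sub>R w)) (at r)"
        by (auto intro!: derivative_eq_intros)
      from has_derivative_compose[OF this f'] show ?thesis
        by (simp add: k_def linear_cmul[OF has_derivative_linear[OF f']])
    qed
    have gd: "(g has_derivative (\<lambda>t. t *\<^sub>R (k (x + s *\<^sub>R v + r *\<^sub>R w) - k (x + r *\<^sub>R w) - s *\<^sub>R D v))) (at r within {0..s})"
      if "r \<in> {0..s}" for r
    proof -
      have "((\<lambda>r. r *\<^sub>R (s *\<^sub>R D v)) has_derivative (\<lambda>t. t *\<^sub>R (s *\<^sub>R D v))) (at r)"
        by (intro bounded_linear_imp_has_derivative bounded_linear_scaleR_left)
      moreover have "((\<lambda>r. f (x + r *\<^sub>R w)) has_derivative (\<lambda>t. t *\<^sub>R k (x + r *\<^sub>R w))) (at r)"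
        using fd[of 0 r] that s by simp
      ultimately have "(g has_derivative (\<lambda>t. t *\<^sub>R k (x + s *\<^sub>R v + r *\<^sub>R w) - t *\<^sub>R k (x + r *\<^sub>R w)
          - t *\<^sub>R (s *\<^sub>R D v))) (at r)"
        unfolding g_def using fd[of s r] that s by (intro has_derivative_diff) auto
      then show ?thesis
        by (simp add: scaleR_diff_right has_derivative_at_withinI)
    qed
    have "norm (g s - g 0) \<le> (e * s) * norm (s - 0)"
    proof (rule differentiable_bound[of "{0..s}" g _ "e * s" s 0, OF _ gd])
      fix r assume r: "r \<in> {0..s}"
      have "norm (k (x + s *\<^sub>R v + r *\<^sub>R w) - k (x + r *\<^sub>R w) - s *\<^sub>R D v) =
        norm ((k (x + s *\<^sub>R v + r *\<^sub>R w) - k x - D (s *\<^sub>R v + r *\<^sub>R w)) - (k (x + r *\<^sub>R w) - k x - D (r *\<^sub>R w)))"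
        by (simp add: D.add D.scaleR algebra_simps)
      also have "\<dots> \<le> e / 2 * s + e / 2 * s"
        using kb[of s r] kb[of 0 r] r s by (intro norm_triangle_le_diff[OF add_mono]) auto
      finally have *: "norm (k (x + s *\<^sub>R v + r *\<^sub>R w) - k (x + r *\<^sub>R w) - s *\<^sub>R D v) \<le> e * s" by simp
      show "onorm (\<lambda>t. t *\<^sub>R (k (x + s *\<^sub>R v + r *\<^sub>R w) - k (x + r *\<^sub>R w) - s *\<^sub>R D v)) \<le> e * s"
        by (rule onorm_le) (use * in \<open>simp add: mult.commute mult_left_mono\<close>)
    qed (use s in auto)
    then show ?thesis using s by (simp add: g_def algebra_simps)
  qed
  ultimately show ?thesis by blast
qed

text \<open>Exchanging v and w leaves the second difference unchanged, so D v and E w differ by at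
  most 2 e after division by s^2. The two directional derivatives need only be differentiable at x
  itself.\<close>

lemma symmetric_second_derivative:
  fixes f :: "'a::real_normed_vector \<Rightarrow> 'b::real_normed_vector"
  assumes "open S" "x \<in> S" and f: "\<And>y. y \<in> S \<Longrightarrow> f differentiable at y"
    and Dw: "((\<lambda>y. frechet_derivative f (at y) w) has_derivative D) (at x)"
    and Dv: "((\<lambda>y. frechet_derivative f (at y) v) has_derivative E) (at x)"
  shows "D v = E w"
proof -
  have "norm (D v - E w) \<le> 2 * e" if e: "e > 0" for e :: real
  proof -
    obtain d1 where d1: "d1 > 0" "\<And>s. 0 < s \<Longrightarrow> s < d1 \<Longrightarrow>
      norm (f (x + s *\<^sub>R v + s *\<^sub>R w) - f (x + s *\<^sub>R v) - f (x + s *\<^sub>R w) + f x - (s * s) *\<^sub>R D v) \<le> e * (s * s)"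
      using second_difference_bound[OF assms(1,2) f Dw e] by blast
    obtain d2 where d2: "d2 > 0" "\<And>s. 0 < s \<Longrightarrow> s < d2 \<Longrightarrow>
      norm (f (x + s *\<^sub>R w + s *\<^sub>R v) - f (x + s *\<^sub>R w) - f (x + s *\<^sub>R v) + f x - (s * s) *\<^sub>R E w) \<le> e * (s * s)"
      using second_difference_bound[OF assms(1,2) f Dv e] by blast
    define s where "s = min d1 d2 / 2"
    have s: "0 < s" "s < d1" "s < d2" using d1 d2 by (auto simp: s_def)
    let ?P = "f (x + s *\<^sub>R v + s *\<^sub>R w) - f (x + s *\<^sub>R v) - f (x + s *\<^sub>R w) + f x"
    have eq: "(s * s) *\<^sub>R (D v - E w) = (?P - (s * s) *\<^sub>R E w) - (?P - (s * s) *\<^sub>R D v)"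
      by (simp add: algebra_simps)
    have "norm (?P - (s * s) *\<^sub>R E w) \<le> e * (s * s)"
      using d2(2)[OF s(1,3)] by (simp add: algebra_simps)
    then have "norm ((s * s) *\<^sub>R (D v - E w)) \<le> e * (s * s) + e * (s * s)"
      unfolding eq using d1(2)[OF s(1,2)] by (intro norm_triangle_le_diff[OF add_mono])
    then have "(s * s) * norm (D v - E w) \<le> (s * s) * (2 * e)" using s by (simp only: norm_scaleR) simp
    moreover have "0 < s * s" using s by simp
    ultimately show ?thesis by (rule mult_left_le_imp_le)
  qed
  note * = this
  have "norm (D v - E w) \<le> 0 + e" if "e > 0" for e :: real
    using *[of "e / 2"] that by simp
  then have "norm (D v - E w) \<le> 0" by (rule field_le_epsilon)
  then show ?thesis by simp
qed


section \<open>Gronwall estimates\<close>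

text \<open>Comparison with \<psi>(t) = (a + c t) exp (L t), which satisfies \<psi>' \<ge> L \<psi>
  + c. The growth bound is granted only while \<open>norm (u t) < \<delta>\<close>, so the argument
  is by first contact: before the first time at which the norm reaches \<psi> it lies below \<psi>
  \<le> \<delta>, the bound applies, and integration from the strict inequality at 0 keeps the norm
  strictly below \<psi>.\<close>

lemma gronwall_forward:
  fixes u :: "real \<Rightarrow> 'a::real_normed_vector"
  assumes d: "\<And>t. t \<in> {0..T} \<Longrightarrow> (u has_vector_derivative u' t) (at t within {0..T})"
    and bnd: "\<And>t. t \<in> {0..T} \<Longrightarrow> norm (u t) < \<delta> \<Longrightarrow> norm (u' t) \<le> L * norm (u t) + c"
    and a: "norm (u 0) < a" and "L \<ge> 0" "c \<ge> 0" and \<delta>: "(a + c * T) * exp (L * T) \<le> \<delta>"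
    and t: "t \<in> {0..T}"
  shows "norm (u t) \<le> (a + c * T) * exp (L * T)"
proof (rule ccontr)
  assume neg: "\<not> ?thesis"
  define \<psi> where "\<psi> t = (a + c * t) * exp (L * t)" for t
  have a0: "a \<ge> 0" using a norm_ge_zero less_imp_le order_trans by blast
  have mono: "\<psi> r \<le> \<psi> s" if "0 \<le> r" "r \<le> s" for r s
    unfolding \<psi>_def using that a0 assms(4,5) by (intro mult_mono add_mono add_nonneg_nonneg) (auto simp: mult_left_mono)
  have ucont: "continuous_on {0..T} u"
    unfolding continuous_on_eq_continuous_within using has_vector_derivative_continuous[OF d] by blast
  have \<psi>cont: "continuous_on X \<psi>" for X
    unfolding \<psi>_def by (intro continuous_intros)
  define B where "B = {t \<in> {0..T}. 0 \<le> norm (u t) - \<psi> t}"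
  have B: "B = {0..T} \<inter> (\<lambda>t. norm (u t) - \<psi> t) -` {0..}" by (auto simp: B_def)
  have "closed B"
    unfolding B by (rule continuous_closed_preimage[OF continuous_on_diff[OF continuous_on_norm[OF ucont] \<psi>cont]]) simp_all
  moreover have "bounded B" unfolding B by (rule bounded_subset[OF bounded_closed_interval]) blast
  ultimately have "compact B" by (simp add: compact_eq_bounded_closed)
  moreover have "t \<in> B"
    using neg t mono[of t T] by (auto simp: B_def \<psi>_def)
  ultimately obtain s where s: "s \<in> B" "\<And>r. r \<in> B \<Longrightarrow> s \<le> r"
    using compact_attains_inf[of B] by blast
  have "s \<noteq> 0" using s(1) a by (auto simp: B_def \<psi>_def)
  then have s0: "0 < s" "s \<le> T" using s(1) by (auto simp: B_def)
  have "norm (u s - u 0) \<le> \<psi> s - \<psi> 0"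
  proof (rule differentiable_bound_general[OF s0(1)])
    show "continuous_on {0..s} u" using ucont by (rule continuous_on_subset) (use s0 in auto)
    fix r assume r: "0 < r" "r < s"
    then have "r \<in> interior {0..T}" using s0 by simp
    then show "(u has_vector_derivative u' r) (at r)"
      using d[of r] at_within_interior r s0 by (metis atLeastAtMost_iff less_eq_real_def order_less_le_trans)
    show "(\<psi> has_vector_derivative (L * \<psi> r + c * exp (L * r))) (at r)"
      unfolding \<psi>_def has_real_derivative_iff_has_vector_derivative[symmetric]
      by (auto intro!: derivative_eq_intros simp: algebra_simps)
    have "r \<notin> B" using s(2)[of r] r by auto
    then have lt: "norm (u r) < \<psi> r" using r s0 by (auto simp: B_def)
    also have "\<psi> r \<le> \<psi> T" using mono r s0 by auto
    also have "\<dots> \<le> \<delta>" using \<delta> by (simp add: \<psi>_def)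
    finally have "norm (u' r) \<le> L * norm (u r) + c" using bnd[of r] r s0 by auto
    also have "\<dots> \<le> L * \<psi> r + c * exp (L * r)"
    proof -
      have "c * 1 \<le> c * exp (L * r)" using \<open>L \<ge> 0\<close> \<open>c \<ge> 0\<close> r by (intro mult_left_mono) auto
      then show ?thesis using lt \<open>L \<ge> 0\<close> by (simp add: add_mono mult_left_mono)
    qed
    finally show "norm (u' r) \<le> L * \<psi> r + c * exp (L * r)" .
  qed (rule \<psi>cont)
  then have "norm (u s) \<le> norm (u 0) + (\<psi> s - a)"
    using norm_triangle_sub[of "u s" "u 0"] by (simp add: \<psi>_def)
  also have "\<dots> < \<psi> s" using a by simp
  finally show False using s(1) by (simp add: B_def)
qed

lemma gronwall:
  fixes u :: "real \<Rightarrow> 'a::real_normed_vector"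
  assumes d: "\<And>t. t \<in> {-T..T} \<Longrightarrow> (u has_vector_derivative u' t) (at t)"
    and bnd: "\<And>t. t \<in> {-T..T} \<Longrightarrow> norm (u t) < \<delta> \<Longrightarrow> norm (u' t) \<le> L * norm (u t) + c"
    and a: "norm (u 0) < a" and "L \<ge> 0" "c \<ge> 0" and \<delta>: "(a + c * T) * exp (L * T) \<le> \<delta>"
    and t: "t \<in> {-T..T}"
  shows "norm (u t) \<le> (a + c * T) * exp (L * T)"
proof (cases "t \<ge> 0")
  case True
  show ?thesis
    by (rule gronwall_forward[of T u u' \<delta> L c a t]) (use assms True in \<open>auto intro: has_vector_derivative_at_within\<close>)
next
  case False
  have "norm ((\<lambda>t. u (- t)) (- t)) \<le> (a + c * T) * exp (L * T)"
  proof (rule gronwall_forward[of T "\<lambda>t. u (- t)" "\<lambda>t. - u' (- t)" \<delta> L c a "- t"])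
    fix r assume "r \<in> {0..T}"
    then have "(u has_vector_derivative u' (- r)) (at (- r))" using d[of "- r"] by auto
    then have "((u \<circ> uminus) has_vector_derivative (- 1) *\<^sub>R u' (- r)) (at r)"
      by (intro vector_diff_chain_at) (auto intro!: derivative_eq_intros)
    then show "((\<lambda>t. u (- t)) has_vector_derivative - u' (- r)) (at r within {0..T})"
      by (auto simp: o_def intro: has_vector_derivative_at_within)
  qed (use assms False in auto)
  then show ?thesis by simp
qed

lemma gronwall_linear:
  fixes u :: "real \<Rightarrow> 'a::real_normed_vector"
  assumes d: "\<And>t. t \<in> {-T..T} \<Longrightarrow> (u has_vector_derivative u' t) (at t)"
    and bnd: "\<And>t. t \<in> {-T..T} \<Longrightarrow> norm (u' t) \<le> L * norm (u t) + c"
    and "L \<ge> 0" "c \<ge> 0" and t: "t \<in> {-T..T}"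
  shows "norm (u t) \<le> (norm (u 0) + c * T) * exp (L * T)"
proof (rule field_le_epsilon)
  fix e :: real assume "e > 0"
  \<comment> \<open>The growth bound holds without smallness here, so \<delta> is set to the final
    bound itself. The surplus over \<open>norm (u 0)\<close> makes the initial inequality strict and
    adds exactly e to the result.\<close>
  define a where "a = norm (u 0) + e / exp (L * T)"
  have "norm (u t) \<le> (a + c * T) * exp (L * T)"
    by (rule gronwall[of T u u' "(a + c * T) * exp (L * T)" L c a t]) (use assms \<open>e > 0\<close> in \<open>auto simp: a_def\<close>)
  also have "\<dots> = (norm (u 0) + c * T) * exp (L * T) + e"
    by (simp add: a_def algebra_simps)
  finally show "norm (u t) \<le> (norm (u 0) + c * T) * exp (L * T) + e" .
qed


section \<open>Differentiable dependence of integral curves on parameters\<close>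

text \<open>Differentiability of V at each \<open>y t\<close> gives a radius depending on t. The
  tube lemma for the continuous map (h, t) to \<open>V' (y t + h)\<close> over the compact K makes
  V' nearly constant around the curve with one radius, and the mean value inequality turns this into
  the linearization error.\<close>

lemma linearization_along_curve:
  fixes V :: "'a::real_normed_vector \<Rightarrow> 'b::real_normed_vector" and y :: "real \<Rightarrow> 'a"
  assumes V: "\<And>z. (V has_derivative blinfun_apply (V' z)) (at z)" and V': "continuous_on UNIV V'"
    and "compact K" "continuous_on K y" "e > 0"
  obtains \<delta> where "\<delta> > 0"
    "\<And>t h. t \<in> K \<Longrightarrow> norm h < \<delta> \<Longrightarrow> norm (V (y t + h) - V (y t) - blinfun_apply (V' (y t)) h) \<le> e * norm h"
proof -
  have "continuous_on (UNIV \<times> K) (\<lambda>z. V' (y (snd z) + fst z))"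
    by (intro continuous_on_compose2[OF V'] continuous_intros continuous_on_compose2[OF assms(4)]) auto
  then obtain X0 where X0: "0 \<in> X0" "open X0" and X0': "\<forall>h\<in>X0 \<inter> UNIV. \<forall>t\<in>K.
      dist (V' (y (snd (h, t)) + fst (h, t))) (V' (y (snd (0 :: 'a, t)) + fst (0 :: 'a, t))) \<le> e"
    by (rule continuous_on_prod_compactE[OF _ \<open>compact K\<close> UNIV_I[of 0] \<open>e > 0\<close>])
  obtain \<delta> where \<delta>: "\<delta> > 0" "ball 0 \<delta> \<subseteq> X0" using X0 by (meson openE)
  have "norm (V (y t + h) - V (y t) - blinfun_apply (V' (y t)) h) \<le> e * norm h" if t: "t \<in> K" and h: "norm h < \<delta>" for t h
  proof -
    have "norm (V (y t + h) - V (y t) - blinfun_apply (V' (y t)) (y t + h - y t)) \<le> norm (y t + h - y t) * e"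
    proof (rule differentiable_bound_linearization[where S = "ball (y t) \<delta>" and f' = "\<lambda>x. blinfun_apply (V' x)"])
      fix x assume x: "x \<in> ball (y t) \<delta>"
      show "(V has_derivative blinfun_apply (V' x)) (at x within ball (y t) \<delta>)"
        using V by (rule has_derivative_at_withinI)
      have "x - y t \<in> X0" using x \<delta> by (auto simp: dist_norm norm_minus_commute)
      with X0' t have "norm (V' x - V' (y t)) \<le> e" by (force simp: dist_norm)
      moreover have "blinfun_apply (V' x) - blinfun_apply (V' (y t)) = blinfun_apply (V' x - V' (y t))"
        by (simp add: fun_eq_iff blinfun.diff_left)
      ultimately show "onorm (blinfun_apply (V' x) - blinfun_apply (V' (y t))) \<le> e"
        by (simp add: norm_blinfun.rep_eq)
    next
      fix r :: real assume "r \<in> {0..1}"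
      then have "norm (r *\<^sub>R h) \<le> 1 * norm h" by (simp add: mult_left_le_one_le)
      then show "y t + r *\<^sub>R (y t + h - y t) \<in> ball (y t) \<delta>" using h by (simp add: dist_norm)
    qed (use \<delta> in auto)
    then show ?thesis by (simp add: mult.commute)
  qed
  with \<delta>(1) that show thesis by blast
qed

text \<open>The parameter space is kept apart from the state space, with initial values affine in
  the parameter. It is used with J the identity for the flow itself, and with J the inclusion of the
  parameter for a linear equation made autonomous. Curves are given for all times, so no existence
  theorem is called upon.\<close>

locale integral_curve_family =
  fixes V :: "'a::banach \<Rightarrow> 'a" and V' :: "'a \<Rightarrow> 'a \<Rightarrow>\<^sub>L 'a"
    and y :: "'p::real_normed_vector \<Rightarrow> real \<Rightarrow> 'a" and J :: "'p \<Rightarrow>\<^sub>L 'a"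
  assumes V: "\<And>z. (V has_derivative blinfun_apply (V' z)) (at z)"
    and V': "continuous_on UNIV V'"
    and y: "\<And>x t. (y x has_vector_derivative V (y x t)) (at t)"
    and y_init: "\<And>x x'. y x' 0 - y x 0 = blinfun_apply J (x' - x)"
begin

lemma continuous_curve: "continuous_on K (y x)"
  using y by (meson continuous_at_imp_continuous_on has_vector_derivative_continuous)

lemma bound_along_curve:
  obtains L where "L \<ge> 0" "\<And>t. t \<in> {-T..T} \<Longrightarrow> norm (V' (y x t)) \<le> L"
proof -
  have "continuous_on {-T..T} (\<lambda>t. V' (y x t))"
    by (intro continuous_on_compose2[OF V'] continuous_curve) auto
  then have "bounded ((\<lambda>t. V' (y x t)) ` {-T..T})"
    by (intro compact_imp_bounded compact_continuous_image) auto
  then obtain L where "\<And>t. t \<in> {-T..T} \<Longrightarrow> norm (V' (y x t)) \<le> L"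
    unfolding bounded_iff by blast
  then show thesis using that[of "max L 0"] by (auto simp: le_max_iff_disj)
qed

text \<open>Gronwall for the difference of two curves, with rate L + 1: L bounds V' along the curve
  of x and 1 is the tolerated linearization error. This rate is valid only while the curves are
  \<delta>-close, which the resulting bound guarantees for small h.\<close>

lemma lipschitz_in_parameter:
  assumes "T \<ge> 0"
  obtains C \<delta> where "C \<ge> 0" "\<delta> > 0"
    "\<And>h t. norm h < \<delta> \<Longrightarrow> t \<in> {-T..T} \<Longrightarrow> norm (y (x + h) t - y x t) \<le> C * norm h"
proof -
  obtain L where L: "L \<ge> 0" "\<And>t. t \<in> {-T..T} \<Longrightarrow> norm (V' (y x t)) \<le> L"
    using bound_along_curve by blast
  obtain \<delta> where \<delta>: "\<delta> > 0" "\<And>t h. t \<in> {-T..T} \<Longrightarrow> norm h < \<delta> \<Longrightarrow>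
      norm (V (y x t + h) - V (y x t) - V' (y x t) h) \<le> 1 * norm h"
    using linearization_along_curve[OF V V' _ continuous_curve, of "{-T..T}" 1 x] by auto
  define K where "K = norm J + 1"
  have K: "K > 0" by (simp add: K_def add_nonneg_pos)
  define E where "E = exp ((L + 1) * T)"
  have E: "E > 0" by (simp add: E_def)
  show thesis
  proof (rule that[of "K * E" "\<delta> / (K * E)"])
    fix h :: 'p and t assume h: "norm h < \<delta> / (K * E)" and t: "t \<in> {-T..T}"
    show "norm (y (x + h) t - y x t) \<le> K * E * norm h"
    proof (cases "h = 0")
      case False
      have "norm (y (x + h) t - y x t) \<le> (K * norm h + 0 * T) * exp ((L + 1) * T)"
      proof (rule gronwall[where u = "\<lambda>t. y (x + h) t - y x t" and u' = "\<lambda>t. V (y (x + h) t) - V (y x t)" and \<delta> = \<delta>])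
        fix t assume t: "t \<in> {-T..T}"
        show "((\<lambda>t. y (x + h) t - y x t) has_vector_derivative V (y (x + h) t) - V (y x t)) (at t)"
          by (intro has_vector_derivative_diff y)
        assume u: "norm (y (x + h) t - y x t) < \<delta>"
        let ?u = "y (x + h) t - y x t"
        have "norm (V (y (x + h) t) - V (y x t) - V' (y x t) ?u) \<le> norm ?u"
          using \<delta>(2)[OF t u] by simp
        moreover have "norm (V' (y x t) ?u) \<le> L * norm ?u"
          by (rule order_trans[OF norm_blinfun mult_right_mono[OF L(2)[OF t]]]) simp
        ultimately show "norm (V (y (x + h) t) - V (y x t)) \<le> (L + 1) * norm ?u + 0"
          using norm_triangle_sub[of "V (y (x + h) t) - V (y x t)" "V' (y x t) ?u"]
          by (simp add: algebra_simps)
      next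
        have "norm (y (x + h) 0 - y x 0) \<le> norm J * norm h"
          using y_init[of "x + h" x] norm_blinfun[of J h] by simp
        also have "\<dots> < K * norm h" using False by (simp add: K_def algebra_simps)
        finally show "norm (y (x + h) 0 - y x 0) < K * norm h" .
        show "(K * norm h + 0 * T) * exp ((L + 1) * T) \<le> \<delta>"
          using h K E unfolding E_def[symmetric] by (simp add: field_simps)
      qed (use L t in auto)
      then show ?thesis by (simp add: E_def mult_ac)
    qed simp
  qed (use K E \<delta> in auto)
qed

text \<open>The distance of the two curves is O(\<open>norm h\<close>) by the Lipschitz bound, so
  the linearization error, small relative to this distance, is small relative to
  \<open>norm h\<close>. C + 1 replaces C to avoid division by zero.\<close>

lemma remainder_in_parameter:
  assumes "T \<ge> 0" "e > 0"
  obtains \<delta> where "\<delta> > 0" "\<And>h t. norm h < \<delta> \<Longrightarrow> t \<in> {-T..T} \<Longrightarrow>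
    norm (V (y (x + h) t) - V (y x t) - V' (y x t) (y (x + h) t - y x t)) \<le> e * norm h"
proof -
  obtain C \<delta>1 where C: "C \<ge> 0" "\<delta>1 > 0"
    "\<And>h t. norm h < \<delta>1 \<Longrightarrow> t \<in> {-T..T} \<Longrightarrow> norm (y (x + h) t - y x t) \<le> C * norm h"
    using lipschitz_in_parameter[OF assms(1), of x] by blast
  have e: "e / (C + 1) > 0" using assms C by simp
  obtain \<delta>2 where \<delta>2: "\<delta>2 > 0" "\<And>t h. t \<in> {-T..T} \<Longrightarrow> norm h < \<delta>2 \<Longrightarrow>
      norm (V (y x t + h) - V (y x t) - V' (y x t) h) \<le> e / (C + 1) * norm h"
    using linearization_along_curve[OF V V' _ continuous_curve e, of "{-T..T}" x] by auto
  show thesis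
  proof (rule that[of "min \<delta>1 (\<delta>2 / (C + 1))"])
    fix h :: 'p and t assume h: "norm h < min \<delta>1 (\<delta>2 / (C + 1))" and t: "t \<in> {-T..T}"
    let ?u = "y (x + h) t - y x t"
    have u: "norm ?u \<le> (C + 1) * norm h" using C(3)[OF _ t, of h] h norm_ge_zero[of h] unfolding distrib_right by linarith
    also have "\<dots> < \<delta>2" using h C(1) by (simp add: field_simps)
    finally have "norm (V (y x t + ?u) - V (y x t) - V' (y x t) ?u) \<le> e / (C + 1) * norm ?u"
      using \<delta>2(2)[OF t] by blast
    also have "\<dots> \<le> e / (C + 1) * ((C + 1) * norm h)" using u e by (intro mult_left_mono) auto
    also have "\<dots> = e * norm h" using C(1) by simp
    finally show "norm (V (y (x + h) t) - V (y x t) - V' (y x t) ?u) \<le> e * norm h" by simp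
  qed (use C \<delta>2 in auto)
qed

lemma variational_solution_unique:
  assumes "\<And>t. (Z has_vector_derivative V' (y x t) (Z t)) (at t)" "Z 0 = 0"
  shows "Z t = 0"
proof -
  obtain L where L: "L \<ge> 0" "\<And>r. r \<in> {-\<bar>t\<bar>..\<bar>t\<bar>} \<Longrightarrow> norm (V' (y x r)) \<le> L"
    using bound_along_curve by blast
  have "norm (Z t) \<le> (norm (Z 0) + 0 * \<bar>t\<bar>) * exp (L * \<bar>t\<bar>)"
  proof (rule gronwall_linear[OF assms(1)])
    fix r assume "r \<in> {-\<bar>t\<bar>..\<bar>t\<bar>}"
    then show "norm (V' (y x r) (Z r)) \<le> L * norm (Z r) + 0"
      using order_trans[OF norm_blinfun mult_right_mono[OF L(2)]] by simp
  qed (use L in auto)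
  then show ?thesis using assms(2) by simp
qed

text \<open>The solution is the limit of difference quotients, which form a Cauchy sequence uniformly on
  compact time intervals by Gronwall; no existence theorem for linear equations is needed.\<close>

lemma variational_solution_exists:
  "\<exists>Z. (\<forall>t. (Z has_vector_derivative V' (y x t) (Z t)) (at t)) \<and> Z 0 = blinfun_apply J h"
proof -
  \<comment> \<open>Difference quotients with steps 1/(n + 1); \<open>w' n\<close> is the time
    derivative of \<open>w n\<close>. By the remainder estimate they solve the variational equation
    up to an error that vanishes uniformly on compact intervals.\<close>
  define w where "w n t = real (Suc n) *\<^sub>R (y (x + h /\<^sub>R real (Suc n)) t - y x t)" for n t
  define w' where "w' n t = real (Suc n) *\<^sub>R (V (y (x + h /\<^sub>R real (Suc n)) t) - V (y x t))" for n t
  have wd: "(w n has_vector_derivative w' n t) (at t)" for n t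
    unfolding w_def w'_def
    using bounded_linear.has_vector_derivative[OF bounded_linear_scaleR_right has_vector_derivative_diff[OF y y]] .
  have w0: "w n 0 = blinfun_apply J h" for n
    using y_init[of "x + h /\<^sub>R real (Suc n)" x] by (simp add: w_def blinfun.scaleR_right del: of_nat_Suc)
  have rem: "\<exists>N. \<forall>n\<ge>N. \<forall>t\<in>{-T..T}. norm (w' n t - V' (y x t) (w n t)) \<le> e"
    if "e > 0" "T \<ge> 0" for e T :: real
  proof -
    have "e / (norm h + 1) > 0" using that by (simp add: add_nonneg_pos)
    then obtain \<delta> where \<delta>: "\<delta> > 0" "\<And>h' t. norm h' < \<delta> \<Longrightarrow> t \<in> {-T..T} \<Longrightarrow>
      norm (V (y (x + h') t) - V (y x t) - V' (y x t) (y (x + h') t - y x t)) \<le> e / (norm h + 1) * norm h'"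
      using remainder_in_parameter[OF \<open>T \<ge> 0\<close>] by metis
    obtain N where N: "norm h / \<delta> < real N" using reals_Archimedean2 by blast
    have "norm (w' n t - V' (y x t) (w n t)) \<le> e" if n: "n \<ge> N" and t: "t \<in> {-T..T}" for n t
    proof -
      define k where "k = real (Suc n)"
      have k: "k > 0" "norm h / \<delta> < k" using N n by (auto simp: k_def)
      have "norm (h /\<^sub>R k) < \<delta>" using k \<delta>(1) by (simp add: field_simps)
      note b = \<delta>(2)[OF this t]
      have "w' n t - V' (y x t) (w n t) = k *\<^sub>R (V (y (x + h /\<^sub>R k) t) - V (y x t)
          - V' (y x t) (y (x + h /\<^sub>R k) t - y x t))"
        unfolding w_def w'_def k_def[symmetric] blinfun.scaleR_right scaleR_diff_right[symmetric] ..
      then have "norm (w' n t - V' (y x t) (w n t)) \<le> k * (e / (norm h + 1) * norm (h /\<^sub>R k))"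
        using mult_left_mono[OF b, of k] k by (simp only: norm_scaleR) simp
      also have "\<dots> = e * (norm h / (norm h + 1))" using k by simp
      also have "\<dots> \<le> e * 1"
        using \<open>e > 0\<close> by (intro mult_left_mono) (auto simp: divide_le_eq add_nonneg_pos)
      finally show ?thesis by simp
    qed
    then show ?thesis by blast
  qed
  have cauchy: "\<exists>N. \<forall>m\<ge>N. \<forall>n\<ge>N. \<forall>t\<in>{-T..T}. norm (w m t - w n t) \<le> e"
    if "e > 0" "T \<ge> 0" for e T :: real
  proof -
    obtain L where L: "L \<ge> 0" "\<And>t. t \<in> {-T..T} \<Longrightarrow> norm (V' (y x t)) \<le> L"
      using bound_along_curve by blast
    \<comment> \<open>Chosen so that the Gronwall bound 2 e' T exp (L T) equals e T / (T + 1); T + 1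
      instead of T because T may be 0.\<close>
    define e' where "e' = e / (2 * (T + 1) * exp (L * T))"
    have "e' > 0" using that by (simp add: e'_def)
    then obtain N where N: "\<And>n t. n \<ge> N \<Longrightarrow> t \<in> {-T..T} \<Longrightarrow> norm (w' n t - V' (y x t) (w n t)) \<le> e'"
      using rem[OF _ \<open>T \<ge> 0\<close>] by blast
    have "norm (w m t - w n t) \<le> e" if mn: "m \<ge> N" "n \<ge> N" and t: "t \<in> {-T..T}" for m n t
    proof -
      have "norm (w m t - w n t) \<le> (norm (w m 0 - w n 0) + 2 * e' * T) * exp (L * T)"
      proof (rule gronwall_linear[where u = "\<lambda>t. w m t - w n t" and u' = "\<lambda>t. w' m t - w' n t"])
        fix r assume r: "r \<in> {-T..T}"
        have eq: "w' m r - w' n r = V' (y x r) (w m r - w n r)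
          + ((w' m r - V' (y x r) (w m r)) - (w' n r - V' (y x r) (w n r)))"
          by (simp add: blinfun.diff_right)
        have "norm (V' (y x r) (w m r - w n r)) \<le> L * norm (w m r - w n r)"
          by (rule order_trans[OF norm_blinfun mult_right_mono[OF L(2)[OF r]]]) simp
        moreover have "norm ((w' m r - V' (y x r) (w m r)) - (w' n r - V' (y x r) (w n r))) \<le> e' + e'"
          by (rule norm_triangle_le_diff[OF add_mono[OF N[OF mn(1) r] N[OF mn(2) r]]])
        ultimately show "norm (w' m r - w' n r) \<le> L * norm (w m r - w n r) + 2 * e'"
          unfolding eq by (intro norm_triangle_le) simp
      qed (use L t \<open>e' > 0\<close> wd in \<open>auto intro!: has_vector_derivative_diff\<close>)
      also have "\<dots> = e * (T / (T + 1))" using \<open>T \<ge> 0\<close> by (simp add: w0 e'_def divide_simps)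
      also have "\<dots> \<le> e * 1" using \<open>e > 0\<close> \<open>T \<ge> 0\<close> by (intro mult_left_mono) auto
      finally show ?thesis by simp
    qed
    then show ?thesis by blast
  qed
  define Z where "Z t = lim (\<lambda>n. w n t)" for t
  have lim: "(\<lambda>n. w n t) \<longlonglongrightarrow> Z t" for t
  proof -
    have "Cauchy (\<lambda>n. w n t)"
    proof (rule CauchyI)
      fix e :: real assume "e > 0"
      then obtain N where "\<forall>m\<ge>N. \<forall>n\<ge>N. \<forall>r\<in>{-\<bar>t\<bar>..\<bar>t\<bar>}. norm (w m r - w n r) \<le> e / 2"
        using cauchy[of "e / 2" "\<bar>t\<bar>"] by auto
      moreover have "t \<in> {-\<bar>t\<bar>..\<bar>t\<bar>}" by auto
      ultimately have *: "norm (w m t - w n t) \<le> e / 2" if "m \<ge> N" "n \<ge> N" for m n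
        using that by blast
      have "norm (w m t - w n t) < e" if "m \<ge> N" "n \<ge> N" for m n
        by (rule le_less_trans[OF *[OF that]]) (use \<open>e > 0\<close> in simp)
      then show "\<exists>N. \<forall>m\<ge>N. \<forall>n\<ge>N. norm (w m t - w n t) < e"
        by blast
    qed
    then show ?thesis unfolding Z_def by (simp add: Cauchy_convergent_iff convergent_LIMSEQ_iff)
  qed
  have unif: "\<exists>N. \<forall>n\<ge>N. \<forall>t\<in>{-T..T}. norm (w n t - Z t) \<le> e" if "e > 0" "T \<ge> 0" for e T :: real
  proof -
    obtain N where N: "\<And>m n t. m \<ge> N \<Longrightarrow> n \<ge> N \<Longrightarrow> t \<in> {-T..T} \<Longrightarrow> norm (w n t - w m t) \<le> e"
      using cauchy[OF \<open>e > 0\<close> \<open>T \<ge> 0\<close>] by blast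
    have "norm (w n t - Z t) \<le> e" if "n \<ge> N" "t \<in> {-T..T}" for n t
    proof (rule LIMSEQ_le_const2)
      show "(\<lambda>m. norm (w n t - w m t)) \<longlonglongrightarrow> norm (w n t - Z t)"
        by (intro tendsto_intros lim)
      show "\<exists>N. \<forall>m\<ge>N. norm (w n t - w m t) \<le> e" using N that by blast
    qed
    then show ?thesis by blast
  qed
  have "(Z has_vector_derivative V' (y x t) (Z t)) (at t)" for t
  proof -
    \<comment> \<open>The extra 1 puts t in the interior of the interval, so the derivative within
      the interval obtained below is a full derivative at t.\<close>
    define T where "T = \<bar>t\<bar> + 1"
    have T: "T \<ge> 0" "t \<in> interior {-T..T}" "t \<in> {-T..T}" by (auto simp: T_def)
    obtain L where L: "L \<ge> 0" "\<And>t. t \<in> {-T..T} \<Longrightarrow> norm (V' (y x t)) \<le> L"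
      using bound_along_curve by blast
    have "\<exists>g. \<forall>r\<in>{-T..T}. (\<lambda>n. w n r) \<longlonglongrightarrow> g r \<and>
      (g has_derivative (\<lambda>s. s *\<^sub>R V' (y x r) (Z r))) (at r within {-T..T})"
    proof (rule has_derivative_sequence[where f' = "\<lambda>n r s. s *\<^sub>R w' n r", OF _ _ _ T(3) lim])
      show "(w n has_derivative (\<lambda>s. s *\<^sub>R w' n r)) (at r within {-T..T})" for n r
        using has_vector_derivative_at_within[OF wd] by (simp add: has_vector_derivative_def)
    next
      fix e :: real assume e: "e > 0"
      have "e / 2 > 0" "e / (2 * (L + 1)) > 0" using e L by auto
      then obtain N1 N2 where N1: "\<And>n r. n \<ge> N1 \<Longrightarrow> r \<in> {-T..T} \<Longrightarrow> norm (w' n r - V' (y x r) (w n r)) \<le> e / 2"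
        and N2: "\<And>n r. n \<ge> N2 \<Longrightarrow> r \<in> {-T..T} \<Longrightarrow> norm (w n r - Z r) \<le> e / (2 * (L + 1))"
        using rem[OF _ T(1)] unif[OF _ T(1)] by metis
      have "norm (s *\<^sub>R w' n r - s *\<^sub>R V' (y x r) (Z r)) \<le> e * norm s"
        if n: "n \<ge> max N1 N2" and r: "r \<in> {-T..T}" for n r and s :: real
      proof -
        have "norm (V' (y x r) (w n r - Z r)) \<le> L * (e / (2 * (L + 1)))"
          using n by (intro order_trans[OF norm_blinfun mult_mono[OF L(2)[OF r] N2[OF _ r]]]) (auto simp: L)
        also have "\<dots> \<le> e / 2" using L(1) e by (simp add: field_simps)
        finally have 2: "norm (V' (y x r) (w n r - Z r)) \<le> e / 2" .
        have eq: "w' n r - V' (y x r) (Z r) =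
          (w' n r - V' (y x r) (w n r)) + V' (y x r) (w n r - Z r)"
          by (simp add: blinfun.diff_right)
        have "norm (w' n r - V' (y x r) (Z r)) \<le> e"
          unfolding eq using norm_triangle_mono[OF N1[OF _ r] 2] n by simp
        then have "\<bar>s\<bar> * norm (w' n r - V' (y x r) (Z r)) \<le> \<bar>s\<bar> * e"
          by (intro mult_left_mono) auto
        then show ?thesis
          unfolding scaleR_diff_right[symmetric] norm_scaleR by (simp add: mult.commute)
      qed
      then show "\<forall>\<^sub>F n in sequentially. \<forall>r\<in>{-T..T}. \<forall>s.
          norm (s *\<^sub>R w' n r - s *\<^sub>R V' (y x r) (Z r)) \<le> e * norm s"
        unfolding eventually_sequentially by blast
    qed simp
    then obtain g where g: "\<And>r. r \<in> {-T..T} \<Longrightarrow> (\<lambda>n. w n r) \<longlonglongrightarrow> g r"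
      "(g has_derivative (\<lambda>s. s *\<^sub>R V' (y x t) (Z t))) (at t within {-T..T})"
      using T(3) by blast
    have "g r = Z r" if "r \<in> {-T..T}" for r using LIMSEQ_unique[OF g(1)[OF that] lim] .
    then have "(Z has_derivative (\<lambda>s. s *\<^sub>R V' (y x t) (Z t))) (at t within {-T..T})"
      using has_derivative_transform[OF T(3) _ g(2), of Z] by simp
    then show ?thesis
      unfolding at_within_interior[OF T(2)] has_vector_derivative_def .
  qed
  moreover have "Z 0 = blinfun_apply J h" using lim[of 0] by (simp add: w0 LIMSEQ_const_iff)
  ultimately show ?thesis by blast
qed

text \<open>The error y (x + h) - y x - Z h vanishes at time 0, since initial values are affine in
  the parameter, and solves the variational equation up to a source that is
  o(\<open>norm h\<close>); Gronwall then makes the error o(\<open>norm h\<close>). Linearity in h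
  comes from uniqueness of variational solutions.\<close>

lemma has_derivative_in_parameter:
  assumes Z: "\<And>h t. (Z h has_vector_derivative V' (y x t) (Z h t)) (at t)"
    and Z0: "\<And>h. Z h 0 = blinfun_apply J h"
  shows "((\<lambda>x. y x t) has_derivative (\<lambda>h. Z h t)) (at x)"
  unfolding has_derivative_at_alt
proof (intro conjI allI impI)
  define T where "T = \<bar>t\<bar>"
  have T: "T \<ge> 0" "t \<in> {-T..T}" by (auto simp: T_def)
  obtain L where L: "L \<ge> 0" "\<And>t. t \<in> {-T..T} \<Longrightarrow> norm (V' (y x t)) \<le> L"
    using bound_along_curve by blast
  have LZ: "norm (V' (y x r) v) \<le> L * norm v" if "r \<in> {-T..T}" for r v
    by (rule order_trans[OF norm_blinfun mult_right_mono[OF L(2)[OF that]]]) simp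
  show "bounded_linear (\<lambda>h. Z h t)"
  proof (rule bounded_linear_intro)
    fix h k
    have "(\<lambda>t. Z (h + k) t - (Z h t + Z k t)) t = 0"
    proof (rule variational_solution_unique[of _ x])
      fix t
      show "((\<lambda>t. Z (h + k) t - (Z h t + Z k t)) has_vector_derivative
          V' (y x t) (Z (h + k) t - (Z h t + Z k t))) (at t)"
        unfolding blinfun.diff_right blinfun.add_right
        by (intro has_vector_derivative_diff has_vector_derivative_add Z)
    qed (simp add: Z0 blinfun.add_right)
    then show "Z (h + k) t = Z h t + Z k t" by simp
  next
    fix r :: real and h
    have "(\<lambda>t. Z (r *\<^sub>R h) t - r *\<^sub>R Z h t) t = 0"
    proof (rule variational_solution_unique[of _ x])
      fix t
      show "((\<lambda>t. Z (r *\<^sub>R h) t - r *\<^sub>R Z h t) has_vector_derivative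
          V' (y x t) (Z (r *\<^sub>R h) t - r *\<^sub>R Z h t)) (at t)"
        unfolding blinfun.diff_right blinfun.scaleR_right
        by (intro has_vector_derivative_diff Z bounded_linear.has_vector_derivative[OF bounded_linear_scaleR_right])
    qed (simp add: Z0 blinfun.scaleR_right)
    then show "Z (r *\<^sub>R h) t = r *\<^sub>R Z h t" by simp
  next
    fix h
    have "norm (Z h t) \<le> (norm (Z h 0) + 0 * T) * exp (L * T)"
      by (rule gronwall_linear[OF Z]) (use L T LZ in auto)
    also have "\<dots> \<le> norm J * norm h * exp (L * T)"
      using norm_blinfun[of J h] by (simp add: Z0)
    finally show "norm (Z h t) \<le> norm h * (norm J * exp (L * T))" by (simp add: mult_ac)
  qed
  fix e :: real assume "e > 0"
  define e' where "e' = e / ((T + 1) * exp (L * T))"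
  have "e' > 0" using \<open>e > 0\<close> T(1) by (simp add: e'_def)
  from remainder_in_parameter[OF T(1) this, of x] obtain \<delta> where \<delta>: "\<delta> > 0"
    "\<And>h t. norm h < \<delta> \<Longrightarrow> t \<in> {-T..T} \<Longrightarrow>
    norm (V (y (x + h) t) - V (y x t) - V' (y x t) (y (x + h) t - y x t)) \<le> e' * norm h"
    by blast
  have "norm (y x' t - y x t - Z (x' - x) t) \<le> e * norm (x' - x)" if x': "norm (x' - x) < \<delta>" for x'
  proof -
    define h where "h = x' - x"
    have "norm (y (x + h) t - y x t - Z h t) \<le> (norm (y (x + h) 0 - y x 0 - Z h 0) + e' * norm h * T) * exp (L * T)"
    proof (rule gronwall_linear[where u = "\<lambda>t. y (x + h) t - y x t - Z h t"])
      fix r assume r: "r \<in> {-T..T}"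
      show "((\<lambda>t. y (x + h) t - y x t - Z h t) has_vector_derivative
        V (y (x + h) r) - V (y x r) - V' (y x r) (Z h r)) (at r)"
        by (intro has_vector_derivative_diff y Z)
      have eq: "V (y (x + h) r) - V (y x r) - V' (y x r) (Z h r) =
        V' (y x r) (y (x + h) r - y x r - Z h r) +
        (V (y (x + h) r) - V (y x r) - V' (y x r) (y (x + h) r - y x r))"
        by (simp add: blinfun.diff_right)
      show "norm (V (y (x + h) r) - V (y x r) - V' (y x r) (Z h r)) \<le>
        L * norm (y (x + h) r - y x r - Z h r) + e' * norm h"
        unfolding eq using \<delta>(2)[OF _ r, of h] x' by (intro norm_triangle_mono LZ[OF r]) (simp add: h_def)
    qed (use L T \<open>e' > 0\<close> in auto)
    also have "\<dots> = e * norm h * (T / (T + 1))"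
      using y_init[of "x + h" x] T(1) by (simp add: Z0 e'_def)
    also have "\<dots> \<le> e * norm h * 1" using \<open>e > 0\<close> T(1) by (intro mult_left_mono) auto
    finally show ?thesis by (simp add: h_def)
  qed
  with \<delta>(1) show "\<exists>d>0. \<forall>x'. norm (x' - x) < d \<longrightarrow> norm (y x' t - y x t - Z (x' - x) t) \<le> e * norm (x' - x)"
    by blast
qed

text \<open>The Lipschitz bound in the parameter is uniform for times near t; it is combined with
  continuity of the single curve of x.\<close>

lemma continuous_joint: "continuous_on UNIV (\<lambda>z. y (fst z) (snd z))"
  unfolding continuous_on_eq_continuous_at[OF open_UNIV]
proof
  fix z0 :: "'p \<times> real"
  obtain x t where z0: "z0 = (x, t)" by fastforce
  obtain C \<delta> where C: "C \<ge> 0" "\<delta> > 0"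
    "\<And>h r. norm h < \<delta> \<Longrightarrow> r \<in> {-(\<bar>t\<bar> + 1)..\<bar>t\<bar> + 1} \<Longrightarrow> norm (y (x + h) r - y x r) \<le> C * norm h"
    using lipschitz_in_parameter[of "\<bar>t\<bar> + 1" x] by auto
  have 1: "((\<lambda>z. fst z - x) \<longlongrightarrow> 0) (at z0)" "((\<lambda>z. snd z) \<longlongrightarrow> t) (at z0)"
    unfolding z0 by (auto intro!: tendsto_eq_intros)
  have "\<forall>\<^sub>F z in at z0. norm (fst z - x) < \<delta>"
    using tendstoD[OF 1(1) C(2)] by (simp add: dist_norm)
  moreover have "\<forall>\<^sub>F z in at z0. \<bar>snd z - t\<bar> < 1"
    using tendstoD[OF 1(2), of 1] by (simp add: dist_norm)
  ultimately have "\<forall>\<^sub>F z in at z0. norm (y (fst z) (snd z) - y x (snd z)) \<le> C * norm (fst z - x)"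
  proof eventually_elim
    case (elim z)
    then have "snd z \<in> {-(\<bar>t\<bar> + 1)..\<bar>t\<bar> + 1}" by (auto simp: abs_if split: if_splits)
    then show ?case using C(3)[of "fst z - x" "snd z"] elim by simp
  qed
  moreover have "((\<lambda>z. C * norm (fst z - x)) \<longlongrightarrow> 0) (at z0)"
    using tendsto_mult_right_zero[OF tendsto_norm_zero[OF 1(1)]] .
  ultimately have "((\<lambda>z. y (fst z) (snd z) - y x (snd z)) \<longlongrightarrow> 0) (at z0)"
    by (rule Lim_null_comparison)
  moreover have "((\<lambda>z. y x (snd z)) \<longlongrightarrow> y x t) (at z0)"
    using continuous_on_tendsto_compose[OF continuous_curve[of UNIV] 1(2)] by simp
  ultimately have "((\<lambda>z. (y (fst z) (snd z) - y x (snd z)) + y x (snd z)) \<longlongrightarrow> 0 + y x t) (at z0)"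
    by (rule tendsto_add)
  then show "isCont (\<lambda>z. y (fst z) (snd z)) z0" by (simp add: isCont_def z0)
qed

text \<open>Passing from partial to total differentiability takes continuity of one partial
  derivative. The time derivative is the convenient one: it is V along the curves, and these are
  jointly continuous.\<close>

lemma has_derivative_joint:
  assumes Z: "\<And>h t. (Z h has_vector_derivative V' (y x t) (Z h t)) (at t)"
    and Z0: "\<And>h. Z h 0 = blinfun_apply J h"
  shows "((\<lambda>z. y (fst z) (snd z)) has_derivative (\<lambda>h. Z (fst h) t + snd h *\<^sub>R V (y x t))) (at (x, t))"
proof -
  have Vc: "continuous_on UNIV V"
    using V by (meson continuous_at_imp_continuous_on has_derivative_continuous)
  have "continuous_on UNIV (\<lambda>z. blinfun_scaleR_left (V (y (fst z) (snd z))))"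
    by (intro bounded_linear.continuous_on[OF bounded_linear_blinfun_scaleR_left]
        continuous_on_compose2[OF Vc] continuous_joint) auto
  then have "continuous (at (x, t) within UNIV \<times> UNIV) (\<lambda>(x, t). blinfun_scaleR_left (V (y x t)))"
    unfolding continuous_on_eq_continuous_at[OF open_UNIV] UNIV_Times_UNIV case_prod_beta by blast
  from has_derivative_partialsI[OF _ _ this]
  have "((\<lambda>(x, t). y x t) has_derivative (\<lambda>(h, s). Z h t + blinfun_apply (blinfun_scaleR_left (V (y x t))) s))
      (at (x, t) within UNIV \<times> UNIV)"
    using has_derivative_in_parameter[OF Z Z0] y by (auto simp: has_vector_derivative_def)
  then show ?thesis unfolding case_prod_beta UNIV_Times_UNIV by simp
qed

end


text \<open>The curves live on [0, T] only, with one-sided derivatives at its ends, so the family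
  above does not apply. Linearization along x and \<open>gronwall_forward\<close> bound the
  difference by every e > 0, because the initial difference 0 lies below every positive a.\<close>

lemma ode_unique:
  fixes V :: "'a::real_normed_vector \<Rightarrow> 'a"
  assumes V: "\<And>z. (V has_derivative blinfun_apply (V' z)) (at z)" and V': "continuous_on UNIV V'"
    and x: "\<And>t. t \<in> {0..T} \<Longrightarrow> (x has_vector_derivative V (x t)) (at t within {0..T})"
    and y: "\<And>t. t \<in> {0..T} \<Longrightarrow> (y has_vector_derivative V (y t)) (at t within {0..T})"
    and "x 0 = y 0" and t: "t \<in> {0..T}"
  shows "x t = y t"
proof -
  have xc: "continuous_on {0..T} x"
    unfolding continuous_on_eq_continuous_within using has_vector_derivative_continuous[OF x] by blast
  obtain \<delta> where \<delta>: "\<delta> > 0" "\<And>t h. t \<in> {0..T} \<Longrightarrow> norm h < \<delta> \<Longrightarrow>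
      norm (V (x t + h) - V (x t) - blinfun_apply (V' (x t)) h) \<le> 1 * norm h"
    using linearization_along_curve[OF V V' compact_Icc xc zero_less_one] by blast
  have "bounded ((\<lambda>t. V' (x t)) ` {0..T})"
    by (intro compact_imp_bounded compact_continuous_image continuous_on_compose2[OF V' xc]) auto
  then obtain L0 where L0: "\<And>t. t \<in> {0..T} \<Longrightarrow> norm (V' (x t)) \<le> L0"
    unfolding bounded_iff by blast
  define L where "L = max L0 0"
  have L: "L \<ge> 0" "\<And>t. t \<in> {0..T} \<Longrightarrow> norm (V' (x t)) \<le> L"
    using L0 by (auto simp: L_def le_max_iff_disj)
  have "norm (y t - x t) \<le> 0 + e" if "e > 0" for e
  proof -
    define a where "a = min e \<delta> / exp ((L + 1) * T)"
    have "norm (y t - x t) \<le> (a + 0 * T) * exp ((L + 1) * T)"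
    proof (rule gronwall_forward[where u = "\<lambda>t. y t - x t" and \<delta> = \<delta>])
      fix r assume r: "r \<in> {0..T}"
      show "((\<lambda>t. y t - x t) has_vector_derivative V (y r) - V (x r)) (at r within {0..T})"
        by (intro has_vector_derivative_diff x y r)
      assume u: "norm (y r - x r) < \<delta>"
      have "norm (V (y r) - V (x r) - blinfun_apply (V' (x r)) (y r - x r)) \<le> norm (y r - x r)"
        using \<delta>(2)[OF r u] by simp
      moreover have "norm (blinfun_apply (V' (x r)) (y r - x r)) \<le> L * norm (y r - x r)"
        by (rule order_trans[OF norm_blinfun mult_right_mono[OF L(2)[OF r]]]) simp
      ultimately show "norm (V (y r) - V (x r)) \<le> (L + 1) * norm (y r - x r) + 0"
        using norm_triangle_sub[of "V (y r) - V (x r)" "blinfun_apply (V' (x r)) (y r - x r)"]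
        by (simp add: algebra_simps)
    qed (use \<open>x 0 = y 0\<close> \<delta> that L t in \<open>auto simp: a_def\<close>)
    then show ?thesis by (simp add: a_def)
  qed
  then have "norm (y t - x t) \<le> 0" by (rule field_le_epsilon)
  then show ?thesis by simp
qed


section \<open>Smooth dependence of integral curves on initial values\<close>

text \<open>The derivative as a point of the operator space. Written through a frame, its continuity
  in operator norm reduces to that of finitely many directional derivatives, which is what
  \<open>Ck_on\<close> gives.\<close>

definition frame_derivative :: "nat \<Rightarrow> (nat \<Rightarrow> 'a::real_normed_vector) \<Rightarrow> (nat \<Rightarrow> 'a \<Rightarrow>\<^sub>L real) \<Rightarrow>
    ('a \<Rightarrow> 'b::real_normed_vector) \<Rightarrow> 'a \<Rightarrow> 'a \<Rightarrow>\<^sub>L 'b" where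
  "frame_derivative n b \<beta> f z = (\<Sum>i<n. blinfun_scaleR_left (frechet_derivative f (at z) (b i)) o\<^sub>L \<beta> i)"

lemma frame_derivative_apply:
  "blinfun_apply (frame_derivative n b \<beta> f z) v = (\<Sum>i<n. \<beta> i v *\<^sub>R frechet_derivative f (at z) (b i))"
  by (simp add: frame_derivative_def blinfun.sum_left)

lemma frame_derivative:
  assumes F: "frame n b \<beta>" and f: "Ck_on (Suc 0) UNIV f"
  shows "(f has_derivative blinfun_apply (frame_derivative n b \<beta> f z)) (at z)"
    and "continuous_on UNIV (frame_derivative n b \<beta> f)"
proof -
  have d: "(f has_derivative frechet_derivative f (at z)) (at z)"
    using Ck_on_has_derivative[OF f] by simp
  have "frechet_derivative f (at z) = blinfun_apply (frame_derivative n b \<beta> f z)"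
    unfolding frame_derivative_apply using linear_frame_eq[OF F has_derivative_linear[OF d]] by (intro ext)
  then show "(f has_derivative blinfun_apply (frame_derivative n b \<beta> f z)) (at z)" using d by simp
  show "continuous_on UNIV (frame_derivative n b \<beta> f)"
    unfolding frame_derivative_def using f
    by (intro continuous_on_sum bounded_linear.continuous_on[OF bounded_bilinear.bounded_linear_left[OF bounded_bilinear_blinfun_compose]]
        bounded_linear.continuous_on[OF bounded_linear_blinfun_scaleR_left]) auto
qed

text \<open>Compare with the solution for a fixed x0: the difference satisfies a linear equation
  with coefficient \<open>M (x, t)\<close> and source G, where G collects the variation of M and B
  and vanishes at x0. Near x0 the tube lemma makes G uniformly small and keeps M within 1 of its
  values at x0, hence the rate L + 1.\<close>

lemma linear_ode_continuous:
  fixes Y :: "'p::real_normed_vector \<times> real \<Rightarrow> 'e::real_normed_vector"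
  assumes Y: "\<And>x t. ((\<lambda>t. Y (x, t)) has_vector_derivative blinfun_apply (M (x, t)) (Y (x, t)) + B (x, t)) (at t)"
    and Y0: "\<And>x. Y (x, 0) = c" and M: "continuous_on UNIV M" and B: "continuous_on UNIV B"
  shows "continuous_on UNIV Y"
  unfolding continuous_on_eq_continuous_at[OF open_UNIV]
proof
  fix z :: "'p \<times> real"
  obtain x0 t0 where z: "z = (x0, t0)" by fastforce
  define T where "T = \<bar>t0\<bar> + 1"
  have T: "T \<ge> 0" by (simp add: T_def)
  have Yc: "continuous_on K (\<lambda>t. Y (x0, t))" for K
    using Y by (meson continuous_at_imp_continuous_on has_vector_derivative_continuous)
  have "bounded ((\<lambda>t. M (x0, t)) ` {-T..T})"
    by (intro compact_imp_bounded compact_continuous_image continuous_on_compose2[OF M] continuous_intros) auto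
  then obtain L0 where L0: "\<And>t. t \<in> {-T..T} \<Longrightarrow> norm (M (x0, t)) \<le> L0"
    unfolding bounded_iff by blast
  define L where "L = max L0 0"
  have L: "L \<ge> 0" "\<And>t. t \<in> {-T..T} \<Longrightarrow> norm (M (x0, t)) \<le> L"
    using L0 by (auto simp: L_def le_max_iff_disj)
  define G where "G z = blinfun_apply (M z - M (x0, snd z)) (Y (x0, snd z)) + (B z - B (x0, snd z))" for z
  have Mc: "continuous_on (UNIV \<times> {-T..T}) M" using M by (rule continuous_on_subset) simp
  have Gc: "continuous_on (UNIV \<times> {-T..T}) G"
    unfolding G_def
    by (intro continuous_intros continuous_on_compose2[OF Yc[of UNIV]] continuous_on_compose2[OF M]
        continuous_on_compose2[OF B]) auto
  have unif: "\<exists>X. x0 \<in> X \<and> open X \<and> (\<forall>x\<in>X. \<forall>t\<in>{-T..T}. norm (Y (x, t) - Y (x0, t)) \<le> e)" if "e > 0" for e :: real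
  proof -
    define e' where "e' = e / ((T + 1) * exp ((L + 1) * T))"
    have e': "e' > 0" using that T by (simp add: e'_def)
    obtain X1 where X1: "x0 \<in> X1" "open X1" "\<forall>x\<in>X1 \<inter> UNIV. \<forall>t\<in>{-T..T}. dist (M (x, t)) (M (x0, t)) \<le> 1"
      by (rule continuous_on_prod_compactE[OF Mc compact_Icc UNIV_I[of x0] zero_less_one])
    obtain X2 where X2: "x0 \<in> X2" "open X2" "\<forall>x\<in>X2 \<inter> UNIV. \<forall>t\<in>{-T..T}. dist (G (x, t)) (G (x0, t)) \<le> e'"
      by (rule continuous_on_prod_compactE[OF Gc compact_Icc UNIV_I[of x0] e'])
    have "norm (Y (x, t) - Y (x0, t)) \<le> e" if x: "x \<in> X1 \<inter> X2" and t: "t \<in> {-T..T}" for x t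
    proof -
      have "norm (Y (x, t) - Y (x0, t)) \<le> (norm (Y (x, 0) - Y (x0, 0)) + e' * T) * exp ((L + 1) * T)"
      proof (rule gronwall_linear[where u = "\<lambda>t. Y (x, t) - Y (x0, t)", OF has_vector_derivative_diff[OF Y Y]])
        fix r assume r: "r \<in> {-T..T}"
        have eq: "blinfun_apply (M (x, r)) (Y (x, r)) + B (x, r) - (blinfun_apply (M (x0, r)) (Y (x0, r)) + B (x0, r)) =
          blinfun_apply (M (x, r)) (Y (x, r) - Y (x0, r)) + G (x, r)"
          by (simp add: G_def blinfun.diff_right blinfun.diff_left)
        have "norm (M (x, r) - M (x0, r)) \<le> 1" using X1(3) x r by (auto simp: dist_norm)
        then have "norm (M (x, r)) \<le> L + 1"
          using norm_triangle_sub[of "M (x, r)" "M (x0, r)"] L(2)[OF r] by simp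
        then have 1: "norm (blinfun_apply (M (x, r)) (Y (x, r) - Y (x0, r))) \<le> (L + 1) * norm (Y (x, r) - Y (x0, r))"
          by (intro order_trans[OF norm_blinfun mult_right_mono]) auto
        have "G (x0, r) = 0" by (simp add: G_def)
        then have 2: "norm (G (x, r)) \<le> e'" using X2(3) x r by (force simp: dist_norm)
        show "norm (blinfun_apply (M (x, r)) (Y (x, r)) + B (x, r) - (blinfun_apply (M (x0, r)) (Y (x0, r)) + B (x0, r)))
            \<le> (L + 1) * norm (Y (x, r) - Y (x0, r)) + e'"
          unfolding eq by (rule norm_triangle_mono[OF 1 2])
      qed (use L e' t in auto)
      also have "\<dots> = e * (T / (T + 1))" using T by (simp add: Y0 e'_def)
      also have "\<dots> \<le> e * 1" using \<open>e > 0\<close> T by (intro mult_left_mono) auto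
      finally show ?thesis by simp
    qed
    then show ?thesis using X1 X2 by (intro exI[of _ "X1 \<inter> X2"]) auto
  qed
  have "(Y \<longlongrightarrow> Y z) (at z)"
  proof (rule tendstoI)
    fix e :: real assume "e > 0"
    then obtain X where X: "x0 \<in> X" "open X" "\<And>x t. x \<in> X \<Longrightarrow> t \<in> {-T..T} \<Longrightarrow> norm (Y (x, t) - Y (x0, t)) \<le> e / 3"
      using unif[of "e / 3"] by auto
    have f: "(fst \<longlongrightarrow> x0) (at z)" and s: "(snd \<longlongrightarrow> t0) (at z)"
      unfolding z by (auto intro!: tendsto_eq_intros)
    have "\<forall>\<^sub>F w in at z. fst w \<in> X" using topological_tendstoD[OF f X(2,1)] .
    moreover have "\<forall>\<^sub>F w in at z. dist (snd w) t0 < 1" using tendstoD[OF s zero_less_one] .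
    moreover have "\<forall>\<^sub>F w in at z. dist (Y (x0, snd w)) (Y (x0, t0)) < e / 3"
      using continuous_on_tendsto_compose[OF Yc[of UNIV] s] \<open>e > 0\<close> by (intro tendstoD) auto
    ultimately show "\<forall>\<^sub>F w in at z. dist (Y w) (Y z) < e"
    proof eventually_elim
      case (elim w)
      have "snd w \<in> {-T..T}" using elim(2) by (auto simp: T_def dist_real_def abs_if split: if_splits)
      from X(3)[OF elim(1) this] have "dist (Y w) (Y (x0, snd w)) \<le> e / 3" by (simp add: dist_norm)
      with elim(3) show ?case
        using dist_triangle[of "Y w" "Y z" "Y (x0, snd w)"] \<open>e > 0\<close> unfolding z by linarith
    qed
  qed
  then show "isCont Y z" by (simp add: isCont_def)
qed

text \<open>Differentiating a linear equation in its parameter gives a linear equation with the same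
  coefficients \<open>A i\<close>, a new source made of Y and first derivatives of
  \<open>A i\<close> and B, and initial value 0. For data of class \<open>Suc k\<close> this source
  is of class k, so the induction hypothesis, general in B, Y and c, applies to the
  derivative.\<close>

lemma linear_ode_Ck:
  fixes Y :: "'p::banach \<times> real \<Rightarrow> 'e::banach"
  assumes F: "frame n (b :: nat \<Rightarrow> 'e) \<beta>" and P: "\<exists>n b \<beta>. frame n (b :: nat \<Rightarrow> 'p) \<beta>"
  shows "(\<And>i. i < n \<Longrightarrow> Ck_on k UNIV (A i)) \<Longrightarrow> Ck_on k UNIV B \<Longrightarrow>
    (\<And>x t. ((\<lambda>t. Y (x, t)) has_vector_derivative
      (\<Sum>i<n. \<beta> i (Y (x, t)) *\<^sub>R A i (x, t)) + B (x, t)) (at t)) \<Longrightarrow>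
    (\<And>x. Y (x, 0) = c) \<Longrightarrow> Ck_on k UNIV Y"
proof (induction k arbitrary: B Y c)
  case 0
  define M where "M z = (\<Sum>i<n. blinfun_scaleR_left (A i z) o\<^sub>L \<beta> i)" for z
  have "continuous_on UNIV M"
    unfolding M_def using 0
    by (intro continuous_on_sum bounded_linear.continuous_on[OF bounded_bilinear.bounded_linear_left[OF bounded_bilinear_blinfun_compose]]
        bounded_linear.continuous_on[OF bounded_linear_blinfun_scaleR_left]) auto
  moreover have "blinfun_apply (M z) v = (\<Sum>i<n. \<beta> i v *\<^sub>R A i z)" for z v
    by (simp add: M_def blinfun.sum_left)
  ultimately show ?case
    using linear_ode_continuous[of Y M B c] 0 by simp
next
  case (Suc k)
  note A = Suc.prems(1) and B = Suc.prems(2) and Yd = Suc.prems(3) and Y0 = Suc.prems(4)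
  \<comment> \<open>Y enters the source of the differentiated equation, so its own class k is needed
    first; the induction hypothesis for the original equation supplies it.\<close>
  have Yk: "Ck_on k UNIV Y"
    by (rule Suc.IH[OF _ _ Yd Y0]) (use A B Ck_on_Suc_imp in blast)+
  \<comment> \<open>The equation made autonomous: parameter and time join the state, the parameter
    at rest and time advancing at unit speed.\<close>
  define V :: "('p \<times> real) \<times> 'e \<Rightarrow> ('p \<times> real) \<times> 'e" where
    "V q = ((0, 1), (\<Sum>i<n. \<beta> i (snd q) *\<^sub>R A i (fst q)) + B (fst q))" for q
  define y where "y x t = ((x, t), Y (x, t))" for x t
  define J :: "'p \<Rightarrow>\<^sub>L (('p \<times> real) \<times> 'e)" where "J = Blinfun (\<lambda>h. ((h, 0), 0))"
  have J: "blinfun_apply J h = ((h, 0), 0)" for h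
    unfolding J_def by (subst bounded_linear_Blinfun_apply) (auto intro!: bounded_linear_intros)
  obtain m c' \<gamma> where G: "frame m (c' :: nat \<Rightarrow> ('p \<times> real) \<times> 'e) \<gamma>"
    using frame_prod_ex[OF frame_prod_ex[OF P frame_real_ex]] F by blast
  obtain l d \<delta> where D: "frame l (d :: nat \<Rightarrow> 'p \<times> real) \<delta>"
    using frame_prod_ex[OF P frame_real_ex] by blast
  have fst_comp: "Ck_on (Suc k) UNIV (\<lambda>q :: ('p \<times> real) \<times> 'e. f (fst q))" if "Ck_on (Suc k) UNIV f"
    for f :: "'p \<times> real \<Rightarrow> 'e"
    by (rule Ck_on_compose[OF D open_UNIV open_UNIV _ Ck_on_bounded_linear[OF open_UNIV bounded_linear_fst] that]) simp
  have snd_comp: "Ck_on (Suc k) UNIV (\<lambda>q :: ('p \<times> real) \<times> 'e. \<beta> i (snd q))" for i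
    by (intro Ck_on_bounded_linear_comp[OF open_UNIV blinfun.bounded_linear_right]
        Ck_on_bounded_linear[OF open_UNIV bounded_linear_snd])
  have V1: "Ck_on (Suc k) UNIV V"
    unfolding V_def
    by (rule Ck_on_Pair[OF open_UNIV Ck_on_const Ck_on_add[OF open_UNIV Ck_on_sum[OF open_UNIV] fst_comp[OF B]]],
        rule Ck_on_scaleR[OF open_UNIV snd_comp fst_comp[OF A]]) simp
  have "Ck_on (Suc 0) UNIV V"
    using V1 by (induction k) (auto simp: simp del: Ck_on.simps intro: Ck_on_Suc_imp)
  note V' = frame_derivative[OF G this]
  have Vd: "(V has_derivative (\<lambda>v. ((0, 0), (\<Sum>i<n. \<beta> i (snd q) *\<^sub>R frechet_derivative (A i) (at (fst q)) (fst v)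
      + \<beta> i (snd v) *\<^sub>R A i (fst q)) + frechet_derivative B (at (fst q)) (fst v)))) (at q)" for q
  proof -
    have comp: "((\<lambda>q :: ('p \<times> real) \<times> 'e. f (fst q)) has_derivative (\<lambda>v. frechet_derivative f (at (fst q)) (fst v))) (at q)"
      if "Ck_on (Suc k) UNIV f" for f :: "'p \<times> real \<Rightarrow> 'e"
      using has_derivative_compose[OF has_derivative_fst[OF has_derivative_ident] Ck_on_has_derivative[OF that]] by simp
    have lin: "((\<lambda>q :: ('p \<times> real) \<times> 'e. \<beta> i (snd q)) has_derivative (\<lambda>v. \<beta> i (snd v))) (at q)" for i
      by (intro bounded_linear.has_derivative[OF blinfun.bounded_linear_right] has_derivative_snd has_derivative_ident)
    have "(V has_derivative (\<lambda>v. (0, (\<Sum>i<n. \<beta> i (snd q) *\<^sub>R frechet_derivative (A i) (at (fst q)) (fst v)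
      + \<beta> i (snd v) *\<^sub>R A i (fst q)) + frechet_derivative B (at (fst q)) (fst v)))) (at q)"
      unfolding V_def
      by (intro has_derivative_Pair has_derivative_const has_derivative_add has_derivative_sum
          has_derivative_scaleR lin comp A B) auto
    then show ?thesis by (simp add: zero_prod_def)
  qed
  have V'_eq: "blinfun_apply (frame_derivative m c' \<gamma> V q) v = ((0, 0), (\<Sum>i<n. \<beta> i (snd q) *\<^sub>R frechet_derivative (A i) (at (fst q)) (fst v)
      + \<beta> i (snd v) *\<^sub>R A i (fst q)) + frechet_derivative B (at (fst q)) (fst v))" for q v
    using has_derivative_unique[OF V'(1) Vd] by (rule fun_cong)
  interpret integral_curve_family V "frame_derivative m c' \<gamma> V" y J
  proof
    fix x :: 'p and t :: real
    show "(y x has_vector_derivative V (y x t)) (at t)"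
      unfolding y_def V_def using Yd[of x t]
      by (auto intro!: has_vector_derivative_Pair derivative_eq_intros)
  qed (use V' in \<open>auto simp: y_def J Y0\<close>)
  obtain Z where Z: "\<And>x h t. (Z x h has_vector_derivative blinfun_apply (frame_derivative m c' \<gamma> V (y x t)) (Z x h t)) (at t)"
    and Z0: "\<And>x h. Z x h 0 = blinfun_apply J h"
    using variational_solution_exists by metis
  note yd = has_derivative_joint[OF Z Z0]
  \<comment> \<open>The first component of \<open>y x t\<close> is just (x, t), so its derivative is
    the identity; reading this at (h, 0) identifies the first component of the variational solution
    without solving for it.\<close>
  have fstZ: "fst (Z x h t) = (h, 0)" for x h t
  proof -
    have "((\<lambda>z. fst (y (fst z) (snd z))) has_derivative (\<lambda>h. fst (Z x (fst h) t + snd h *\<^sub>R V (y x t)))) (at (x, t))"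
      using yd by (rule has_derivative_fst)
    moreover have "((\<lambda>z. fst (y (fst z) (snd z))) has_derivative (\<lambda>h. h)) (at (x, t))"
      by (simp add: y_def)
    ultimately have "(\<lambda>h. fst (Z x (fst h) t + snd h *\<^sub>R V (y x t))) = (\<lambda>h. h)"
      by (rule has_derivative_unique)
    from fun_cong[OF this, of "(h, 0)"] show ?thesis by simp
  qed
  have YD: "(Y has_derivative (\<lambda>h. snd (Z (fst z) (fst h) (snd z)) + snd h *\<^sub>R
      ((\<Sum>i<n. \<beta> i (Y z) *\<^sub>R A i z) + B z))) (at z)" for z
    using has_derivative_snd[OF yd[of "fst z" "snd z"]] by (simp add: y_def V_def)
  show ?case
  proof (rule Ck_on_SucI[OF open_UNIV YD])
    fix v :: "'p \<times> real"
    obtain h s where v: "v = (h, s)" by fastforce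
    have W: "Ck_on k UNIV (\<lambda>z. snd (Z (fst z) h (snd z)))"
    proof (rule Suc.IH)
      show "Ck_on k UNIV (A i)" if "i < n" for i using A[OF that] by (rule Ck_on_Suc_imp)
      show "Ck_on k UNIV (\<lambda>z. (\<Sum>i<n. \<beta> i (Y z) *\<^sub>R frechet_derivative (A i) (at z) (h, 0))
          + frechet_derivative B (at z) (h, 0))"
        by (intro Ck_on_add Ck_on_sum Ck_on_scaleR Ck_on_bounded_linear_comp[OF _ blinfun.bounded_linear_right] Yk
            Ck_on_frechet A B) auto
      show "snd (Z (fst (x, 0)) h (snd (x, 0))) = 0" for x by (simp add: Z0 J)
    next
      fix x t
      have "((\<lambda>t. snd (Z x h t)) has_vector_derivative snd (blinfun_apply (frame_derivative m c' \<gamma> V (y x t)) (Z x h t))) (at t)"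
        using bounded_linear.has_vector_derivative[OF bounded_linear_snd Z] .
      then show "((\<lambda>t. snd (Z (fst (x, t)) h (snd (x, t)))) has_vector_derivative
        (\<Sum>i<n. \<beta> i (snd (Z (fst (x, t)) h (snd (x, t)))) *\<^sub>R A i (x, t)) +
        ((\<Sum>i<n. \<beta> i (Y (x, t)) *\<^sub>R frechet_derivative (A i) (at (x, t)) (h, 0))
          + frechet_derivative B (at (x, t)) (h, 0))) (at t)"
        by (simp add: V'_eq y_def fstZ sum.distrib add_ac)
    qed
    show "Ck_on k UNIV (\<lambda>z. snd (Z (fst z) (fst v) (snd z)) + snd v *\<^sub>R
      ((\<Sum>i<n. \<beta> i (Y z) *\<^sub>R A i z) + B z))"
      unfolding v fst_conv snd_conv
      by (intro W Ck_on_add Ck_on_sum Ck_on_scaleR Ck_on_const Ck_on_bounded_linear_comp[OF _ blinfun.bounded_linear_right] Yk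
            Ck_on_Suc_imp[OF A] Ck_on_Suc_imp[OF B]) auto
  qed
qed

text \<open>The derivative of the flow in the initial value solves a linear equation whose
  coefficients are derivatives of V along the flow. If the flow is of class k, so are the
  coefficients, hence that derivative by \<open>linear_ode_Ck\<close>, and the flow is of class
  \<open>Suc k\<close>.\<close>

proposition integral_curves_smooth:
  fixes V :: "'a::banach \<Rightarrow> 'a" and \<phi> :: "'a \<times> real \<Rightarrow> 'a"
  assumes F: "frame n (b :: nat \<Rightarrow> 'a) \<beta>" and Vs: "smooth_on UNIV V"
    and \<phi>: "\<And>x t. ((\<lambda>t. \<phi> (x, t)) has_vector_derivative V (\<phi> (x, t))) (at t)"
    and \<phi>0: "\<And>x. \<phi> (x, 0) = x"
  shows "smooth_on UNIV \<phi>"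
proof -
  note V' = frame_derivative[OF F smooth_on_Ck[OF Vs]]
  interpret integral_curve_family V "frame_derivative n b \<beta> V" "\<lambda>x t. \<phi> (x, t)" id_blinfun
    by standard (use V' \<phi> \<phi>0 in auto)
  obtain Z where Z: "\<And>x h t. (Z x h has_vector_derivative blinfun_apply (frame_derivative n b \<beta> V (\<phi> (x, t))) (Z x h t)) (at t)"
    and Z0: "\<And>x h. Z x h 0 = h"
    using variational_solution_exists by (metis blinfun_apply_id_blinfun id_apply)
  have D: "(\<phi> has_derivative (\<lambda>h. Z (fst z) (fst h) (snd z) + snd h *\<^sub>R V (\<phi> z))) (at z)" for z
    using has_derivative_joint[of "\<lambda>h. Z (fst z) h" "fst z" "snd z"] Z Z0 by simp
  have "Ck_on k UNIV \<phi>" for k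
  proof (induction k)
    case 0
    then show ?case using continuous_joint by simp
  next
    case (Suc k)
    show ?case
    proof (rule Ck_on_SucI[OF open_UNIV D])
      fix v :: "'a \<times> real"
      obtain h s where v: "v = (h, s)" by fastforce
      have "Ck_on k UNIV (\<lambda>z. Z (fst z) h (snd z))"
      proof (rule linear_ode_Ck[OF F])
        show "Ck_on k UNIV (\<lambda>z. frechet_derivative V (at (\<phi> z)) (b i))" for i
          by (rule Ck_on_compose[OF F _ open_UNIV _ Suc.IH smooth_on_Ck[OF smooth_on_frechet[OF Vs]]]) auto
        show "Ck_on k UNIV (\<lambda>_ :: 'a \<times> real. 0 :: 'a)" by (rule Ck_on_const)
        show "((\<lambda>t. Z (fst (x, t)) h (snd (x, t))) has_vector_derivative
          (\<Sum>i<n. \<beta> i (Z (fst (x, t)) h (snd (x, t))) *\<^sub>R frechet_derivative V (at (\<phi> (x, t))) (b i)) + 0) (at t)" for x t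
          using Z[of x h t] by (simp add: frame_derivative_apply)
        show "Z (fst (x, 0)) h (snd (x, 0)) = h" for x by (simp add: Z0)
      qed (use F in blast)
      then show "Ck_on k UNIV (\<lambda>z. Z (fst z) (fst v) (snd z) + snd v *\<^sub>R V (\<phi> z))"
        unfolding v fst_conv snd_conv
        by (intro Ck_on_add Ck_on_scaleR Ck_on_const Ck_on_compose[OF F _ open_UNIV _ Suc.IH smooth_on_Ck[OF Vs]]) auto
    qed
  qed
  then show ?thesis by (simp add: smooth_on_def)
qed


section \<open>Charts\<close>

lemma has_derivative_Blinfun_frechet:
  "f differentiable at x \<Longrightarrow> (f has_derivative blinfun_apply (Blinfun (frechet_derivative f (at x)))) (at x)"
  using frechet_derivative_works has_derivative_bounded_linear bounded_linear_Blinfun_apply by metis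

lemma Blinfun_frechet_eq:
  assumes "(f has_derivative blinfun_apply D) (at x)"
  shows "Blinfun (frechet_derivative f (at x)) = D"
  using frechet_derivative_at[OF assms] by (metis blinfun_apply_inverse)

locale chart =
  fixes c :: "('m::t2_space, 'e::real_normed_vector) chart"
  assumes topological: "topological_chart c"
begin

lemma open_domain: "open (fst c)" and open_image: "open (snd c ` fst c)"
  using topological by (auto simp: topological_chart_def)

lemma inv_chart [simp]: "x \<in> fst c \<Longrightarrow> chart_inv c (snd c x) = x"
  using topological by (auto simp: topological_chart_def homeomorphism_def)

lemma chart_inv [simp]: "q \<in> snd c ` fst c \<Longrightarrow> snd c (chart_inv c q) = q"
  using topological by (auto simp: topological_chart_def homeomorphism_def)

lemma chart_inv_in: "q \<in> snd c ` fst c \<Longrightarrow> chart_inv c q \<in> fst c"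
  by (rule inv_into_into)

lemma inj: "inj_on (snd c) (fst c)"
  by (metis inj_onI inv_chart)

lemma isCont_chart: "x \<in> fst c \<Longrightarrow> isCont (snd c) x"
  using topological open_domain continuous_on_eq_continuous_at
  by (auto simp: topological_chart_def homeomorphism_def)

lemma isCont_inv: "q \<in> snd c ` fst c \<Longrightarrow> isCont (chart_inv c) q"
  using topological open_image continuous_on_eq_continuous_at
  by (auto simp: topological_chart_def homeomorphism_def)

lemma isCont_inv_at: "x \<in> fst c \<Longrightarrow> isCont (chart_inv c) (snd c x)"
  by (intro isCont_inv imageI)

lemma open_image_Int: "open U \<Longrightarrow> open (snd c ` (fst c \<inter> U))"
proof -
  assume "open U"
  have "snd c ` (fst c \<inter> U) = snd c ` fst c \<inter> chart_inv c -` U"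
    by (auto simp: image_iff)
  also have "open \<dots>"
    using isCont_inv continuous_at_imp_continuous_on \<open>open U\<close> open_image
    by (intro continuous_open_preimage) blast+
  finally show ?thesis .
qed

lemma eventually_domain:
  assumes "continuous (at w within S) F" "F w \<in> fst c"
  shows "\<forall>\<^sub>F u in at w within S. F u \<in> fst c"
  using assms open_domain by (auto simp: continuous_within intro: topological_tendstoD)

text \<open>Chain rule for a map factored through the manifold. Continuity of F is a hypothesis of
  its own because coordinates outside the domain are arbitrary: it keeps F in the domain of c near
  w, where c can be undone.\<close>

lemma chain:
  assumes "continuous (at w within S) F" "F w \<in> fst c" "w \<in> S"
    and 1: "((\<lambda>u. snd c (F u)) has_derivative D) (at w within S)"
    and 2: "((\<lambda>q. K (chart_inv c q)) has_derivative E) (at (snd c (F w)))"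
  shows "((\<lambda>u. K (F u)) has_derivative (\<lambda>v. E (D v))) (at w within S)"
proof (rule has_derivative_transform_eventually)
  show "((\<lambda>u. K (chart_inv c (snd c (F u)))) has_derivative (\<lambda>v. E (D v))) (at w within S)"
    using has_derivative_compose[OF 1 2] .
  show "\<forall>\<^sub>F u in at w within S. K (chart_inv c (snd c (F u))) = K (F u)"
    using eventually_domain[OF assms(1,2)] by eventually_elim simp
qed (use assms in auto)

end

text \<open>Transition maps are left out on purpose, so that product atlases qualify as soon as
  their members are charts.\<close>

definition atlas_cover :: "('m::t2_space, 'e::real_normed_vector) chart set \<Rightarrow> bool" where
  "atlas_cover A \<longleftrightarrow> (\<forall>c\<in>A. topological_chart c) \<and> (\<Union>c\<in>A. fst c) = UNIV"

lemma atlas_coverD: "atlas_cover A \<Longrightarrow> c \<in> A \<Longrightarrow> chart c"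
  by (simp add: atlas_cover_def chart_def)

lemma smooth_atlas_cover: "smooth_atlas A \<Longrightarrow> atlas_cover A"
  by (simp add: smooth_atlas_def atlas_cover_def)

lemma chart_at: "atlas_cover A \<Longrightarrow> chart_at A x \<in> A" "atlas_cover A \<Longrightarrow> x \<in> fst (chart_at A x)"
proof -
  assume "atlas_cover A"
  then have "\<exists>c. c \<in> A \<and> x \<in> fst c" unfolding atlas_cover_def by blast
  from someI_ex[OF this] show "chart_at A x \<in> A" "x \<in> fst (chart_at A x)"
    by (simp_all add: chart_at_def)
qed

lemma smooth_mapD:
  assumes "smooth_map A B f" "c \<in> A" "d \<in> B"
  shows "open (snd c ` (fst c \<inter> f -` fst d))"
    and "smooth_on (snd c ` (fst c \<inter> f -` fst d)) (\<lambda>q. snd d (f (chart_inv c q)))"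
  using assms by (auto simp: smooth_map_def o_def)

lemma smooth_map_rep_differentiable:
  assumes "smooth_map A B f" "c \<in> A" "d \<in> B" "x \<in> fst c" "f x \<in> fst d"
  shows "(\<lambda>q. snd d (f (chart_inv c q))) differentiable at (snd c x)"
  using smooth_on_has_derivative[OF smooth_mapD(2)[OF assms(1-3)], of "snd c x"] assms
  by (auto simp: differentiable_def)

text \<open>The representative in charts is differentiable and hence continuous. The openness clause
  of \<open>smooth_map\<close> provides a neighbourhood of x that f maps into the domain of d, where
  d can be undone.\<close>

lemma smooth_map_isCont:
  assumes A: "atlas_cover A" and B: "atlas_cover B" and f: "smooth_map A B f"
  shows "isCont f x"
proof -
  obtain c d where c: "c \<in> A" "x \<in> fst c" and d: "d \<in> B" "f x \<in> fst d"
    using A B unfolding atlas_cover_def by blast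
  interpret c: chart c using atlas_coverD[OF A c(1)] .
  interpret d: chart d using atlas_coverD[OF B d(1)] .
  define U where "U = fst c \<inter> f -` fst d"
  have W: "open (snd c ` U)" unfolding U_def using smooth_mapD(1)[OF f c(1) d(1)] .
  \<comment> \<open>Injectivity of the chart makes U the full preimage of its open coordinate
    image.\<close>
  have U: "U = fst c \<inter> snd c -` (snd c ` U)"
    using c.inj by (auto simp: U_def inj_on_def)
  have "open U"
    by (subst U, rule continuous_open_preimage)
      (use W c.open_domain c.isCont_chart continuous_at_imp_continuous_on in blast)+
  have xU: "x \<in> U" using c d by (simp add: U_def)
  have "isCont (\<lambda>q. snd d (f (chart_inv c q))) (snd c x)"
    using smooth_map_rep_differentiable[OF f c(1) d(1) c(2) d(2)] by (rule differentiable_imp_continuous_within)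
  then have "isCont (\<lambda>y. snd d (f (chart_inv c (snd c y)))) x"
    by (rule isCont_o2[OF c.isCont_chart[OF c(2)]])
  moreover have "isCont (chart_inv d) (snd d (f (chart_inv c (snd c x))))"
    using d.isCont_inv_at c d by simp
  ultimately have "isCont (\<lambda>y. chart_inv d (snd d (f (chart_inv c (snd c y))))) x"
    using isCont_o2 by fast
  moreover have "\<forall>\<^sub>F y in nhds x. chart_inv d (snd d (f (chart_inv c (snd c y)))) = f y"
    using eventually_nhds_in_open[OF \<open>open U\<close> xU] by eventually_elim (simp add: U_def)
  ultimately show ?thesis using isCont_cong by fast
qed

lemma coord_change_has_derivative:
  assumes "smooth_atlas A" "c \<in> A" "d \<in> A" "x \<in> fst c" "x \<in> fst d"
  shows "((\<lambda>q. snd d (chart_inv c q)) has_derivative blinfun_apply (coord_change c d x)) (at (snd c x))"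
proof -
  have "smooth_on (snd c ` (fst c \<inter> fst d)) (\<lambda>q. snd d (chart_inv c q))"
    using assms by (auto simp: smooth_atlas_def smooth_transition_def o_def)
  from smooth_on_has_derivative[OF this, of "snd c x"] assms
  have "(\<lambda>q. snd d (chart_inv c q)) differentiable at (snd c x)" by (auto simp: differentiable_def)
  then show ?thesis
    unfolding coord_change_def o_def by (rule has_derivative_Blinfun_frechet)
qed

lemma coord_change_self:
  assumes "chart c" "x \<in> fst c"
  shows "coord_change c c x = id_blinfun"
proof -
  interpret chart c by fact
  have "((\<lambda>q. snd c (chart_inv c q)) has_derivative blinfun_apply id_blinfun) (at (snd c x))"
    by (rule has_derivative_transform_within_open[where f = "\<lambda>q. q" and s = "snd c ` fst c"])
      (use assms open_image in \<open>auto simp: id_def\<close>)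
  then show ?thesis unfolding coord_change_def o_def by (rule Blinfun_frechet_eq)
qed

lemma coord_change_inverse:
  fixes A :: "('m::t2_space, 'e::real_normed_vector) chart set"
  assumes "smooth_atlas A" "c \<in> A" "d \<in> A" "x \<in> fst c" "x \<in> fst d"
  shows "coord_change d c x o\<^sub>L coord_change c d x = id_blinfun"
proof -
  interpret c: chart c using assms smooth_atlas_cover atlas_coverD by blast
  interpret d: chart d using assms smooth_atlas_cover atlas_coverD by blast
  have "((\<lambda>q. snd c (chart_inv c q)) has_derivative (\<lambda>v. blinfun_apply (coord_change d c x) (blinfun_apply (coord_change c d x) v))) (at (snd c x))"
    by (rule d.chain[where F = "chart_inv c"])
      (use assms c.isCont_inv_at coord_change_has_derivative[OF assms(1)] in auto)
  then have "((\<lambda>q. snd c (chart_inv c q)) has_derivative blinfun_apply (coord_change d c x o\<^sub>L coord_change c d x)) (at (snd c x))"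
    by (simp add: blinfun_compose.rep_eq o_def)
  from Blinfun_frechet_eq[OF this] coord_change_self[OF c.chart_axioms assms(4)]
  show ?thesis by (simp add: coord_change_def o_def)
qed

lemma tangent_map_has_derivative:
  assumes "atlas_cover A" "atlas_cover B" "smooth_map A B f"
  shows "((\<lambda>q. snd (chart_at B (f x)) (f (chart_inv (chart_at A x) q))) has_derivative
    blinfun_apply (tangent_map A B f x)) (at (snd (chart_at A x) x))"
  unfolding tangent_map_def o_def
  by (intro has_derivative_Blinfun_frechet smooth_map_rep_differentiable[OF assms(3)] chart_at assms)

lemma tangent_map_eqI:
  assumes "((\<lambda>q. snd (chart_at B (f x)) (f (chart_inv (chart_at A x) q))) has_derivative
    blinfun_apply D) (at (snd (chart_at A x) x))"
  shows "tangent_map A B f x = D"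
  unfolding tangent_map_def o_def using assms by (rule Blinfun_frechet_eq)

lemma tangent_map_compose:
  assumes A: "atlas_cover A" and B: "atlas_cover B" and C: "atlas_cover C"
    and f: "smooth_map A B f" and g: "smooth_map B C g"
  shows "tangent_map A C (\<lambda>x. g (f x)) x = tangent_map B C g (f x) o\<^sub>L tangent_map A B f x"
proof (rule tangent_map_eqI)
  interpret a: chart "chart_at A x" by (intro atlas_coverD[OF A] chart_at A)
  interpret b: chart "chart_at B (f x)" by (intro atlas_coverD[OF B] chart_at B)
  have ax: "x \<in> fst (chart_at A x)" by (rule chart_at(2)[OF A])
  have "((\<lambda>q. snd (chart_at C (g (f x))) (g (f (chart_inv (chart_at A x) q)))) has_derivative
    (\<lambda>v. blinfun_apply (tangent_map B C g (f x)) (blinfun_apply (tangent_map A B f x) v))) (at (snd (chart_at A x) x))"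
  proof (rule b.chain)
    show "isCont (\<lambda>q. f (chart_inv (chart_at A x) q)) (snd (chart_at A x) x)"
      by (rule isCont_o2[OF a.isCont_inv_at[OF ax]]) (rule smooth_map_isCont[OF A B f])
  qed (use tangent_map_has_derivative[OF A B f] tangent_map_has_derivative[OF B C g] ax chart_at(2)[OF B] in auto)
  then show "((\<lambda>q. snd (chart_at C (g (f x))) (g (f (chart_inv (chart_at A x) q)))) has_derivative
    blinfun_apply (tangent_map B C g (f x) o\<^sub>L tangent_map A B f x)) (at (snd (chart_at A x) x))"
    by (simp add: blinfun_compose.rep_eq o_def)
qed

lemma tangent_map_id:
  assumes A: "atlas_cover A"
  shows "tangent_map A A (\<lambda>x. x) x = id_blinfun"
  using coord_change_self[OF atlas_coverD[OF A chart_at(1)[OF A]] chart_at(2)[OF A], of x]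
  by (simp add: tangent_map_def coord_change_def o_def)

section \<open>Products of charts and atlases\<close>

lemma chart_prod:
  assumes "chart c" "chart d"
  shows "chart (fst c \<times> fst d, map_prod (snd c) (snd d))"
    and "\<And>p q. p \<in> snd c ` fst c \<Longrightarrow> q \<in> snd d ` fst d \<Longrightarrow>
      chart_inv (fst c \<times> fst d, map_prod (snd c) (snd d)) (p, q) = (chart_inv c p, chart_inv d q)"
proof -
  interpret c: chart c by fact
  interpret d: chart d by fact
  let ?e = "(fst c \<times> fst d, map_prod (snd c) (snd d))"
  have img: "snd ?e ` fst ?e = snd c ` fst c \<times> snd d ` fst d"
    by (force simp: map_prod_def)
  have inj: "inj_on (snd ?e) (fst ?e)"
    using c.inj d.inj by (auto simp: inj_on_def)
  show inv: "chart_inv ?e (p, q) = (chart_inv c p, chart_inv d q)"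
    if "p \<in> snd c ` fst c" "q \<in> snd d ` fst d" for p q
    by (rule inv_into_f_eq[OF inj]) (use that c.chart_inv_in d.chart_inv_in in auto)
  have "homeomorphism (fst ?e) (snd ?e ` fst ?e) (snd ?e) (chart_inv ?e)"
    unfolding homeomorphism_def
  proof (intro conjI ballI)
    show "continuous_on (fst ?e) (snd ?e)"
      unfolding fst_conv snd_conv map_prod_def case_prod_beta
      using c.isCont_chart d.isCont_chart
      by (intro continuous_on_Pair continuous_on_compose2[of "fst c" "snd c" _ fst]
          continuous_on_compose2[of "fst d" "snd d" _ snd]
          continuous_on_fst continuous_on_snd continuous_on_id continuous_at_imp_continuous_on) auto
    have "continuous_on (snd c ` fst c \<times> snd d ` fst d) (\<lambda>z. (chart_inv c (fst z), chart_inv d (snd z)))"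
      using c.isCont_inv d.isCont_inv
      by (intro continuous_on_Pair continuous_on_compose2[of "snd c ` fst c" "chart_inv c" _ fst]
          continuous_on_compose2[of "snd d ` fst d" "chart_inv d" _ snd]
          continuous_on_fst continuous_on_snd continuous_on_id continuous_at_imp_continuous_on) auto
    then show "continuous_on (snd ?e ` fst ?e) (chart_inv ?e)"
      unfolding img by (rule continuous_on_eq) (auto simp: inv[unfolded fst_conv snd_conv])
    show "chart_inv ?e (snd ?e x) = x" if "x \<in> fst ?e" for x
      using inj that by (rule inv_into_f_f)
    then show "chart_inv ?e ` snd ?e ` fst ?e = fst ?e" by force
    show "snd ?e (chart_inv ?e q) = q" if "q \<in> snd ?e ` fst ?e" for q
      using that by (rule f_inv_into_f)
  qed simp
  then show "chart ?e"
    unfolding chart_def topological_chart_def img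
    using c.open_domain d.open_domain c.open_image d.open_image by (simp add: open_Times)
qed

lemma atlas_cover_prod:
  assumes "atlas_cover A" "atlas_cover B"
  shows "atlas_cover (prod_atlas A B)"
  unfolding atlas_cover_def
proof (intro conjI ballI)
  fix e assume "e \<in> prod_atlas A B"
  then obtain c d where "e = (fst c \<times> fst d, map_prod (snd c) (snd d))" "c \<in> A" "d \<in> B"
    unfolding prod_atlas_def by blast
  then show "topological_chart e"
    using chart_prod(1)[OF atlas_coverD[OF assms(1)] atlas_coverD[OF assms(2)]] by (simp add: chart_def)
next
  have "\<exists>e\<in>prod_atlas A B. z \<in> fst e" for z
  proof -
    have "(fst (chart_at A (fst z)) \<times> fst (chart_at B (snd z)),
        map_prod (snd (chart_at A (fst z))) (snd (chart_at B (snd z)))) \<in> prod_atlas A B"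
      using chart_at(1)[OF assms(1)] chart_at(1)[OF assms(2)] unfolding prod_atlas_def by blast
    then show ?thesis
      using chart_at(2)[OF assms(1), of "fst z"] chart_at(2)[OF assms(2), of "snd z"]
      by (intro bexI) (auto simp: mem_Times_iff)
  qed
  then show "(\<Union>e\<in>prod_atlas A B. fst e) = UNIV" by blast
qed


section \<open>Left translations in charts\<close>

context lie_group
begin

declare carrier_UNIV [simp]

lemma cover: "atlas_cover (atlas G)"
  by (rule smooth_atlas_cover[OF smooth_atlas])

lemma atlas_chart: "c \<in> atlas G \<Longrightarrow> chart c"
  by (rule atlas_coverD[OF cover])

lemma frame_ex: "\<exists>n b \<beta>. frame n (b :: nat \<Rightarrow> 'e) \<beta>"
  using finite_dimensional frame_inner_ex by blast

lemma frame_pair_ex: "\<exists>n b \<beta>. frame n (b :: nat \<Rightarrow> 'e \<times> 'e) \<beta>"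
  by (intro frame_prod_ex frame_ex)

definition "unit_chart = chart_at (atlas G) \<one>"

definition "unit_coord = snd unit_chart \<one>"

lemma unit_chart [simp]: "unit_chart \<in> atlas G" "\<one> \<in> fst unit_chart"
  by (simp_all add: unit_chart_def chart_at[OF cover])

sublocale unit: chart unit_chart
  by (rule atlas_chart) simp

lemma unit_coord [simp]: "unit_coord \<in> snd unit_chart ` fst unit_chart" "chart_inv unit_chart unit_coord = \<one>"
  by (simp_all add: unit_coord_def)

lemma isCont_mult: "isCont (\<lambda>(g, h). g \<otimes> h) z"
  by (rule smooth_map_isCont[OF atlas_cover_prod[OF cover cover] cover smooth_mult])

lemma continuous_mult:
  assumes "continuous (at w within S) f" "continuous (at w within S) g"
  shows "continuous (at w within S) (\<lambda>u. f u \<otimes> g u)"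
  using isCont_tendsto_compose[OF isCont_mult tendsto_Pair[OF assms[unfolded continuous_within]]]
  by (simp add: continuous_within)

lemma continuous_inverse:
  assumes "continuous (at w within S) f"
  shows "continuous (at w within S) (\<lambda>u. inv (f u))"
  using isCont_tendsto_compose[OF smooth_map_isCont[OF cover cover smooth_inverse] assms[unfolded continuous_within]]
  by (simp add: continuous_within)

lemma mult_in_charts:
  assumes "c \<in> atlas G" "d \<in> atlas G" "e \<in> atlas G"
  defines "W \<equiv> {z \<in> snd c ` fst c \<times> snd d ` fst d. chart_inv c (fst z) \<otimes> chart_inv d (snd z) \<in> fst e}"
  shows "open W" "smooth_on W (\<lambda>z. snd e (chart_inv c (fst z) \<otimes> chart_inv d (snd z)))"
proof -
  interpret c: chart c using assms by (simp add: atlas_chart)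
  interpret d: chart d using assms by (simp add: atlas_chart)
  define p where "p = (fst c \<times> fst d, map_prod (snd c) (snd d))"
  have p: "p \<in> prod_atlas (atlas G) (atlas G)" unfolding p_def prod_atlas_def using assms(1,2) by blast
  note m = smooth_mapD[OF smooth_mult p assms(3)]
  have inv: "chart_inv p z = (chart_inv c (fst z), chart_inv d (snd z))" if "z \<in> snd c ` fst c \<times> snd d ` fst d" for z
    using chart_prod(2)[OF c.chart_axioms d.chart_axioms, of "fst z" "snd z"] that
    by (auto simp: p_def)
  have W: "snd p ` (fst p \<inter> (\<lambda>(g, h). g \<otimes> h) -` fst e) = W"
  proof (intro equalityI subsetI)
    fix z assume "z \<in> snd p ` (fst p \<inter> (\<lambda>(g, h). g \<otimes> h) -` fst e)"
    then show "z \<in> W" by (auto simp: p_def W_def)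
  next
    fix z assume "z \<in> W"
    then have "z = snd p (chart_inv c (fst z), chart_inv d (snd z))"
      and "(chart_inv c (fst z), chart_inv d (snd z)) \<in> fst p \<inter> (\<lambda>(g, h). g \<otimes> h) -` fst e"
      by (auto simp: W_def p_def)
    then show "z \<in> snd p ` (fst p \<inter> (\<lambda>(g, h). g \<otimes> h) -` fst e)" by (rule image_eqI)
  qed
  show "open W" using m(1) by (simp add: W)
  show "smooth_on W (\<lambda>z. snd e (chart_inv c (fst z) \<otimes> chart_inv d (snd z)))"
  proof (rule smooth_on_transform[OF \<open>open W\<close> _ m(2)[unfolded W]])
    show "snd e (case chart_inv p z of (g, h) \<Rightarrow> g \<otimes> h) = snd e (chart_inv c (fst z) \<otimes> chart_inv d (snd z))"
      if "z \<in> W" for z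
    proof -
      have "z \<in> snd c ` fst c \<times> snd d ` fst d" using that by (simp add: W_def)
      then show ?thesis by (simp add: inv)
    qed
  qed
qed

lemma smooth_on_affine: "open S \<Longrightarrow> bounded_linear L \<Longrightarrow> smooth_on S (\<lambda>q. a + L q)"
  unfolding smooth_on_def by (intro allI Ck_on_add Ck_on_const Ck_on_bounded_linear)

lemma smooth_map_left: "smooth_map (atlas G) (atlas G) (\<lambda>h. g \<otimes> h)"
  unfolding smooth_map_def
proof (intro ballI conjI)
  fix d e assume d: "d \<in> atlas G" and e: "e \<in> atlas G"
  interpret d: chart d using d by (rule atlas_chart)
  interpret e: chart e using e by (rule atlas_chart)
  define c where "c = chart_at (atlas G) g"
  have c: "c \<in> atlas G" "g \<in> fst c" by (simp_all add: c_def chart_at[OF cover])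
  interpret c: chart c using c(1) by (rule atlas_chart)
  let ?S = "snd d ` (fst d \<inter> (\<lambda>h. g \<otimes> h) -` fst e)"
  have "isCont (\<lambda>h. g \<otimes> h) h" for h
    by (intro continuous_mult continuous_const continuous_ident)
  then have "open ((\<lambda>h. g \<otimes> h) -` fst e)"
    using e.open_domain continuous_on_eq_continuous_at[OF open_UNIV] continuous_open_vimage by blast
  then show oS: "open ?S" by (rule d.open_image_Int)
  \<comment> \<open>Left translation is multiplication restricted to an affine slice; writing
    \<open>(snd c g, q)\<close> as a constant plus a linear map of q lets
    \<open>smooth_on_compose\<close> apply.\<close>
  have "smooth_on ?S (\<lambda>q. snd e (chart_inv c (fst ((snd c g, 0) + (0, q))) \<otimes> chart_inv d (snd ((snd c g, 0) + (0, q)))))"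
  proof -
    obtain n b \<beta> where F: "frame n (b :: nat \<Rightarrow> 'e \<times> 'e) \<beta>" using frame_pair_ex by blast
    show ?thesis
      by (rule smooth_on_compose[OF F oS mult_in_charts(1)[OF c(1) d e] _ smooth_on_affine[OF oS] mult_in_charts(2)[OF c(1) d e]])
        (use c in \<open>auto intro!: bounded_linear_Pair bounded_linear_zero bounded_linear_ident\<close>)
  qed
  then show "smooth_on ?S (snd e \<circ> (\<lambda>h. g \<otimes> h) \<circ> chart_inv d)"
    using c by (simp add: o_def)
qed

lemma smooth_map_right: "smooth_map (atlas G) (atlas G) (\<lambda>h. h \<otimes> g)"
  unfolding smooth_map_def
proof (intro ballI conjI)
  fix d e assume d: "d \<in> atlas G" and e: "e \<in> atlas G"
  interpret d: chart d using d by (rule atlas_chart)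
  interpret e: chart e using e by (rule atlas_chart)
  define c where "c = chart_at (atlas G) g"
  have c: "c \<in> atlas G" "g \<in> fst c" by (simp_all add: c_def chart_at[OF cover])
  interpret c: chart c using c(1) by (rule atlas_chart)
  let ?S = "snd d ` (fst d \<inter> (\<lambda>h. h \<otimes> g) -` fst e)"
  have "isCont (\<lambda>h. h \<otimes> g) h" for h
    by (intro continuous_mult continuous_const continuous_ident)
  then have "open ((\<lambda>h. h \<otimes> g) -` fst e)"
    using e.open_domain continuous_on_eq_continuous_at[OF open_UNIV] continuous_open_vimage by blast
  then show oS: "open ?S" by (rule d.open_image_Int)
  have "smooth_on ?S (\<lambda>q. snd e (chart_inv d (fst ((0, snd c g) + (q, 0))) \<otimes> chart_inv c (snd ((0, snd c g) + (q, 0)))))"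
  proof -
    obtain n b \<beta> where F: "frame n (b :: nat \<Rightarrow> 'e \<times> 'e) \<beta>" using frame_pair_ex by blast
    show ?thesis
      by (rule smooth_on_compose[OF F oS mult_in_charts(1)[OF d c(1) e] _ smooth_on_affine[OF oS] mult_in_charts(2)[OF d c(1) e]])
        (use c in \<open>auto intro!: bounded_linear_Pair bounded_linear_zero bounded_linear_ident\<close>)
  qed
  then show "smooth_on ?S (snd e \<circ> (\<lambda>h. h \<otimes> g) \<circ> chart_inv d)"
    using c by (simp add: o_def)
qed

text \<open>\<open>inv_field c q \<zeta>\<close> is the value at the point with coordinates \<open>q\<close> of the left-invariant
  field with value \<open>\<zeta>\<close> at the unit, in the chart \<open>c\<close>.\<close>

definition inv_field :: "('g, 'e) chart \<Rightarrow> 'e \<Rightarrow> 'e \<Rightarrow>\<^sub>L 'e" where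
  "inv_field c q = Blinfun (frechet_derivative (\<lambda>y. snd c (chart_inv c q \<otimes> chart_inv unit_chart y)) (at unit_coord))"

lemma inv_field_has_derivative:
  assumes "c \<in> atlas G" "x \<in> fst c"
  shows "((\<lambda>y. snd c (x \<otimes> chart_inv unit_chart y)) has_derivative inv_field c (snd c x)) (at unit_coord)"
proof -
  interpret chart c using assms by (simp add: atlas_chart)
  show ?thesis
    using has_derivative_Blinfun_frechet[OF smooth_map_rep_differentiable[OF smooth_map_left[of x] unit_chart(1) assms(1) unit_chart(2)]] assms
    by (simp add: inv_field_def unit_coord_def)
qed

text \<open>In \<open>inv_field\<close> the derivative is always taken at the unit while the
  function varies with q. As a partial derivative of multiplication it becomes a derivative in the
  fixed direction (0, \<zeta>) at a moving point, whose smoothness in q is known.\<close>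

lemma inv_field_apply:
  assumes c: "c \<in> atlas G" and q: "q \<in> snd c ` fst c"
  shows "inv_field c q \<zeta> =
    frechet_derivative (\<lambda>z. snd c (chart_inv c (fst z) \<otimes> chart_inv unit_chart (snd z))) (at (q, unit_coord)) (0, \<zeta>)"
proof -
  interpret chart c using c by (rule atlas_chart)
  note m = mult_in_charts[OF c unit_chart(1) c]
  have "((\<lambda>z. snd c (chart_inv c (fst z) \<otimes> chart_inv unit_chart (snd z))) has_derivative
    frechet_derivative (\<lambda>z. snd c (chart_inv c (fst z) \<otimes> chart_inv unit_chart (snd z))) (at (q, unit_coord))) (at (q, unit_coord))"
    using q chart_inv_in by (intro smooth_on_has_derivative[OF m(2)]) auto
  from has_derivative_compose[OF has_derivative_Pair[OF has_derivative_const has_derivative_ident] this]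
  have "((\<lambda>y. snd c (chart_inv c q \<otimes> chart_inv unit_chart y)) has_derivative
    (\<lambda>\<zeta>. frechet_derivative (\<lambda>z. snd c (chart_inv c (fst z) \<otimes> chart_inv unit_chart (snd z))) (at (q, unit_coord)) (0, \<zeta>)))
    (at unit_coord)" by simp
  moreover have "((\<lambda>y. snd c (chart_inv c q \<otimes> chart_inv unit_chart y)) has_derivative inv_field c q) (at unit_coord)"
    using inv_field_has_derivative[OF c chart_inv_in[OF q]] q by simp
  ultimately show ?thesis by (rule has_derivative_unique[THEN fun_cong, symmetric])
qed

lemma inv_field_smooth:
  assumes c: "c \<in> atlas G"
  shows "smooth_on (snd c ` fst c) (\<lambda>q. inv_field c q \<zeta>)"
proof -
  interpret chart c using c by (rule atlas_chart)
  note m = mult_in_charts[OF c unit_chart(1) c]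
  obtain n b \<beta> where F: "frame n (b :: nat \<Rightarrow> 'e \<times> 'e) \<beta>" using frame_pair_ex by blast
  have "smooth_on (snd c ` fst c) (\<lambda>q. frechet_derivative (\<lambda>z. snd c (chart_inv c (fst z) \<otimes> chart_inv unit_chart (snd z)))
      (at ((0, unit_coord) + (q, 0))) (0, \<zeta>))"
    by (rule smooth_on_compose[OF F open_image m(1) _ smooth_on_affine[OF open_image] smooth_on_frechet[OF m(2)]])
      (auto intro!: bounded_linear_Pair bounded_linear_zero bounded_linear_ident)
  then show ?thesis
    by (rule smooth_on_transform[OF open_image, rotated]) (simp add: inv_field_apply[OF c])
qed

definition "d_inv_field c \<zeta> q = frechet_derivative (\<lambda>q. inv_field c q \<zeta>) (at q)"

lemma d_inv_field:
  assumes "c \<in> atlas G" "q \<in> snd c ` fst c"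
  shows "((\<lambda>q. inv_field c q \<zeta>) has_derivative d_inv_field c \<zeta> q) (at q)"
  unfolding d_inv_field_def using smooth_on_has_derivative[OF inv_field_smooth[OF assms(1)] assms(2)] .

lemma d_inv_field_frame:
  assumes F: "frame n (b :: nat \<Rightarrow> 'e) \<beta>" and c: "c \<in> atlas G" "q \<in> snd c ` fst c"
  shows "d_inv_field c \<zeta> q v = (\<Sum>i<n. \<beta> i \<zeta> *\<^sub>R d_inv_field c (b i) q v)"
proof -
  have "((\<lambda>q. \<Sum>i<n. \<beta> i \<zeta> *\<^sub>R inv_field c q (b i)) has_derivative
    (\<lambda>v. \<Sum>i<n. \<beta> i \<zeta> *\<^sub>R d_inv_field c (b i) q v)) (at q)"
    by (intro has_derivative_sum has_derivative_scaleR_right d_inv_field c)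
  moreover have "(\<lambda>q. inv_field c q \<zeta>) =
      (\<lambda>q. \<Sum>i<n. \<beta> i \<zeta> *\<^sub>R inv_field c q (b i))"
    by (intro ext linear_frame_eq[OF F] bounded_linear.linear blinfun.bounded_linear_right)
  ultimately have "((\<lambda>q. inv_field c q \<zeta>) has_derivative
    (\<lambda>v. \<Sum>i<n. \<beta> i \<zeta> *\<^sub>R d_inv_field c (b i) q v)) (at q)"
    by simp
  from has_derivative_unique[OF d_inv_field[OF c] this] show ?thesis by (rule fun_cong)
qed

lemma inv_field_unit: "inv_field unit_chart unit_coord = id_blinfun"
proof -
  have "((\<lambda>y. snd unit_chart (\<one> \<otimes> chart_inv unit_chart y)) has_derivative id_blinfun) (at unit_coord)"
    by (rule has_derivative_transform_within_open[where f = "\<lambda>q. q" and s = "snd unit_chart ` fst unit_chart"])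
      (use unit.open_image in \<open>auto simp: id_def\<close>)
  from Blinfun_frechet_eq[OF this] show ?thesis by (simp add: inv_field_def)
qed

text \<open>\<open>d_left\<close> is expressed in the charts chosen at each point, and these may
  jump from point to point; this passes to a single chart c, in which one can differentiate.\<close>

lemma inv_field_d_left:
  assumes c: "c \<in> atlas G" "x \<in> fst c"
  shows "coord_change (chart_at (atlas G) x) c x o\<^sub>L d_left G x \<one> = inv_field c (snd c x)"
proof -
  define d where "d = chart_at (atlas G) x"
  have d: "d \<in> atlas G" "x \<in> fst d" by (simp_all add: d_def chart_at[OF cover])
  interpret d: chart d using d(1) by (rule atlas_chart)
  have "((\<lambda>y. snd c (x \<otimes> chart_inv unit_chart y)) has_derivative
    (\<lambda>v. coord_change d c x ((d_left G x \<one>) v))) (at unit_coord)"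
  proof (rule d.chain[where F = "\<lambda>u. x \<otimes> chart_inv unit_chart u" and K = "snd c"
      and D = "blinfun_apply (d_left G x \<one>)" and E = "blinfun_apply (coord_change d c x)"])
    show "isCont (\<lambda>u. x \<otimes> chart_inv unit_chart u) unit_coord"
      by (intro continuous_mult continuous_const unit.isCont_inv) simp
    show "((\<lambda>u. snd d (x \<otimes> chart_inv unit_chart u)) has_derivative (d_left G x \<one>)) (at unit_coord)"
      using tangent_map_has_derivative[OF cover cover smooth_map_left[of x], of \<one>]
      by (simp add: d_left_def d_def unit_chart_def unit_coord_def)
  qed (use d coord_change_has_derivative[OF smooth_atlas d(1) c(1) d(2) c(2)] in auto)
  from has_derivative_unique[OF this inv_field_has_derivative[OF c]]
  show ?thesis by (intro blinfun_eqI) (simp add: d_def fun_eq_iff)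
qed

lemma d_left_inverse:
  "d_left G x \<one> o\<^sub>L d_left G (inv x) x = id_blinfun"
  "d_left G (inv x) x o\<^sub>L d_left G x \<one> = id_blinfun"
  using tangent_map_compose[OF cover cover cover smooth_map_left[of "inv x"] smooth_map_left[of x], of x]
    tangent_map_compose[OF cover cover cover smooth_map_left[of x] smooth_map_left[of "inv x"], of \<one>]
    tangent_map_id[OF cover]
  by (simp_all add: d_left_def m_assoc[symmetric])

section \<open>The Lie bracket in charts\<close>

lemma lie_bracket_eq:
  "lie_bracket G \<xi> \<zeta> = d_inv_field unit_chart \<zeta> unit_coord \<xi> - d_inv_field unit_chart \<xi> unit_coord \<zeta>"
proof -
  have field: "field_in_chart (atlas G) unit_chart (left_invariant_field G \<zeta>) q = inv_field unit_chart q \<zeta>"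
    if "q \<in> snd unit_chart ` fst unit_chart" for q \<zeta>
    using inv_field_d_left[OF unit_chart(1) unit.chart_inv_in[OF that], symmetric] that
    by (simp add: field_in_chart_def left_invariant_field_def Let_def)
  have "(field_in_chart (atlas G) unit_chart (left_invariant_field G \<zeta>) has_derivative d_inv_field unit_chart \<zeta> unit_coord) (at unit_coord)" for \<zeta>
    by (rule has_derivative_transform_within_open[OF d_inv_field unit.open_image]) (auto simp: field)
  from frechet_derivative_at[OF this, symmetric] show ?thesis
    unfolding lie_bracket_def field_bracket_def Let_def unit_chart_def[symmetric] unit_coord_def[symmetric]
    by (simp add: field inv_field_unit)
qed

text \<open>\<open>ad\<close> applies \<open>Blinfun\<close>, which is meaningful only on bounded
  linear maps. One term of the bracket is a derivative in the direction \<zeta>; the other is linear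
  in \<zeta> by expansion of the field in a frame.\<close>

lemma ad_apply: "ad G \<xi> \<zeta> = lie_bracket G \<xi> \<zeta>"
proof -
  obtain n b \<beta> where F: "frame n (b :: nat \<Rightarrow> 'e) \<beta>" using frame_ex by blast
  have "lie_bracket G \<xi> = (\<lambda>\<zeta>. (\<Sum>i<n. \<beta> i \<zeta> *\<^sub>R d_inv_field unit_chart (b i) unit_coord \<xi>)
      - d_inv_field unit_chart \<xi> unit_coord \<zeta>)"
    by (rule ext, subst lie_bracket_eq, subst d_inv_field_frame[OF F unit_chart(1) unit_coord(1)]) (rule refl)
  moreover have "bounded_linear \<dots>"
    by (intro bounded_linear_sub bounded_linear_sum bounded_linear_scaleR_const blinfun.bounded_linear_right
        has_derivative_bounded_linear[OF d_inv_field] unit_chart unit_coord)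
  ultimately have "bounded_linear (lie_bracket G \<xi>)" by simp
  then show ?thesis by (simp add: ad_def bounded_linear_Blinfun_apply)
qed

text \<open>Differentiate x (h z) = (x h) z in z at the unit: left translation by x carries a
  left-invariant field to itself.\<close>

lemma inv_field_equivariant:
  assumes c: "c \<in> atlas G" and y: "y \<in> snd unit_chart ` fst unit_chart" "x \<otimes> chart_inv unit_chart y \<in> fst c"
  shows "(inv_field c (snd c (x \<otimes> chart_inv unit_chart y))) \<zeta> =
    frechet_derivative (\<lambda>y. snd c (x \<otimes> chart_inv unit_chart y)) (at y) (inv_field unit_chart y \<zeta>)"
proof -
  let ?\<Psi> = "\<lambda>y. snd c (x \<otimes> chart_inv unit_chart y)"
  interpret c: chart c using c by (rule atlas_chart)
  have "((\<lambda>z. snd c (x \<otimes> (chart_inv unit_chart y \<otimes> chart_inv unit_chart z))) has_derivative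
    (\<lambda>\<zeta>. frechet_derivative ?\<Psi> (at y) (inv_field unit_chart y \<zeta>))) (at unit_coord)"
  proof (rule unit.chain[where F = "\<lambda>u. chart_inv unit_chart y \<otimes> chart_inv unit_chart u" and K = "\<lambda>h. snd c (x \<otimes> h)"
      and D = "blinfun_apply (inv_field unit_chart y)" and E = "frechet_derivative ?\<Psi> (at y)"])
    show "isCont (\<lambda>u. chart_inv unit_chart y \<otimes> chart_inv unit_chart u) unit_coord"
      by (intro continuous_mult continuous_const unit.isCont_inv) simp
    show "((\<lambda>u. snd unit_chart (chart_inv unit_chart y \<otimes> chart_inv unit_chart u)) has_derivative
        inv_field unit_chart y) (at unit_coord)"
      using inv_field_has_derivative[OF unit_chart(1) unit.chart_inv_in[OF y(1)]] y(1) by simp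
    have "?\<Psi> differentiable at (snd unit_chart (chart_inv unit_chart y))"
      by (rule smooth_map_rep_differentiable[OF smooth_map_left unit_chart(1) c unit.chart_inv_in[OF y(1)] y(2)])
    then show "((\<lambda>q. snd c (x \<otimes> chart_inv unit_chart q)) has_derivative frechet_derivative ?\<Psi> (at y))
      (at (snd unit_chart (chart_inv unit_chart y \<otimes> chart_inv unit_chart unit_coord)))"
      using y(1) by (simp add: frechet_derivative_works)
  qed (use unit.chart_inv_in[OF y(1)] in auto)
  moreover have "((\<lambda>z. snd c (x \<otimes> (chart_inv unit_chart y \<otimes> chart_inv unit_chart z))) has_derivative
     (inv_field c (?\<Psi> y))) (at unit_coord)"
    using inv_field_has_derivative[OF c y(2)] by (simp add: m_assoc)
  ultimately show ?thesis by (rule has_derivative_unique[THEN fun_cong, symmetric])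
qed

text \<open>The second derivative of the left translation by \<open>x\<close> in charts is symmetric, so it cancels
  in the commutator.\<close>

lemma inv_field_bracket:
  assumes c: "c \<in> atlas G" "x \<in> fst c"
  shows "d_inv_field c \<zeta> (snd c x) (inv_field c (snd c x) \<xi>)
    - d_inv_field c \<xi> (snd c x) (inv_field c (snd c x) \<zeta>)
    = inv_field c (snd c x) (lie_bracket G \<xi> \<zeta>)"
proof -
  obtain n b \<beta> where F: "frame n (b :: nat \<Rightarrow> 'e) \<beta>" using frame_ex by blast
  interpret c: chart c using c(1) by (rule atlas_chart)
  define \<Psi> where "\<Psi> y = snd c (x \<otimes> chart_inv unit_chart y)" for y
  define W where "W = snd unit_chart ` (fst unit_chart \<inter> (\<lambda>h. x \<otimes> h) -` fst c)"
  have W: "open W" "smooth_on W \<Psi>"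
    using smooth_mapD[OF smooth_map_left[of x] unit_chart(1) c(1)] by (simp_all add: W_def \<Psi>_def[abs_def])
  have oW: "unit_coord \<in> W" using c by (auto simp: W_def unit_coord_def)
  have q: "snd c x \<in> snd c ` fst c" using c by simp
  have \<Psi>o: "\<Psi> unit_coord = snd c x" using c by (simp add: \<Psi>_def)
  have d\<Psi>: "(\<Psi> has_derivative frechet_derivative \<Psi> (at y)) (at y)" if "y \<in> W" for y
    by (rule smooth_on_has_derivative[OF W(2) that])
  have dd\<Psi>: "((\<lambda>y. frechet_derivative \<Psi> (at y) w) has_derivative
      frechet_derivative (\<lambda>y. frechet_derivative \<Psi> (at y) w) (at unit_coord)) (at unit_coord)" for w
    by (rule smooth_on_has_derivative[OF smooth_on_frechet[OF W(2)] oW])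
  have d\<Psi>o: "frechet_derivative \<Psi> (at unit_coord) = inv_field c (snd c x)"
    using has_derivative_unique[OF d\<Psi>[OF oW]] inv_field_has_derivative[OF c] by (simp add: \<Psi>_def[abs_def])
  \<comment> \<open>The second derivative of \<Psi> at the unit in the directions w and v, assembled
    from frame directions to match the product rule below.\<close>
  define K where "K w v = (\<Sum>i<n. \<beta> i w *\<^sub>R
      frechet_derivative (\<lambda>y. frechet_derivative \<Psi> (at y) (b i)) (at unit_coord) v)" for w v
  have expand: "frechet_derivative \<Psi> (at y) w = (\<Sum>i<n. \<beta> i w *\<^sub>R frechet_derivative \<Psi> (at y) (b i))"
    if "y \<in> W" for y w
    by (rule linear_frame_eq[OF F has_derivative_linear[OF d\<Psi>[OF that]]])
  have K: "((\<lambda>y. frechet_derivative \<Psi> (at y) w) has_derivative K w) (at unit_coord)" for w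
  proof (rule has_derivative_transform_within_open[OF _ W(1) oW])
    show "((\<lambda>y. \<Sum>i<n. \<beta> i w *\<^sub>R frechet_derivative \<Psi> (at y) (b i)) has_derivative K w) (at unit_coord)"
      unfolding K_def by (intro has_derivative_sum has_derivative_scaleR_right dd\<Psi>)
  qed (simp add: expand[symmetric])
  have sym: "K w v = K v w" for v w
    by (rule symmetric_second_derivative[OF W(1) oW _ K K]) (use d\<Psi> in \<open>auto simp: differentiable_def\<close>)
  \<comment> \<open>Differentiate the equivariance of left-invariant fields at the unit: by the
    chain rule on one side and by the product rule on the other, where the symmetric term K
    appears.\<close>
  have key: "d_inv_field c \<zeta> (snd c x) (inv_field c (snd c x) v) =
      K \<zeta> v + inv_field c (snd c x) (d_inv_field unit_chart \<zeta> unit_coord v)" for \<zeta> v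
  proof -
    have d1: "((\<lambda>y. (inv_field c (\<Psi> y)) \<zeta>) has_derivative
        (\<lambda>v. d_inv_field c \<zeta> (snd c x) (inv_field c (snd c x) v))) (at unit_coord)"
      using has_derivative_compose[OF d\<Psi>[OF oW] d_inv_field[OF c(1), of "\<Psi> unit_coord" \<zeta>]] c
      by (simp add: \<Psi>o d\<Psi>o)
    have d2: "((\<lambda>y. (inv_field c (\<Psi> y)) \<zeta>) has_derivative
        (\<lambda>v. \<Sum>i<n. \<beta> i (inv_field unit_chart unit_coord \<zeta>) *\<^sub>R
            frechet_derivative (\<lambda>y. frechet_derivative \<Psi> (at y) (b i)) (at unit_coord) v
          + \<beta> i (d_inv_field unit_chart \<zeta> unit_coord v) *\<^sub>R frechet_derivative \<Psi> (at unit_coord) (b i))) (at unit_coord)"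
    proof (rule has_derivative_transform_within_open[OF _ W(1) oW])
      show "((\<lambda>y. \<Sum>i<n. \<beta> i (inv_field unit_chart y \<zeta>) *\<^sub>R frechet_derivative \<Psi> (at y) (b i)) has_derivative
        (\<lambda>v. \<Sum>i<n. \<beta> i (inv_field unit_chart unit_coord \<zeta>) *\<^sub>R
            frechet_derivative (\<lambda>y. frechet_derivative \<Psi> (at y) (b i)) (at unit_coord) v
          + \<beta> i (d_inv_field unit_chart \<zeta> unit_coord v) *\<^sub>R frechet_derivative \<Psi> (at unit_coord) (b i))) (at unit_coord)"
        by (intro has_derivative_sum has_derivative_scaleR dd\<Psi>
            bounded_linear.has_derivative[OF blinfun.bounded_linear_right] d_inv_field) simp_all
      fix y assume y: "y \<in> W"
      then have "(inv_field c (\<Psi> y)) \<zeta> = frechet_derivative \<Psi> (at y) (inv_field unit_chart y \<zeta>)"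
        using inv_field_equivariant[OF c(1), of y x \<zeta>] by (auto simp: \<Psi>_def[abs_def] W_def)
      then show "(\<Sum>i<n. \<beta> i (inv_field unit_chart y \<zeta>) *\<^sub>R frechet_derivative \<Psi> (at y) (b i))
          = (inv_field c (\<Psi> y)) \<zeta>"
        using expand[OF y, symmetric] by simp
    qed
    have "d_inv_field c \<zeta> (snd c x) (inv_field c (snd c x) v) =
      (\<Sum>i<n. \<beta> i \<zeta> *\<^sub>R frechet_derivative (\<lambda>y. frechet_derivative \<Psi> (at y) (b i)) (at unit_coord) v
          + \<beta> i (d_inv_field unit_chart \<zeta> unit_coord v) *\<^sub>R frechet_derivative \<Psi> (at unit_coord) (b i))"
      using fun_cong[OF has_derivative_unique[OF d1 d2], of v] by (simp add: inv_field_unit)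
    then show ?thesis
      by (simp add: sum.distrib K_def d\<Psi>o[symmetric] expand[OF oW, symmetric])
  qed
  show ?thesis
    unfolding key lie_bracket_eq blinfun.diff_right using sym[of \<zeta> \<xi>] by simp
qed

end


section \<open>Velocities of curves in the group\<close>

lemma (in chart) chain_vector:
  assumes "continuous (at t within I) F" "F t \<in> fst c" "t \<in> I"
    and 1: "((\<lambda>u. snd c (F u)) has_vector_derivative v) (at t within I)"
    and 2: "((\<lambda>q. K (chart_inv c q)) has_derivative D) (at (snd c (F t)))"
  shows "((\<lambda>u. K (F u)) has_vector_derivative D v) (at t within I)"
  using chain[OF assms(1-3) 1[unfolded has_vector_derivative_def] 2] linear_cmul[OF has_derivative_linear[OF 2]]
  by (simp add: has_vector_derivative_def)

context lie_group
begin

text \<open>\<xi> is the element with g' = dL_g \<xi>. Translating back by \<open>inv (g t)\<close>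
  puts the curve at the unit at time t, so the unit chart serves for all t. Continuity is demanded
  separately since the coordinate map is arbitrary outside its domain.\<close>

definition left_velocity :: "real set \<Rightarrow> (real \<Rightarrow> 'g) \<Rightarrow> real \<Rightarrow> 'e \<Rightarrow> bool" where
  "left_velocity I g t \<xi> \<longleftrightarrow> continuous (at t within I) g \<and>
     ((\<lambda>u. snd unit_chart (inv (g t) \<otimes> g u)) has_vector_derivative \<xi>) (at t within I)"

definition right_velocity :: "real set \<Rightarrow> (real \<Rightarrow> 'g) \<Rightarrow> real \<Rightarrow> 'e \<Rightarrow> bool" where
  "right_velocity I g t \<xi> \<longleftrightarrow> continuous (at t within I) g \<and>
     ((\<lambda>u. snd unit_chart (g u \<otimes> inv (g t))) has_vector_derivative \<xi>) (at t within I)"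

text \<open>With one factor held at the unit, multiplication is the identity in the other; linearity
  of the derivative adds the two partial maps.\<close>

lemma mult_has_derivative_unit:
  "((\<lambda>z. snd unit_chart (chart_inv unit_chart (fst z) \<otimes> chart_inv unit_chart (snd z))) has_derivative
     (\<lambda>v. fst v + snd v)) (at (unit_coord, unit_coord))"
proof -
  let ?m = "\<lambda>z. snd unit_chart (chart_inv unit_chart (fst z) \<otimes> chart_inv unit_chart (snd z))"
  let ?D = "frechet_derivative ?m (at (unit_coord, unit_coord))"
  have D: "(?m has_derivative ?D) (at (unit_coord, unit_coord))"
    by (rule smooth_on_has_derivative[OF mult_in_charts(2)[OF unit_chart(1) unit_chart(1) unit_chart(1)]]) auto
  have 2: "?D (0, w) = w" for w
    using inv_field_apply[OF unit_chart(1) unit_coord(1), of w] by (simp add: inv_field_unit)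
  have "((\<lambda>x. ?m (x, unit_coord)) has_derivative (\<lambda>v. ?D (v, 0))) (at unit_coord)"
    by (rule has_derivative_compose[OF has_derivative_Pair[OF has_derivative_ident has_derivative_const] D])
  moreover have "((\<lambda>x. ?m (x, unit_coord)) has_derivative (\<lambda>v. v)) (at unit_coord)"
    by (rule has_derivative_transform_within_open[where f = "\<lambda>q. q" and s = "snd unit_chart ` fst unit_chart"])
      (use unit.open_image in auto)
  ultimately have 1: "?D (v, 0) = v" for v
    by (rule has_derivative_unique[THEN fun_cong])
  have "?D v = fst v + snd v" for v
    using linear_add[OF has_derivative_linear[OF D], of "(fst v, 0)" "(0, snd v)"] 1[of "fst v"] 2[of "snd v"] by simp
  then have "?D = (\<lambda>v. fst v + snd v)" by (rule ext)
  then show ?thesis using D by simp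
qed

lemma mult_has_vector_derivative_unit:
  assumes a: "continuous (at t within I) a" "a t = \<one>" "((\<lambda>u. snd unit_chart (a u)) has_vector_derivative v) (at t within I)"
    and b: "continuous (at t within I) b" "b t = \<one>" "((\<lambda>u. snd unit_chart (b u)) has_vector_derivative w) (at t within I)"
    and "t \<in> I"
  shows "((\<lambda>u. snd unit_chart (a u \<otimes> b u)) has_vector_derivative v + w) (at t within I)"
  unfolding has_vector_derivative_def
proof (rule has_derivative_transform_eventually)
  let ?m = "\<lambda>z. snd unit_chart (chart_inv unit_chart (fst z) \<otimes> chart_inv unit_chart (snd z))"
  have m: "(?m has_derivative (\<lambda>v. fst v + snd v)) (at (snd unit_chart (a t), snd unit_chart (b t)))"
    using mult_has_derivative_unit by (simp add: a b unit_coord_def)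
  show "((\<lambda>u. ?m (snd unit_chart (a u), snd unit_chart (b u))) has_derivative (\<lambda>x. x *\<^sub>R (v + w))) (at t within I)"
    using has_derivative_compose[OF has_derivative_Pair[OF a(3)[unfolded has_vector_derivative_def] b(3)[unfolded has_vector_derivative_def]] m]
    by (simp add: scaleR_add_right)
  have "\<forall>\<^sub>F u in at t within I. a u \<in> fst unit_chart" "\<forall>\<^sub>F u in at t within I. b u \<in> fst unit_chart"
    by (rule unit.eventually_domain; simp add: a b)+
  then show "\<forall>\<^sub>F u in at t within I. ?m (snd unit_chart (a u), snd unit_chart (b u)) = snd unit_chart (a u \<otimes> b u)"
    by eventually_elim simp
qed (use assms in \<open>simp_all\<close>)

text \<open>Differentiate a(t) a(t)^-1 = 1 along the coordinate line a with velocity v.\<close>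

lemma tangent_map_inverse_unit: "tangent_map (atlas G) (atlas G) (\<lambda>g. inv g) \<one> = - id_blinfun"
proof (rule blinfun_eqI)
  fix v
  let ?i = "tangent_map (atlas G) (atlas G) (\<lambda>g. inv g) \<one>"
  have i: "((\<lambda>q. snd unit_chart (inv (chart_inv unit_chart q))) has_derivative blinfun_apply ?i) (at unit_coord)"
    using tangent_map_has_derivative[OF cover cover smooth_inverse, of \<one>]
    by (simp add: unit_chart_def[symmetric] unit_coord_def)
  define a where "a t = chart_inv unit_chart (unit_coord + t *\<^sub>R v)" for t :: real
  have line: "((\<lambda>t. unit_coord + t *\<^sub>R v) has_vector_derivative v) (at 0)"
    by (auto intro!: derivative_eq_intros simp: has_vector_derivative_def)
  have ac: "isCont a 0"
    unfolding a_def by (rule isCont_o2[OF has_vector_derivative_continuous[OF line]]) (simp add: unit.isCont_inv)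
  have a0: "a 0 = \<one>" by (simp add: a_def)
  have "\<forall>\<^sub>F t in at 0. unit_coord + t *\<^sub>R v \<in> snd unit_chart ` fst unit_chart"
    using has_vector_derivative_continuous[OF line] unit.open_image
    by (auto simp: continuous_within intro!: topological_tendstoD)
  then have "\<forall>\<^sub>F t in at 0. unit_coord + t *\<^sub>R v = snd unit_chart (a t)"
    by eventually_elim (simp add: a_def)
  then have ad: "((\<lambda>t. snd unit_chart (a t)) has_vector_derivative v) (at 0)"
    unfolding has_vector_derivative_def
    by (rule has_derivative_transform_eventually[OF line[unfolded has_vector_derivative_def]])
      (simp_all add: a0 flip: unit_coord_def)
  have bd: "((\<lambda>t. snd unit_chart (inv (a t))) has_vector_derivative blinfun_apply ?i v) (at 0)"
    by (rule unit.chain_vector[where K = "\<lambda>g. snd unit_chart (inv g)", OF ac _ _ ad])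
      (use i in \<open>simp_all add: a0 unit_coord_def\<close>)
  have "((\<lambda>t. snd unit_chart (a t \<otimes> inv (a t))) has_vector_derivative v + blinfun_apply ?i v) (at 0)"
    by (rule mult_has_vector_derivative_unit[OF ac a0 ad _ _ bd]) (use continuous_inverse[OF ac] a0 in auto)
  moreover have "((\<lambda>t. snd unit_chart (a t \<otimes> inv (a t))) has_vector_derivative 0) (at 0)"
    by simp
  ultimately have "v + blinfun_apply ?i v = 0" by (rule vector_derivative_unique_at)
  then show "blinfun_apply ?i v = (- id_blinfun) v"
    by (simp add: blinfun.minus_left eq_neg_iff_add_eq_0 add.commute)
qed

lemma anti_hom_unit_inverse:
  assumes "\<And>g h. U (g \<otimes> h) = U h \<otimes> U g"
  shows "U \<one> = \<one>" "U (inv g) = inv (U g)"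
proof -
  show 1: "U \<one> = \<one>" using assms[of \<one> \<one>] by (metis UNIV_I carrier_UNIV l_cancel_one' l_one)
  show "U (inv g) = inv (U g)"
    using assms[of g "inv g"] 1 by (intro inv_equality[symmetric]) simp_all
qed

lemma hom_unit_inverse:
  assumes "\<And>g h. U (g \<otimes> h) = U g \<otimes> U h"
  shows "U \<one> = \<one>" "U (inv g) = inv (U g)"
proof -
  show 1: "U \<one> = \<one>" using assms[of \<one> \<one>] by (metis UNIV_I carrier_UNIV l_cancel_one' l_one)
  show "U (inv g) = inv (U g)"
    using assms[of "inv g" g] 1 by (intro inv_equality[symmetric]) simp_all
qed

text \<open>Common to homomorphisms and anti-homomorphisms. U applied to
  \<open>inv (g t) \<otimes> g u\<close> splits as U(g(t))^-1 U(g(u)) in one case and with the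
  factors exchanged in the other, which turns a left velocity into a right one.\<close>

lemma velocity_smooth_image:
  assumes U: "smooth_map (atlas G) (atlas G) U" "U \<one> = \<one>" and g: "left_velocity I g t \<xi>" "t \<in> I"
  shows "((\<lambda>u. snd unit_chart (U (inv (g t) \<otimes> g u))) has_vector_derivative
      (tangent_map (atlas G) (atlas G) U \<one>) \<xi>) (at t within I)"
    and "continuous (at t within I) (\<lambda>u. U (g u))"
proof -
  have gc: "continuous (at t within I) g" using g by (simp add: left_velocity_def)
  show "((\<lambda>u. snd unit_chart (U (inv (g t) \<otimes> g u))) has_vector_derivative
      (tangent_map (atlas G) (atlas G) U \<one>) \<xi>) (at t within I)"
  proof (rule unit.chain_vector[where F = "\<lambda>u. inv (g t) \<otimes> g u" and K = "\<lambda>h. snd unit_chart (U h)"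
      and D = "blinfun_apply (tangent_map (atlas G) (atlas G) U \<one>)" and v = \<xi>])
    show "continuous (at t within I) (\<lambda>u. inv (g t) \<otimes> g u)"
      by (intro continuous_mult continuous_const gc)
    show "((\<lambda>q. snd unit_chart (U (chart_inv unit_chart q))) has_derivative
        (tangent_map (atlas G) (atlas G) U \<one>)) (at (snd unit_chart (inv (g t) \<otimes> g t)))"
      using tangent_map_has_derivative[OF cover cover U(1), of \<one>] by (simp add: unit_chart_def U)
  qed (use g in \<open>auto simp: left_velocity_def\<close>)
  show "continuous (at t within I) (\<lambda>u. U (g u))"
    using isCont_tendsto_compose[OF smooth_map_isCont[OF cover cover U(1)] gc[unfolded continuous_within]]
    by (simp add: continuous_within)
qed

lemma left_velocity_hom:
  assumes U: "smooth_map (atlas G) (atlas G) U" "\<And>g h. U (g \<otimes> h) = U g \<otimes> U h"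
    and g: "left_velocity I g t \<xi>" "t \<in> I"
  shows "left_velocity I (\<lambda>u. U (g u)) t ((tangent_map (atlas G) (atlas G) U \<one>) \<xi>)"
  using velocity_smooth_image[OF U(1) hom_unit_inverse(1)[OF U(2)] g]
  by (simp add: left_velocity_def U(2) hom_unit_inverse(2)[OF U(2)])

lemma left_velocity_anti_hom:
  assumes U: "smooth_map (atlas G) (atlas G) U" "\<And>g h. U (g \<otimes> h) = U h \<otimes> U g"
    and g: "left_velocity I g t \<xi>" "t \<in> I"
  shows "right_velocity I (\<lambda>u. U (g u)) t ((tangent_map (atlas G) (atlas G) U \<one>) \<xi>)"
  using velocity_smooth_image[OF U(1) anti_hom_unit_inverse(1)[OF U(2)] g]
  by (simp add: right_velocity_def U(2) anti_hom_unit_inverse(2)[OF U(2)])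

lemma left_velocity_reflect:
  assumes "left_velocity {0..T} g (T - t) \<xi>"
  shows "left_velocity {0..T} (\<lambda>u. g (T - u)) t (- \<xi>)"
proof -
  have im: "(\<lambda>u. T - u) ` {0..T} = {0..T}" by (auto simp: image_iff intro: bexI[of _ "T - _"])
  have "((\<lambda>u. T - u) has_vector_derivative - 1) (at t within {0..T})"
    by (auto intro!: derivative_eq_intros)
  from vector_diff_chain_within[OF this, of "\<lambda>u. snd unit_chart (inv (g (T - t)) \<otimes> g u)" \<xi>]
  have "((\<lambda>u. snd unit_chart (inv (g (T - t)) \<otimes> g (T - u))) has_vector_derivative - \<xi>) (at t within {0..T})"
    using assms by (simp add: im left_velocity_def o_def)
  moreover have "continuous (at t within {0..T}) (\<lambda>u. g (T - u))"
    using assms by (intro continuous_within_compose2[of _ _ "\<lambda>u. T - u" g] continuous_intros) (simp add: im left_velocity_def)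
  ultimately show ?thesis by (simp add: left_velocity_def)
qed

text \<open>The product has zero derivative in every chart, hence is locally constant.\<close>

lemma velocity_product_constant:
  assumes k: "\<And>t. t \<in> {0..T} \<Longrightarrow> left_velocity {0..T} k t (\<eta> t)"
    and r: "\<And>t. t \<in> {0..T} \<Longrightarrow> right_velocity {0..T} r t (- \<eta> t)" and "T \<ge> 0"
  shows "k T \<otimes> r T = k 0 \<otimes> r 0"
proof -
  define m where "m u = k u \<otimes> r u" for u
  have mc: "continuous (at t within {0..T}) m" if "t \<in> {0..T}" for t
    unfolding m_def using k[OF that] r[OF that]
    by (intro continuous_mult) (simp_all add: left_velocity_def right_velocity_def)
  have md: "((\<lambda>u. snd c (m u)) has_vector_derivative 0) (at t within {0..T})"
    if t: "t \<in> {0..T}" and c: "c \<in> atlas G" "m t \<in> fst c" for t c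
  proof -
    interpret c: chart c using c(1) by (rule atlas_chart)
    \<comment> \<open>m u = k t (a u b u) r t, where a and b pass through the unit at u = t with
      velocities \<eta> t and - \<eta> t. Hence a b has velocity 0 there, and the fixed translations
      on both sides preserve this.\<close>
    let ?a = "\<lambda>u. inv (k t) \<otimes> k u" and ?b = "\<lambda>u. r u \<otimes> inv (r t)"
    have ac: "continuous (at t within {0..T}) ?a" and bc: "continuous (at t within {0..T}) ?b"
      using k[OF t] r[OF t]
      by (auto intro!: continuous_mult continuous_const simp: left_velocity_def right_velocity_def)
    have "((\<lambda>u. snd unit_chart (?a u \<otimes> ?b u)) has_vector_derivative \<eta> t + - \<eta> t) (at t within {0..T})"
      by (rule mult_has_vector_derivative_unit[OF ac _ _ bc])
        (use k[OF t] r[OF t] t in \<open>auto simp: left_velocity_def right_velocity_def\<close>)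
    then have ab: "((\<lambda>u. snd unit_chart (?a u \<otimes> ?b u)) has_vector_derivative 0) (at t within {0..T})" by simp
    define d where "d = chart_at (atlas G) (k t)"
    have d: "d \<in> atlas G" "k t \<in> fst d" by (simp_all add: d_def chart_at[OF cover])
    interpret d: chart d using d(1) by (rule atlas_chart)
    have "((\<lambda>y. snd c ((k t \<otimes> chart_inv unit_chart y) \<otimes> r t)) has_derivative
      (\<lambda>v. frechet_derivative (\<lambda>q. snd c (chart_inv d q \<otimes> r t)) (at (snd d (k t)))
        (inv_field d (snd d (k t)) v))) (at unit_coord)"
    proof (rule d.chain[where F = "\<lambda>y. k t \<otimes> chart_inv unit_chart y" and K = "\<lambda>h. snd c (h \<otimes> r t)"
          and D = "blinfun_apply (inv_field d (snd d (k t)))"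
          and E = "frechet_derivative (\<lambda>q. snd c (chart_inv d q \<otimes> r t)) (at (snd d (k t)))"])
      show "isCont (\<lambda>y. k t \<otimes> chart_inv unit_chart y) unit_coord"
        by (intro continuous_mult continuous_const unit.isCont_inv) simp
      show "((\<lambda>q. snd c (chart_inv d q \<otimes> r t)) has_derivative frechet_derivative (\<lambda>q. snd c (chart_inv d q \<otimes> r t)) (at (snd d (k t))))
        (at (snd d (k t \<otimes> chart_inv unit_chart unit_coord)))"
        using smooth_map_rep_differentiable[OF smooth_map_right d(1) c(1) d(2)] c(2)
        by (simp add: m_def frechet_derivative_works)
    qed (use d inv_field_has_derivative[OF d] in auto)
    then obtain E where E: "((\<lambda>y. snd c ((k t \<otimes> chart_inv unit_chart y) \<otimes> r t)) has_derivative E) (at unit_coord)" by blast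
    have "((\<lambda>u. snd c ((k t \<otimes> (?a u \<otimes> ?b u)) \<otimes> r t)) has_vector_derivative E 0) (at t within {0..T})"
    proof (rule unit.chain_vector[where F = "\<lambda>u. ?a u \<otimes> ?b u" and K = "\<lambda>h. snd c ((k t \<otimes> h) \<otimes> r t)", OF _ _ t ab])
      show "continuous (at t within {0..T}) (\<lambda>u. ?a u \<otimes> ?b u)" by (rule continuous_mult[OF ac bc])
    qed (use E in \<open>simp_all add: unit_coord_def\<close>)
    moreover have "(k t \<otimes> (?a u \<otimes> ?b u)) \<otimes> r t = m u" for u
    proof -
      have "k t \<otimes> (?a u \<otimes> ?b u) \<otimes> r t = (k t \<otimes> inv (k t)) \<otimes> (k u \<otimes> r u) \<otimes> (inv (r t) \<otimes> r t)"
        by (simp only: m_assoc carrier_UNIV UNIV_I m_closed inv_closed)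
      then show ?thesis by (simp add: m_def)
    qed
    ultimately show ?thesis using linear_0[OF has_derivative_linear[OF E]] by simp
  qed
  have "m T = m 0"
  \<comment> \<open>A chart covers m only near each time, so constancy is obtained locally and
    spread by connectedness of the interval.\<close>
  proof (rule connected_local_const[of "{0..T}"])
    show "\<forall>t\<in>{0..T}. \<forall>\<^sub>F u in at t within {0..T}. m t = m u"
    proof
      fix t assume t: "t \<in> {0..T}"
      define c where "c = chart_at (atlas G) (m t)"
      have c: "c \<in> atlas G" "m t \<in> fst c" by (simp_all add: c_def chart_at[OF cover])
      interpret c: chart c using c(1) by (rule atlas_chart)
      have ev: "\<forall>\<^sub>F u in at t within {0..T}. m u \<in> fst c" by (rule c.eventually_domain[where F = m, OF mc[OF t] c(2)])
      then obtain d where d: "d > 0" "\<And>u. u \<in> {0..T} \<Longrightarrow> dist u t < d \<Longrightarrow> m u \<in> fst c"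
        unfolding eventually_at using c(2) by (metis (mono_tags))
      let ?J = "{0..T} \<inter> ball t d"
      have J: "m u \<in> fst c" if "u \<in> ?J" for u using d(2) that by (simp add: dist_commute)
      have "\<exists>q. \<forall>u\<in>?J. snd c (m u) = q"
      proof (rule has_derivative_zero_constant)
        show "convex ?J" by (intro convex_Int convex_ball) auto
        show "((\<lambda>u. snd c (m u)) has_derivative (\<lambda>h. 0)) (at u within ?J)" if "u \<in> ?J" for u
          using md[OF _ c(1) J[OF that]] that
          by (auto simp: has_vector_derivative_def intro: has_derivative_subset)
      qed
      then have "m u = m t" if "u \<in> ?J" for u
        using J[OF that] that t d(1) c(2) by (metis IntI c.inv_chart centre_in_ball)
      moreover have "\<forall>\<^sub>F u in at t within {0..T}. u \<in> ?J"
        unfolding eventually_at using d(1) by (intro exI[of _ d]) (auto simp: dist_commute)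
      ultimately show "\<forall>\<^sub>F u in at t within {0..T}. m t = m u"
        by (auto elim!: eventually_mono)
    qed
  qed (use \<open>T \<ge> 0\<close> in auto)
  then show ?thesis by (simp add: m_def)
qed

text \<open>The inverse of l has right velocity - \<eta>, so k l^-1 is constant and equal to the
  unit. Here \<eta> may be any function of time.\<close>

lemma left_velocity_unique:
  assumes k: "\<And>t. t \<in> {0..T} \<Longrightarrow> left_velocity {0..T} k t (\<eta> t)"
    and l: "\<And>t. t \<in> {0..T} \<Longrightarrow> left_velocity {0..T} l t (\<eta> t)" and "T \<ge> 0" "k 0 = l 0"
  shows "k T = l T"
proof -
  have "right_velocity {0..T} (\<lambda>u. inv (l u)) t (- \<eta> t)" if "t \<in> {0..T}" for t
    using left_velocity_anti_hom[OF smooth_inverse _ l[OF that] that]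
    by (simp add: inv_mult_group tangent_map_inverse_unit blinfun.minus_left)
  from velocity_product_constant[OF k this \<open>T \<ge> 0\<close>] have "k T \<otimes> inv (l T) = \<one>"
    using \<open>k 0 = l 0\<close> by simp
  from inv_equality[OF this] show ?thesis by simp
qed

end


section \<open>The Hamiltonian system in the left trivialization\<close>

lemma blinfun_compose_assoc: "(a o\<^sub>L b) o\<^sub>L c = a o\<^sub>L (b o\<^sub>L c)"
  by (rule blinfun_eqI) simp

lemma blinfun_compose_id [simp]: "a o\<^sub>L id_blinfun = a" "id_blinfun o\<^sub>L a = a"
  by (rule blinfun_eqI; simp)+

context lie_group
begin

lemma cotangent_chart_inv:
  assumes c: "c \<in> atlas G" and q: "q \<in> snd c ` fst c"
  shows "chart_inv (cotangent_chart (atlas G) c) (q, a) =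
    (chart_inv c q, a o\<^sub>L coord_change (chart_at (atlas G) (chart_inv c q)) c (chart_inv c q))"
proof -
  interpret chart c using c by (rule atlas_chart)
  let ?C = "cotangent_chart (atlas G) c"
  let ?g = "\<lambda>(q, a). (chart_inv c q, a o\<^sub>L coord_change (chart_at (atlas G) (chart_inv c q)) c (chart_inv c q))"
  have inverse: "coord_change c (chart_at (atlas G) x) x o\<^sub>L coord_change (chart_at (atlas G) x) c x = id_blinfun"
    "coord_change (chart_at (atlas G) x) c x o\<^sub>L coord_change c (chart_at (atlas G) x) x = id_blinfun"
    if "x \<in> fst c" for x
    using that c by (simp_all add: coord_change_inverse[OF smooth_atlas] chart_at[OF cover])
  have "inj_on (snd ?C) (fst ?C)"
    by (rule inj_on_inverseI[of _ ?g]) (auto simp: cotangent_chart_def inverse blinfun_compose_assoc)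
  moreover have "snd ?C (?g (q, a)) = (q, a)" "?g (q, a) \<in> fst ?C"
    using q chart_inv_in[OF q] by (simp_all add: cotangent_chart_def inverse blinfun_compose_assoc)
  ultimately show ?thesis using inv_into_f_eq by fastforce
qed

lemma frame_covector_ex: "\<exists>n b \<beta>. frame n (b :: nat \<Rightarrow> 'e \<times> ('e \<Rightarrow>\<^sub>L real)) \<beta>"
  using frame_ex frame_dual_ex by (intro frame_prod_ex) blast+

text \<open>The map (q, a) to \<open>a o\<^sub>L inv_field c q\<close> is the left-trivialized
  momentum in canonical coordinates. \<open>d_inv_field\<close> differentiates
  \<open>inv_field\<close> at a fixed vector only, so the composition is expanded in the dual frame
  and differentiated coefficientwise.\<close>

lemma has_derivative_pullback:
  fixes a :: "'e \<Rightarrow>\<^sub>L real"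
  assumes F: "frame n (b :: nat \<Rightarrow> 'e) \<beta>" and c: "c \<in> atlas G" "q \<in> snd c ` fst c"
  shows "((\<lambda>z. snd z o\<^sub>L inv_field c (fst z)) has_derivative
    (\<lambda>v. \<Sum>i<n. (a (d_inv_field c (b i) q (fst v)) + blinfun_apply (snd v) (inv_field c q (b i))) *\<^sub>R \<beta> i))
    (at (q, a))"
proof -
  have ff: "((\<lambda>z :: 'e \<times> ('e \<Rightarrow>\<^sub>L real). inv_field c (fst z) (b i)) has_derivative (\<lambda>v. d_inv_field c (b i) q (fst v))) (at (q, a))" for i
    using has_derivative_compose[OF has_derivative_fst[OF has_derivative_ident] d_inv_field[OF c(1)], of "(q, a)"] c(2) by simp
  have eval: "((\<lambda>z. blinfun_apply (snd z) (inv_field c (fst z) (b i))) has_derivative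
    (\<lambda>v. a (d_inv_field c (b i) q (fst v)) + blinfun_apply (snd v) (inv_field c q (b i)))) (at (q, a))" for i
    using bounded_bilinear.FDERIV[OF bounded_bilinear_blinfun_apply has_derivative_snd[OF has_derivative_ident] ff] by simp
  have eq: "(\<lambda>z. \<Sum>i<n. blinfun_apply (snd z o\<^sub>L inv_field c (fst z)) (b i) *\<^sub>R \<beta> i) =
      (\<lambda>z. snd z o\<^sub>L inv_field c (fst z))"
    by (rule ext) (rule blinfun_eq_sum_frame[OF F, symmetric])
  have "((\<lambda>z. \<Sum>i<n. blinfun_apply (snd z o\<^sub>L inv_field c (fst z)) (b i) *\<^sub>R \<beta> i) has_derivative
    (\<lambda>v. \<Sum>i<n. (a (d_inv_field c (b i) q (fst v)) + blinfun_apply (snd v) (inv_field c q (b i))) *\<^sub>R \<beta> i))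
    (at (q, a))"
    unfolding blinfun_apply_blinfun_compose by (intro has_derivative_sum has_derivative_scaleR_left eval)
  then show ?thesis unfolding eq .
qed

end

section \<open>Left-invariant Hamiltonians and the equations of their trajectories\<close>

locale left_invariant_system = lie_group G
  for G :: "('g::{t2_space, second_countable_topology}, 'e::{real_inner, banach}) smooth_group" (structure) +
  fixes H :: "'g \<times> ('e \<Rightarrow>\<^sub>L real) \<Rightarrow> real"
  assumes left_invariant: "left_invariant_hamiltonian G H"
begin

text \<open>A covector \<alpha> at x is the left trivialization of (x, p) with p = \<alpha> o dL_x,
  and p reads \<open>a o\<^sub>L inv_field c q\<close> in canonical coordinates.\<close>

lemma hamiltonian_in_chart:
  assumes c: "c \<in> atlas G" and q: "q \<in> snd c ` fst c"
  shows "H (chart_inv (cotangent_chart (atlas G) c) (q, a)) = H (\<one>, a o\<^sub>L inv_field c q)"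
proof -
  interpret chart c using c by (rule atlas_chart)
  define x where "x = chart_inv c q"
  have x: "x \<in> fst c" "snd c x = q" using q chart_inv_in[OF q] by (simp_all add: x_def)
  define \<alpha> where "\<alpha> = a o\<^sub>L coord_change (chart_at (atlas G) x) c x"
  have "left_trivialization G (x, \<alpha> o\<^sub>L d_left G x \<one>) = (x, \<alpha>)"
    by (simp add: left_trivialization_def blinfun_compose_assoc d_left_inverse)
  then have "H (x, \<alpha>) = H (\<one>, \<alpha> o\<^sub>L d_left G x \<one>)"
    using left_invariant unfolding left_invariant_hamiltonian_def by metis
  also have "\<alpha> o\<^sub>L d_left G x \<one> = a o\<^sub>L inv_field c q"
    using inv_field_d_left[OF c x(1)] by (simp add: \<alpha>_def blinfun_compose_assoc x(2))
  finally show ?thesis by (simp add: cotangent_chart_inv[OF c q] x_def \<alpha>_def)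
qed

text \<open>The fibre over the unit is an affine slice of a canonical chart, and
  \<open>inv_field\<close> is the identity there.\<close>

lemma fiber_hamiltonian_smooth: "smooth_on UNIV (\<lambda>p. H (\<one>, p))"
proof -
  let ?C = "cotangent_chart (atlas G) unit_chart"
  have C: "?C \<in> cotangent_atlas (atlas G)" by (simp add: cotangent_atlas_def)
  have im: "snd ?C ` (fst ?C \<inter> H -` UNIV) = snd unit_chart ` fst unit_chart \<times> UNIV"
  proof (intro equalityI subsetI)
    fix z assume "z \<in> snd ?C ` (fst ?C \<inter> H -` UNIV)"
    then show "z \<in> snd unit_chart ` fst unit_chart \<times> UNIV" by (auto simp: cotangent_chart_def)
  next
    fix z assume z: "z \<in> snd unit_chart ` fst unit_chart \<times> (UNIV :: ('e \<Rightarrow>\<^sub>L real) set)"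
    then obtain x where x: "x \<in> fst unit_chart" "fst z = snd unit_chart x" by auto
    have "z = snd ?C (x, snd z o\<^sub>L coord_change (chart_at (atlas G) x) unit_chart x)"
      using x by (simp add: cotangent_chart_def blinfun_compose_assoc coord_change_inverse[OF smooth_atlas] chart_at[OF cover] prod_eq_iff)
    then show "z \<in> snd ?C ` (fst ?C \<inter> H -` UNIV)"
      by (rule image_eqI) (use x in \<open>simp add: cotangent_chart_def\<close>)
  qed
  have "smooth_map (cotangent_atlas (atlas G)) vector_space_atlas H"
    using left_invariant by (simp add: left_invariant_hamiltonian_def)
  then have "smooth_on (snd unit_chart ` fst unit_chart \<times> UNIV) (\<lambda>z. H (chart_inv ?C z))"
    using C im by (auto simp: smooth_map_def o_def)
  moreover obtain n b \<beta> where F: "frame n (b :: nat \<Rightarrow> 'e \<times> ('e \<Rightarrow>\<^sub>L real)) \<beta>"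
    using frame_covector_ex by blast
  ultimately have "smooth_on UNIV (\<lambda>p. H (chart_inv ?C ((unit_coord, 0) + (0, p))))"
    by (intro smooth_on_compose[OF F open_UNIV open_Times[OF unit.open_image open_UNIV] _ smooth_on_affine[OF open_UNIV]])
      (auto intro!: bounded_linear_Pair bounded_linear_zero bounded_linear_ident)
  then show ?thesis by (simp add: hamiltonian_in_chart inv_field_unit)
qed

abbreviation "gradient p \<equiv> dual_gradient (\<lambda>q. H (\<one>, q)) p"

text \<open>\<open>dual_gradient\<close> is a definite description. The frame shows that it is
  proper: every linear functional on the dual is an evaluation, and covectors separate
  points.\<close>

lemma fiber_hamiltonian_has_derivative:
  "((\<lambda>q. H (\<one>, q)) has_derivative (\<lambda>q. q (gradient p))) (at p)"
proof -
  obtain n b \<beta> where F: "frame n (b :: nat \<Rightarrow> 'e) \<beta>" using frame_ex by blast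
  let ?D = "frechet_derivative (\<lambda>q. H (\<one>, q)) (at p)"
  have D: "((\<lambda>q. H (\<one>, q)) has_derivative ?D) (at p)"
    using smooth_on_has_derivative[OF fiber_hamiltonian_smooth] by simp
  have "\<forall>q. ?D q = q (gradient p)"
    unfolding dual_gradient_def
  proof (rule theI[of _ "\<Sum>i<n. ?D (\<beta> i) *\<^sub>R b i"])
    show "\<forall>q. ?D q = q (\<Sum>i<n. ?D (\<beta> i) *\<^sub>R b i)"
    proof
      fix q
      have "?D q = ?D (\<Sum>i<n. q (b i) *\<^sub>R \<beta> i)"
        using blinfun_eq_sum_frame[OF F, of q] by simp
      also have "\<dots> = q (\<Sum>i<n. ?D (\<beta> i) *\<^sub>R b i)"
        by (simp add: linear_sum[OF has_derivative_linear[OF D]] linear_cmul[OF has_derivative_linear[OF D]]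
            blinfun.sum_right blinfun.scaleR_right mult.commute)
      finally show "?D q = q (\<Sum>i<n. ?D (\<beta> i) *\<^sub>R b i)" .
    qed
    fix \<xi> assume \<xi>: "\<forall>q. ?D q = q \<xi>"
    show "\<xi> = (\<Sum>i<n. ?D (\<beta> i) *\<^sub>R b i)" using frameD[OF F, of \<xi>] \<xi> by simp
  qed
  then have "?D = (\<lambda>q. q (gradient p))" by (intro ext) simp
  then show ?thesis using D by simp
qed

text \<open>Hamilton's equations for F(q, a) = h(a o \<open>inv_field c q\<close>), h being the
  fibre Hamiltonian: \<partial>F/\<partial>a is the left-invariant field of \<xi>, and
  \<partial>F/\<partial>q is a applied to the q-derivative of that field. The description in
  \<open>hamiltonian_field\<close> is proper because the canonical form is nondegenerate, as testing
  against (0, w) and (v, 0) shows.\<close>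

lemma hamiltonian_field_eq:
  fixes \<alpha> :: "'e \<Rightarrow>\<^sub>L real"
  assumes c: "c \<in> atlas G" "x \<in> fst c"
  defines "\<xi> \<equiv> gradient (\<alpha> o\<^sub>L d_left G x \<one>)" and "a \<equiv> \<alpha> o\<^sub>L coord_change c (chart_at (atlas G) x) x"
  shows "hamiltonian_field H (cotangent_chart (atlas G) c) (x, \<alpha>) =
    (inv_field c (snd c x) \<xi>, - (a o\<^sub>L Blinfun (d_inv_field c \<xi> (snd c x))))"
proof -
  interpret chart c using c(1) by (rule atlas_chart)
  obtain n b \<beta> where F: "frame n (b :: nat \<Rightarrow> 'e) \<beta>" using frame_ex by blast
  let ?C = "cotangent_chart (atlas G) c"
  define q where "q = snd c x"
  have q: "q \<in> snd c ` fst c" using c by (simp add: q_def)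
  have Cz: "snd ?C (x, \<alpha>) = (q, a)" by (simp add: cotangent_chart_def q_def a_def)
  have p: "a o\<^sub>L inv_field c q = \<alpha> o\<^sub>L d_left G x \<one>"
    unfolding a_def q_def inv_field_d_left[OF c, symmetric]
    using coord_change_inverse[OF smooth_atlas _ c(1) chart_at(2)[OF cover] c(2)] chart_at(1)[OF cover]
    by (metis blinfun_compose_assoc blinfun_compose_id(1))
  have d: "bounded_linear (d_inv_field c \<xi> q)"
    by (rule has_derivative_bounded_linear[OF d_inv_field[OF c(1) q]])
  have "((\<lambda>z. H (\<one>, snd z o\<^sub>L inv_field c (fst z))) has_derivative
    (\<lambda>v. (\<Sum>i<n. (a (d_inv_field c (b i) q (fst v)) +
      blinfun_apply (snd v) (inv_field c q (b i))) *\<^sub>R \<beta> i) \<xi>)) (at (q, a))"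
    using has_derivative_compose[OF has_derivative_pullback[OF F c(1) q, of a] fiber_hamiltonian_has_derivative] by (simp add: p \<xi>_def)
  moreover have "(\<Sum>i<n. (a (d_inv_field c (b i) q v) +
      w (inv_field c q (b i))) *\<^sub>R \<beta> i) \<xi> =
      a (d_inv_field c \<xi> q v) + w (inv_field c q \<xi>)" for v and w :: "'e \<Rightarrow>\<^sub>L real"
  proof -
    have "a (d_inv_field c \<xi> q v) = (\<Sum>i<n. \<beta> i \<xi> * a (d_inv_field c (b i) q v))"
      by (subst d_inv_field_frame[OF F c(1) q]) (simp add: blinfun.sum_right blinfun.scaleR_right)
    moreover have "w (inv_field c q \<xi>) =
        (\<Sum>i<n. \<beta> i \<xi> * w (inv_field c q (b i)))"
      using linear_frame_eq[OF F bounded_linear.linear[OF blinfun.bounded_linear_right[of "w o\<^sub>L inv_field c q"]], of \<xi>] by simp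
    ultimately show ?thesis
      by (simp add: blinfun.sum_left blinfun.scaleR_left sum.distrib distrib_left mult.commute)
  qed
  ultimately have "((\<lambda>z. H (\<one>, snd z o\<^sub>L inv_field c (fst z))) has_derivative
    (\<lambda>v. a (d_inv_field c \<xi> q (fst v)) + blinfun_apply (snd v) (inv_field c q \<xi>))) (at (q, a))"
    by simp
  then have "(H \<circ> chart_inv ?C has_derivative
    (\<lambda>v. a (d_inv_field c \<xi> q (fst v)) + blinfun_apply (snd v) (inv_field c q \<xi>))) (at (q, a))"
    by (rule has_derivative_transform_within_open[OF _ open_Times[OF open_image open_UNIV]])
      (use q in \<open>auto simp: hamiltonian_in_chart[OF c(1)]\<close>)
  from frechet_derivative_at[OF this]
  have D: "frechet_derivative (H \<circ> chart_inv ?C) (at (q, a)) v =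
    a (d_inv_field c \<xi> q (fst v)) + blinfun_apply (snd v) (inv_field c q \<xi>)" for v
    by metis
  show ?thesis
    unfolding hamiltonian_field_def Cz q_def[symmetric]
  proof (rule the_equality)
    show "\<forall>Y. canonical_form (inv_field c q \<xi>, - (a o\<^sub>L Blinfun (d_inv_field c \<xi> q))) Y =
      frechet_derivative (H \<circ> chart_inv ?C) (at (q, a)) Y"
      by (simp add: D canonical_form_def blinfun.minus_left bounded_linear_Blinfun_apply[OF d])
  next
    fix X assume X: "\<forall>Y. canonical_form X Y = frechet_derivative (H \<circ> chart_inv ?C) (at (q, a)) Y"
    have X': "w (fst X) - blinfun_apply (snd X) v =
      a (d_inv_field c \<xi> q v) + w (inv_field c q \<xi>)" for v and w :: "'e \<Rightarrow>\<^sub>L real"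
      using X[rule_format, of "(v, w)"] by (simp add: D canonical_form_def)
    have eval: "w (fst X) = w (inv_field c q \<xi>)" for w :: "'e \<Rightarrow>\<^sub>L real"
      using X'[of w 0] by (simp add: linear_0[OF bounded_linear.linear[OF d]])
    have "fst X = inv_field c q \<xi>"
      using frameD[OF F, of "fst X"] frameD[OF F, of "inv_field c q \<xi>"] unfolding eval by simp
    moreover have "snd X = - (a o\<^sub>L Blinfun (d_inv_field c \<xi> q))"
    proof (rule blinfun_eqI)
      fix v
      show "blinfun_apply (snd X) v = (- (a o\<^sub>L Blinfun (d_inv_field c \<xi> q))) v"
        using X'[of 0 v] by (simp add: blinfun.minus_left bounded_linear_Blinfun_apply[OF d])
    qed
    ultimately show "X = (inv_field c q \<xi>, - (a o\<^sub>L Blinfun (d_inv_field c \<xi> q)))"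
      by (simp add: prod_eq_iff)
  qed
qed

definition momentum :: "(real \<Rightarrow> 'g \<times> ('e \<Rightarrow>\<^sub>L real)) \<Rightarrow> real \<Rightarrow> 'e \<Rightarrow>\<^sub>L real" where
  "momentum \<gamma> u = snd (\<gamma> u) o\<^sub>L d_left G (fst (\<gamma> u)) \<one>"

text \<open>In canonical coordinates the momentum p is a o \<open>inv_field c q\<close>. By the
  product rule and Hamilton's equations its derivative at b is a applied to the commutator of the
  left-invariant fields of \<xi> and b, and \<open>inv_field_bracket\<close> turns this into p(ad
  \<xi> b).\<close>

proposition hamiltonian_curve:
  assumes \<gamma>: "integral_curve (cotangent_atlas (atlas G)) (hamiltonian_field H) I \<gamma>" and t: "t \<in> I"
  shows "left_velocity I (\<lambda>u. fst (\<gamma> u)) t (gradient (momentum \<gamma> t))"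
    and "(momentum \<gamma> has_vector_derivative vertical_field G H (momentum \<gamma> t)) (at t within I)"
proof -
  obtain n b \<beta> where F: "frame n (b :: nat \<Rightarrow> 'e) \<beta>" using frame_ex by blast
  define g where "g u = fst (\<gamma> u)" for u
  define c where "c = chart_at (atlas G) (g t)"
  have c: "c \<in> atlas G" "g t \<in> fst c" by (simp_all add: c_def chart_at[OF cover])
  interpret c: chart c using c(1) by (rule atlas_chart)
  let ?C = "cotangent_chart (atlas G) c"
  define q where "q = snd c (g t)"
  have q: "q \<in> snd c ` fst c" using c by (simp add: q_def)
  define \<xi> where "\<xi> = gradient (momentum \<gamma> t)"
  define a where "a u = snd (\<gamma> u) o\<^sub>L coord_change c (chart_at (atlas G) (g u)) (g u)" for u
  have C: "?C \<in> cotangent_atlas (atlas G)" "\<gamma> t \<in> fst ?C"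
    using c by (simp_all add: cotangent_atlas_def cotangent_chart_def g_def mem_Times_iff)
  have C\<gamma>: "snd ?C (\<gamma> u) = (snd c (g u), a u)" for u
    by (simp add: cotangent_chart_def g_def a_def case_prod_beta)
  have "\<forall>\<^sub>F u in at t within I. \<gamma> u \<in> fst ?C"
    using \<gamma> t C unfolding integral_curve_def by blast
  then have ev: "\<forall>\<^sub>F u in at t within I. g u \<in> fst c"
    by (simp add: cotangent_chart_def g_def mem_Times_iff)
  have "hamiltonian_field H ?C (\<gamma> t) = (inv_field c q \<xi>, - (a t o\<^sub>L Blinfun (d_inv_field c \<xi> q)))"
    using hamiltonian_field_eq[OF c, of "snd (\<gamma> t)"] by (simp add: g_def q_def a_def \<xi>_def momentum_def)
  moreover have "((snd ?C \<circ> \<gamma>) has_vector_derivative hamiltonian_field H ?C (\<gamma> t)) (at t within I)"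
    using \<gamma> t C unfolding integral_curve_def by blast
  ultimately have "((\<lambda>u. (snd c (g u), a u)) has_vector_derivative
      (inv_field c q \<xi>, - (a t o\<^sub>L Blinfun (d_inv_field c \<xi> q)))) (at t within I)"
    by (simp add: o_def C\<gamma>)
  then have gd: "((\<lambda>u. snd c (g u)) has_vector_derivative inv_field c q \<xi>) (at t within I)"
    and ad: "(a has_vector_derivative - (a t o\<^sub>L Blinfun (d_inv_field c \<xi> q))) (at t within I)"
    using bounded_linear.has_vector_derivative[OF bounded_linear_fst] bounded_linear.has_vector_derivative[OF bounded_linear_snd]
    by (fastforce simp: o_def)+
  \<comment> \<open>Continuity in the topology of the group: near t the curve stays in the domain of
    c, so it is recovered from its continuous coordinates.\<close>
  have gc: "continuous (at t within I) g"
    unfolding continuous_within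
  proof (rule Lim_transform_eventually)
    show "((\<lambda>u. chart_inv c (snd c (g u))) \<longlongrightarrow> g t) (at t within I)"
      using isCont_tendsto_compose[OF c.isCont_inv_at[OF c(2)]
          has_vector_derivative_continuous[OF gd, unfolded continuous_within]] c(2) by simp
    show "\<forall>\<^sub>F u in at t within I. chart_inv c (snd c (g u)) = g u"
      using ev by eventually_elim simp
  qed
  \<comment> \<open>Translation by \<open>inv (g t)\<close> from c to the unit chart. Since
    \<open>inv_field c q\<close> is the derivative of translation by \<open>g t\<close>, the two
    compose to the identity, and the coordinate velocity \<open>inv_field c q \<xi>\<close> is read
    as \<xi>.\<close>
  let ?D = "frechet_derivative (\<lambda>q. snd unit_chart (inv (g t) \<otimes> chart_inv c q)) (at q)"
  have D: "((\<lambda>q. snd unit_chart (inv (g t) \<otimes> chart_inv c q)) has_derivative ?D) (at q)"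
    using smooth_map_rep_differentiable[OF smooth_map_left[of "inv (g t)"] c(1) unit_chart(1) c(2)]
    by (simp add: q_def frechet_derivative_works)
  have "?D (inv_field c q v) = v" for v
  proof -
    have "((\<lambda>y. snd unit_chart (inv (g t) \<otimes> (g t \<otimes> chart_inv unit_chart y))) has_derivative
      (\<lambda>v. ?D (inv_field c q v))) (at unit_coord)"
    proof (rule c.chain[where F = "\<lambda>y. g t \<otimes> chart_inv unit_chart y" and K = "\<lambda>h. snd unit_chart (inv (g t) \<otimes> h)"
          and D = "blinfun_apply (inv_field c q)" and E = ?D])
      show "isCont (\<lambda>y. g t \<otimes> chart_inv unit_chart y) unit_coord"
        by (intro continuous_mult continuous_const unit.isCont_inv) simp
    qed (use c D inv_field_has_derivative[OF c] in \<open>auto simp: q_def\<close>)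
    moreover have "((\<lambda>y. snd unit_chart (inv (g t) \<otimes> (g t \<otimes> chart_inv unit_chart y))) has_derivative (\<lambda>v. v)) (at unit_coord)"
      by (rule has_derivative_transform_within_open[where f = "\<lambda>q. q" and s = "snd unit_chart ` fst unit_chart"])
        (use unit.open_image in \<open>auto simp: m_assoc[symmetric]\<close>)
    ultimately show ?thesis by (rule has_derivative_unique[THEN fun_cong])
  qed
  moreover have "((\<lambda>u. snd unit_chart (inv (g t) \<otimes> g u)) has_vector_derivative ?D (inv_field c q \<xi>)) (at t within I)"
    by (rule c.chain_vector[where F = g and K = "\<lambda>h. snd unit_chart (inv (g t) \<otimes> h)", OF gc c(2) t gd])
      (use D in \<open>simp add: q_def\<close>)
  ultimately show "left_velocity I (\<lambda>u. fst (\<gamma> u)) t (gradient (momentum \<gamma> t))"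
    using gc by (simp add: left_velocity_def g_def[symmetric] \<xi>_def)
  have mom: "momentum \<gamma> u = a u o\<^sub>L inv_field c (snd c (g u))" if "g u \<in> fst c" for u
    unfolding momentum_def a_def inv_field_d_left[OF c(1) that, symmetric] g_def[symmetric]
    using coord_change_inverse[OF smooth_atlas chart_at(1)[OF cover] c(1) chart_at(2)[OF cover] that]
    by (metis blinfun_compose_assoc blinfun_compose_id(1))
  have md: "((\<lambda>u. a u o\<^sub>L inv_field c (snd c (g u))) has_derivative (\<lambda>s. s *\<^sub>R vertical_field G H (momentum \<gamma> t))) (at t within I)"
  proof -
    have "((\<lambda>u. (snd c (g u), a u)) has_derivative (\<lambda>s. (s *\<^sub>R inv_field c q \<xi>,
        s *\<^sub>R (- (a t o\<^sub>L Blinfun (d_inv_field c \<xi> q)))))) (at t within I)"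
      using has_derivative_Pair[OF gd[unfolded has_vector_derivative_def] ad[unfolded has_vector_derivative_def]] .
    from has_derivative_compose[OF this has_derivative_pullback[OF F c(1) q, of "a t", unfolded q_def]]
    have "((\<lambda>u. a u o\<^sub>L inv_field c (snd c (g u))) has_derivative
      (\<lambda>s. \<Sum>i<n. (a t (d_inv_field c (b i) q (s *\<^sub>R inv_field c q \<xi>)) +
        (s *\<^sub>R (- (a t o\<^sub>L Blinfun (d_inv_field c \<xi> q)))) (inv_field c q (b i))) *\<^sub>R \<beta> i)) (at t within I)"
      by (simp add: q_def)
    moreover have "a t (d_inv_field c (b i) q (s *\<^sub>R inv_field c q \<xi>)) +
        (s *\<^sub>R (- (a t o\<^sub>L Blinfun (d_inv_field c \<xi> q)))) (inv_field c q (b i))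
      = s * vertical_field G H (momentum \<gamma> t) (b i)" for s i
    proof -
      have "vertical_field G H (momentum \<gamma> t) (b i) = a t (inv_field c q (lie_bracket G \<xi> (b i)))"
        unfolding vertical_field_def \<xi>_def[symmetric] by (simp add: ad_apply mom[OF c(2)] q_def)
      then show ?thesis
        using inv_field_bracket[OF c, of "b i" \<xi>, folded q_def, symmetric]
        by (simp add: linear_cmul[OF has_derivative_linear[OF d_inv_field[OF c(1) q]]] blinfun.scaleR_right
            blinfun.scaleR_left blinfun.minus_left blinfun.diff_right
            bounded_linear_Blinfun_apply[OF has_derivative_bounded_linear[OF d_inv_field[OF c(1) q]]] right_diff_distrib)
    qed
    ultimately have "((\<lambda>u. a u o\<^sub>L inv_field c (snd c (g u))) has_derivative
      (\<lambda>s. \<Sum>i<n. (s * vertical_field G H (momentum \<gamma> t) (b i)) *\<^sub>R \<beta> i)) (at t within I)"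
      by simp
    then show ?thesis
      by (simp add: scaleR_scaleR[symmetric] scaleR_sum_right[symmetric] blinfun_eq_sum_frame[OF F, symmetric] del: scaleR_scaleR)
  qed
  have "\<forall>\<^sub>F u in at t within I. a u o\<^sub>L inv_field c (snd c (g u)) = momentum \<gamma> u"
    using ev by eventually_elim (simp add: mom)
  then show "(momentum \<gamma> has_vector_derivative vertical_field G H (momentum \<gamma> t)) (at t within I)"
    unfolding has_vector_derivative_def
    by (rule has_derivative_transform_eventually[OF md]) (use mom c(2) t in auto)
qed

text \<open>Expanding \<open>ad\<close> of the gradient in a frame leaves coefficients that are
  directional derivatives of H along the covectors \<open>\<beta> i\<close>, multiplied by maps
  linear in p.\<close>

lemma vertical_field_smooth: "smooth_on UNIV (vertical_field G H)"
proof -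
  obtain n b \<beta> where F: "frame n (b :: nat \<Rightarrow> 'e) \<beta>" using frame_ex by blast
  let ?D = "\<lambda>p. frechet_derivative (\<lambda>q. H (\<one>, q)) (at p)"
  have D: "?D p q = q (gradient p)" for p q
    using frechet_derivative_at[OF fiber_hamiltonian_has_derivative[of p]] by metis
  have "ad G \<xi> = (\<Sum>i<n. \<beta> i \<xi> *\<^sub>R ad G (b i))" for \<xi>
  proof (rule blinfun_eqI)
    fix \<zeta>
    \<comment> \<open>Linearity of the bracket in its first argument comes from that in the second
      by antisymmetry.\<close>
    have "lie_bracket G \<xi> \<zeta> = - ad G \<zeta> \<xi>" for \<xi> by (simp add: ad_apply lie_bracket_eq)
    moreover have "ad G \<zeta> \<xi> = (\<Sum>i<n. \<beta> i \<xi> *\<^sub>R ad G \<zeta> (b i))"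
      by (rule linear_frame_eq[OF F bounded_linear.linear[OF blinfun.bounded_linear_right]])
    ultimately show "ad G \<xi> \<zeta> = (\<Sum>i<n. \<beta> i \<xi> *\<^sub>R ad G (b i)) \<zeta>"
      by (simp add: ad_apply[of _ \<zeta>] blinfun.sum_left blinfun.scaleR_left sum_negf)
  qed
  from this[of "gradient _"] have "vertical_field G H p = (\<Sum>i<n. ?D p (\<beta> i) *\<^sub>R (p o\<^sub>L ad G (b i)))" for p
    unfolding vertical_field_def D
    by (metis (no_types, lifting) bounded_bilinear.sum_right bounded_bilinear.scaleR_right bounded_bilinear_blinfun_compose sum.cong)
  then have eq: "vertical_field G H = (\<lambda>p. \<Sum>i<n. ?D p (\<beta> i) *\<^sub>R (p o\<^sub>L ad G (b i)))" by (rule ext)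
  show ?thesis
    unfolding smooth_on_def eq
    by (intro allI Ck_on_sum Ck_on_scaleR open_UNIV smooth_on_Ck[OF smooth_on_frechet[OF fiber_hamiltonian_smooth]]
        Ck_on_bounded_linear bounded_bilinear.bounded_linear_left[OF bounded_bilinear_blinfun_compose])
qed

end


section \<open>Symmetries of the exponential map\<close>

lemma integral_curve_subset:
  "integral_curve A X I \<gamma> \<Longrightarrow> J \<subseteq> I \<Longrightarrow> integral_curve A X J \<gamma>"
  unfolding integral_curve_def
  by (meson at_le filter_leD has_vector_derivative_within_subset subsetD)

lemma integral_curve_vector_space:
  "integral_curve vector_space_atlas (\<lambda>_. V) I x \<longleftrightarrow> (\<forall>t\<in>I. (x has_vector_derivative V (x t)) (at t within I))"
  by (simp add: integral_curve_def)

lemma flow_eqI: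
  assumes "integral_curve A X {0..t} \<gamma>" "\<gamma> 0 = x"
    and "\<And>\<delta>. integral_curve A X {0..t} \<delta> \<Longrightarrow> \<delta> 0 = x \<Longrightarrow> \<delta> t = \<gamma> t"
  shows "flow A X t x = \<gamma> t"
  unfolding flow_def using assms by (intro the_equality) blast+

lemma diffeomorphism_onto_selfI:
  assumes "open X" "f ` X \<subseteq> X" "g ` X \<subseteq> X" and gf: "\<And>x. x \<in> X \<Longrightarrow> g (f x) = x"
    and fg: "\<And>x. x \<in> X \<Longrightarrow> f (g x) = x" and "smooth_on X f" "smooth_on X g"
  shows "diffeomorphism_onto_self X f"
proof -
  have bij: "bij_betw f X X" using assms by (intro bij_betw_byWitness[where f' = g]) auto
  have "inv_into X f x = g x" if "x \<in> X" for x
    using that assms fg by (intro inv_into_f_eq bij_betw_imp_inj_on[OF bij]) auto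
  then have "smooth_on X (inv_into X f)"
    using smooth_on_transform[OF \<open>open X\<close> _ \<open>smooth_on X g\<close>] by metis
  with bij \<open>smooth_on X f\<close> show ?thesis by (simp add: diffeomorphism_onto_self_def)
qed

lemma bounded_linear_compose_right: "bounded_linear (\<lambda>p. p o\<^sub>L \<sigma>)"
  by (rule bounded_bilinear.bounded_linear_left[OF bounded_bilinear_blinfun_compose])

text \<open>Reversal of time and R contribute one sign each.\<close>

lemma reflected_curve:
  fixes V :: "'a::real_normed_vector \<Rightarrow> 'a"
  assumes x: "\<And>t. t \<in> {0..T} \<Longrightarrow> (x has_vector_derivative V (x t)) (at t within {0..T})"
    and R: "bounded_linear R" "\<And>p. R (V p) = - V (R p)" and t: "t \<in> {0..T}"
  shows "((\<lambda>u. R (x (T - u))) has_vector_derivative V (R (x (T - t)))) (at t within {0..T})"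
proof -
  have im: "(\<lambda>u. T - u) ` {0..T} = {0..T}" by (auto simp: image_iff intro: bexI[of _ "T - _"])
  have "((\<lambda>u. T - u) has_vector_derivative - 1) (at t within {0..T})"
    by (auto intro!: derivative_eq_intros)
  from vector_diff_chain_within[OF this, of x "V (x (T - t))"] x[of "T - t"] t
  have "((\<lambda>u. x (T - u)) has_vector_derivative - V (x (T - t))) (at t within {0..T})"
    by (simp add: im o_def)
  from bounded_linear.has_vector_derivative[OF R(1) this] show ?thesis
    by (simp add: linear_neg[OF bounded_linear.linear[OF R(1)]] R(2))
qed

section \<open>Uniqueness of trajectories, and gradients under a symmetry\<close>

context left_invariant_system
begin

lemma vertical_unique:
  assumes "\<And>t. t \<in> {0..T} \<Longrightarrow> (x has_vector_derivative vertical_field G H (x t)) (at t within {0..T})"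
    and "\<And>t. t \<in> {0..T} \<Longrightarrow> (y has_vector_derivative vertical_field G H (y t)) (at t within {0..T})"
    and "x 0 = y 0" "t \<in> {0..T}"
  shows "x t = y t"
proof -
  obtain n b \<beta> where F: "frame n (b :: nat \<Rightarrow> 'e \<Rightarrow>\<^sub>L real) \<beta>" using frame_ex frame_dual_ex by blast
  note V' = frame_derivative[OF F smooth_on_Ck[OF vertical_field_smooth]]
  show ?thesis by (rule ode_unique[OF V' assms])
qed

lemma vertical_flow_eq:
  assumes "\<And>t. t \<in> {0..T} \<Longrightarrow> (x has_vector_derivative vertical_field G H (x t)) (at t within {0..T})"
    and "x 0 = p" "T \<ge> 0"
  shows "vertical_flow G H T p = x T"
  unfolding vertical_flow_def
proof (rule flow_eqI)
  fix y assume "integral_curve vector_space_atlas (\<lambda>_. vertical_field G H) {0..T} y" "y 0 = p"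
  then show "y T = x T"
    using assms vertical_unique[of T y x T] by (simp add: integral_curve_vector_space)
qed (use assms in \<open>simp_all add: integral_curve_vector_space\<close>)

lemma momentum_unit: "\<gamma> u = (\<one>, p) \<Longrightarrow> momentum \<gamma> u = p"
proof -
  have "d_left G \<one> \<one> = id_blinfun"
    using tangent_map_id[OF cover] by (simp add: d_left_def)
  then show "\<gamma> u = (\<one>, p) \<Longrightarrow> momentum \<gamma> u = p" by (simp add: momentum_def)
qed

text \<open>Momenta agree because their equation is autonomous, then the group components because
  they have the same left velocities; base point and momentum together give back the
  covector.\<close>

lemma hamiltonian_unique:
  assumes \<gamma>: "integral_curve (cotangent_atlas (atlas G)) (hamiltonian_field H) {0..T} \<gamma>"
    and \<delta>: "integral_curve (cotangent_atlas (atlas G)) (hamiltonian_field H) {0..T} \<delta>"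
    and "\<gamma> 0 = \<delta> 0" "T \<ge> 0"
  shows "\<gamma> T = \<delta> T"
proof -
  have m: "momentum \<gamma> t = momentum \<delta> t" if "t \<in> {0..T}" for t
    by (rule vertical_unique[of T _ _ t, OF hamiltonian_curve(2)[OF \<gamma>] hamiltonian_curve(2)[OF \<delta>]])
      (use that assms in \<open>auto simp: momentum_def\<close>)
  have g: "fst (\<gamma> T) = fst (\<delta> T)"
    by (rule left_velocity_unique[of T _ "\<lambda>t. gradient (momentum \<gamma> t)"])
      (use hamiltonian_curve(1)[OF \<gamma>] hamiltonian_curve(1)[OF \<delta>] m assms in auto)
  have snd: "snd (\<eta> T) = momentum \<eta> T o\<^sub>L d_left G (inv (fst (\<eta> T))) (fst (\<eta> T))" for \<eta>
    by (simp add: momentum_def blinfun_compose_assoc d_left_inverse)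
  show ?thesis using g m[of T] \<open>T \<ge> 0\<close> snd[of \<gamma>] snd[of \<delta>] by (simp add: prod_eq_iff)
qed

lemma Exp_eq:
  assumes "integral_curve (cotangent_atlas (atlas G)) (hamiltonian_field H) {0..T} \<gamma>" "\<gamma> 0 = (\<one>, p)" "T \<ge> 0"
  shows "Exp G H (p, T) = fst (\<gamma> T)"
proof -
  have "flow (cotangent_atlas (atlas G)) (hamiltonian_field H) T (\<one>, p) = \<gamma> T"
    by (rule flow_eqI) (use assms hamiltonian_unique[of T _ \<gamma>] in auto)
  then show ?thesis by (simp add: Exp_def)
qed

text \<open>Differentiating H(p o \<sigma>) = H(p) and pairing with all covectors gives
  \<sigma>(gradient (p o \<sigma>)) = gradient p; then \<mu> undoes \<sigma>.\<close>

lemma gradient_dual_symmetry: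
  assumes H: "\<And>p. H (\<one>, p o\<^sub>L \<sigma>) = H (\<one>, p)" and \<mu>: "\<mu> o\<^sub>L \<sigma> = id_blinfun"
  shows "gradient (p o\<^sub>L \<sigma>) = \<mu> (gradient p)"
proof -
  obtain n b \<beta> where F: "frame n (b :: nat \<Rightarrow> 'e) \<beta>" using frame_ex by blast
  have "((\<lambda>q. H (\<one>, q o\<^sub>L \<sigma>)) has_derivative (\<lambda>q. (q o\<^sub>L \<sigma>) (gradient (p o\<^sub>L \<sigma>)))) (at p)"
    by (rule has_derivative_compose[OF bounded_linear_imp_has_derivative[OF bounded_linear_compose_right] fiber_hamiltonian_has_derivative])
  then have "((\<lambda>q. H (\<one>, q)) has_derivative (\<lambda>q. (q o\<^sub>L \<sigma>) (gradient (p o\<^sub>L \<sigma>)))) (at p)"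
    by (simp only: H)
  from fun_cong[OF has_derivative_unique[OF this fiber_hamiltonian_has_derivative]]
  have eval: "q (\<sigma> (gradient (p o\<^sub>L \<sigma>))) = q (gradient p)"
    for q :: "'e \<Rightarrow>\<^sub>L real"
    by simp
  have "\<sigma> (gradient (p o\<^sub>L \<sigma>)) = gradient p"
    using frameD[OF F, of "\<sigma> (gradient (p o\<^sub>L \<sigma>))"] frameD[OF F, of "gradient p"] unfolding eval by simp
  then show ?thesis using \<mu> by (metis blinfun_apply_blinfun_compose blinfun_apply_id_blinfun id_apply)
qed

lemma tangent_map_unit_inverse:
  assumes "smooth_map (atlas G) (atlas G) S" "smooth_map (atlas G) (atlas G) T" "S \<one> = \<one>" "T \<one> = \<one>"
    and "\<And>x. T (S x) = x"
  shows "tangent_map (atlas G) (atlas G) T \<one> o\<^sub>L tangent_map (atlas G) (atlas G) S \<one> = id_blinfun"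
  using tangent_map_compose[OF cover cover cover assms(1,2), of \<one>] tangent_map_id[OF cover, of \<one>] assms by simp

end

section \<open>Complete systems: the vertical flow and the two kinds of symmetry\<close>

locale complete_left_invariant_system = left_invariant_system G H
  for G :: "('g::{t2_space, second_countable_topology}, 'e::{real_inner, banach}) smooth_group" (structure)
    and H :: "'g \<times> ('e \<Rightarrow>\<^sub>L real) \<Rightarrow> real" +
  assumes complete: "forward_complete (cotangent_atlas (atlas G)) (hamiltonian_field H)"
begin

lemma hamiltonian_curve_exists:
  obtains \<gamma> where "\<gamma> 0 = (\<one>, p)"
    "\<And>T. integral_curve (cotangent_atlas (atlas G)) (hamiltonian_field H) {0..T} \<gamma>"
    "\<And>t. t \<ge> 0 \<Longrightarrow> (momentum \<gamma> has_vector_derivative vertical_field G H (momentum \<gamma> t)) (at t within {0..})"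
proof -
  obtain \<gamma> where \<gamma>: "integral_curve (cotangent_atlas (atlas G)) (hamiltonian_field H) {0..} \<gamma>" "\<gamma> 0 = (\<one>, p)"
    using complete unfolding forward_complete_def by blast
  show thesis
    by (rule that[of \<gamma>]) (use \<gamma> integral_curve_subset[OF \<gamma>(1)] hamiltonian_curve(2)[OF \<gamma>(1)] in auto)
qed

lemma vertical_curve_exists:
  "\<exists>\<eta>. \<eta> 0 = p \<and> (\<forall>t\<ge>0. (\<eta> has_vector_derivative vertical_field G H (\<eta> t)) (at t within {0..}))"
  using hamiltonian_curve_exists[of p] momentum_unit by metis

lemma vertical_anti_symmetry_inverse:
  assumes \<sigma>: "\<And>p. vertical_field G H p o\<^sub>L \<sigma> = - vertical_field G H (p o\<^sub>L \<sigma>)"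
    and inverse: "\<sigma> o\<^sub>L \<mu> = id_blinfun" "\<mu> o\<^sub>L \<sigma> = id_blinfun"
  shows "vertical_field G H p o\<^sub>L \<mu> = - vertical_field G H (p o\<^sub>L \<mu>)"
proof -
  have "vertical_field G H p = - (vertical_field G H (p o\<^sub>L \<mu>) o\<^sub>L \<sigma>)"
    using \<sigma>[of "p o\<^sub>L \<mu>"] by (simp add: blinfun_compose_assoc inverse)
  then show ?thesis
    by (simp add: bounded_bilinear.minus_left[OF bounded_bilinear_blinfun_compose] blinfun_compose_assoc inverse)
qed

text \<open>An anti-symmetry of the vertical field conjugates it to its negative, so forward completeness
  implies completeness.\<close>

lemma smooth_vertical_flow:
  assumes \<sigma>: "\<And>p. vertical_field G H p o\<^sub>L \<sigma> = - vertical_field G H (p o\<^sub>L \<sigma>)"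
    and inverse: "\<sigma> o\<^sub>L \<mu> = id_blinfun" "\<mu> o\<^sub>L \<sigma> = id_blinfun"
  obtains \<phi> where "smooth_on UNIV \<phi>" "\<And>p. \<phi> (p, 0) = p"
    "\<And>p t. ((\<lambda>t. \<phi> (p, t)) has_vector_derivative vertical_field G H (\<phi> (p, t))) (at t)"
proof -
  obtain n b \<beta> where F: "frame n (b :: nat \<Rightarrow> 'e \<Rightarrow>\<^sub>L real) \<beta>" using frame_ex frame_dual_ex by blast
  obtain \<eta> where \<eta>0: "\<And>p. \<eta> p 0 = p"
    and \<eta>: "\<And>p t. t \<ge> 0 \<Longrightarrow> (\<eta> p has_vector_derivative vertical_field G H (\<eta> p t)) (at t within {0..})"
    using vertical_curve_exists by metis
  have \<mu>: "vertical_field G H p o\<^sub>L \<mu> = - vertical_field G H (p o\<^sub>L \<mu>)" for p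
    by (rule vertical_anti_symmetry_inverse[OF \<sigma> inverse])
  \<comment> \<open>For negative times: carry p over by \<sigma>, run forward for the time -t, and
    carry the result back by \<mu>.\<close>
  define \<phi> where "\<phi> z = (if 0 \<le> snd z then \<eta> (fst z) (snd z) else \<eta> (fst z o\<^sub>L \<sigma>) (- snd z) o\<^sub>L \<mu>)" for z
  have d: "((\<lambda>t. \<phi> (p, t)) has_vector_derivative vertical_field G H (\<phi> (p, t))) (at t)" for p t
  proof -
    let ?f = "\<lambda>t. \<eta> p t" and ?g = "\<lambda>t. \<eta> (p o\<^sub>L \<sigma>) (- t) o\<^sub>L \<mu>"
    have im: "uminus ` {..0 :: real} = {0..}" by auto
    have g: "(?g has_vector_derivative vertical_field G H (?g t)) (at t within {..0})" if "t \<le> 0" for t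
    proof -
      have "(uminus has_vector_derivative - 1) (at t within {..0})"
        by (auto intro!: derivative_eq_intros)
      from vector_diff_chain_within[OF this, of "\<eta> (p o\<^sub>L \<sigma>)" "vertical_field G H (\<eta> (p o\<^sub>L \<sigma>) (- t))"]
      have "((\<lambda>t. \<eta> (p o\<^sub>L \<sigma>) (- t)) has_vector_derivative - vertical_field G H (\<eta> (p o\<^sub>L \<sigma>) (- t))) (at t within {..0})"
        using \<eta>[of "- t" "p o\<^sub>L \<sigma>"] that by (simp add: im o_def)
      from bounded_linear.has_vector_derivative[OF bounded_linear_compose_right this, of \<mu>]
      show ?thesis by (simp add: bounded_bilinear.minus_left[OF bounded_bilinear_blinfun_compose] \<mu>)
    qed
    have "((\<lambda>t. if t \<in> {0..} then ?f t else ?g t) has_vector_derivative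
        (if t \<in> {0..} then vertical_field G H (?f t) else vertical_field G H (?g t))) (at t within UNIV)"
    \<comment> \<open>The point 0 lies in the closure of both pieces; there both halves have the
      value p, since \<sigma> and \<mu> are inverse, and hence the same derivative.\<close>
    proof (rule has_vector_derivative_If_within_closures[where T = "{..<0}"])
      have cl: "closure {0 :: real..} = {0..}" "closure {..<0 :: real} = {..0}" by auto
      have un: "{0 :: real..} \<union> (closure {0..} \<inter> closure {..<0}) = {0..}"
        "{..<0 :: real} \<union> (closure {0..} \<inter> closure {..<0}) = {..0}"
        unfolding cl by auto
      show "(?f has_vector_derivative vertical_field G H (?f t)) (at t within {0..} \<union> (closure {0..} \<inter> closure {..<0}))"
        if "t \<in> {0..} \<union> (closure {0..} \<inter> closure {..<0})"
        using that \<eta> unfolding un by simp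
      show "(?g has_vector_derivative vertical_field G H (?g t)) (at t within {..<0} \<union> (closure {0..} \<inter> closure {..<0}))"
        if "t \<in> {..<0} \<union> (closure {0..} \<inter> closure {..<0})"
        using that g unfolding un by simp
      show fg: "?f t = ?g t" if "t \<in> closure {0..}" "t \<in> closure {..<0}"
        using that unfolding cl by (simp add: \<eta>0 blinfun_compose_assoc inverse)
      show "vertical_field G H (?f t) = vertical_field G H (?g t)" if "t \<in> closure {0..}" "t \<in> closure {..<0}"
        using fg[OF that] by simp
    qed auto
    moreover have "(\<lambda>t. \<phi> (p, t)) = (\<lambda>t. if t \<in> {0..} then ?f t else ?g t)"
      by (rule ext) (simp add: \<phi>_def)
    ultimately show ?thesis by (cases "0 \<le> t") (simp_all add: \<phi>_def)
  qed
  show thesis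
    by (rule that[OF integral_curves_smooth[OF F vertical_field_smooth d]]) (use d in \<open>simp_all add: \<phi>_def \<eta>0\<close>)
qed

lemma Exp_hom:
  assumes T: "smooth_map (atlas G) (atlas G) T" "\<And>g h. T (g \<otimes> h) = T g \<otimes> T h"
    and H: "\<And>p. H (\<one>, p o\<^sub>L \<sigma>) = H (\<one>, p)"
    and \<mu>: "tangent_map (atlas G) (atlas G) T \<one> o\<^sub>L \<sigma> = id_blinfun"
    and V: "\<And>p. vertical_field G H p o\<^sub>L \<sigma> = vertical_field G H (p o\<^sub>L \<sigma>)"
    and "t \<ge> 0"
  shows "Exp G H (p o\<^sub>L \<sigma>, t) = T (Exp G H (p, t))"
proof -
  obtain \<gamma> where \<gamma>0: "\<gamma> 0 = (\<one>, p)"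
    and \<gamma>: "integral_curve (cotangent_atlas (atlas G)) (hamiltonian_field H) {0..t} \<gamma>"
    using hamiltonian_curve_exists by metis
  obtain \<delta> where \<delta>0: "\<delta> 0 = (\<one>, p o\<^sub>L \<sigma>)"
    and \<delta>: "integral_curve (cotangent_atlas (atlas G)) (hamiltonian_field H) {0..t} \<delta>"
    using hamiltonian_curve_exists by metis
  have "((\<lambda>u. momentum \<gamma> u o\<^sub>L \<sigma>) has_vector_derivative vertical_field G H (momentum \<gamma> u o\<^sub>L \<sigma>)) (at u within {0..t})"
    if "u \<in> {0..t}" for u
    using bounded_linear.has_vector_derivative[OF bounded_linear_compose_right hamiltonian_curve(2)[OF \<gamma> that], of \<sigma>]
    by (simp add: V)
  then have m: "momentum \<delta> u = momentum \<gamma> u o\<^sub>L \<sigma>" if "u \<in> {0..t}" for u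
    using that by (intro vertical_unique[of t _ _ u, OF hamiltonian_curve(2)[OF \<delta>]])
      (auto simp: momentum_unit[of \<gamma> 0, OF \<gamma>0] momentum_unit[of \<delta> 0, OF \<delta>0])
  have "fst (\<delta> t) = T (fst (\<gamma> t))"
  proof (rule left_velocity_unique[where \<eta> = "\<lambda>u. gradient (momentum \<delta> u)"])
    fix u assume u: "u \<in> {0..t}"
    show "left_velocity {0..t} (\<lambda>u. fst (\<delta> u)) u (gradient (momentum \<delta> u))"
      by (rule hamiltonian_curve(1)[OF \<delta> u])
    show "left_velocity {0..t} (\<lambda>u. T (fst (\<gamma> u))) u (gradient (momentum \<delta> u))"
      using left_velocity_hom[OF T hamiltonian_curve(1)[OF \<gamma> u] u]
      by (simp add: m[OF u] gradient_dual_symmetry[OF H \<mu>])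
  qed (use \<open>t \<ge> 0\<close> hom_unit_inverse(1)[of T, OF T(2)] in \<open>simp_all add: \<gamma>0 \<delta>0\<close>)
  then show ?thesis
    by (simp add: Exp_eq[OF \<gamma> \<gamma>0 \<open>t \<ge> 0\<close>] Exp_eq[OF \<delta> \<delta>0 \<open>t \<ge> 0\<close>])
qed

text \<open>\<open>\<delta>\<close> retraces the momentum of \<open>\<gamma>\<close> backwards, so the product of \<open>\<delta> u\<close> with the image of
  \<open>\<gamma> (t - u)\<close> under the anti-automorphism does not depend on \<open>u\<close>.\<close>

lemma Exp_anti_hom:
  assumes T: "smooth_map (atlas G) (atlas G) T" "\<And>g h. T (g \<otimes> h) = T h \<otimes> T g"
    and H: "\<And>p. H (\<one>, p o\<^sub>L \<sigma>) = H (\<one>, p)"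
    and \<mu>: "tangent_map (atlas G) (atlas G) T \<one> o\<^sub>L \<sigma> = id_blinfun"
    and V: "\<And>p. vertical_field G H p o\<^sub>L \<sigma> = - vertical_field G H (p o\<^sub>L \<sigma>)"
    and "t \<ge> 0"
  shows "Exp G H (vertical_flow G H t p o\<^sub>L \<sigma>, t) = T (Exp G H (p, t))"
proof -
  obtain \<gamma> where \<gamma>0: "\<gamma> 0 = (\<one>, p)"
    and \<gamma>: "integral_curve (cotangent_atlas (atlas G)) (hamiltonian_field H) {0..t} \<gamma>"
    using hamiltonian_curve_exists by metis
  obtain \<delta> where \<delta>0: "\<delta> 0 = (\<one>, momentum \<gamma> t o\<^sub>L \<sigma>)"
    and \<delta>: "integral_curve (cotangent_atlas (atlas G)) (hamiltonian_field H) {0..t} \<delta>"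
    using hamiltonian_curve_exists by metis
  have flow: "vertical_flow G H t p = momentum \<gamma> t"
    by (rule vertical_flow_eq[OF hamiltonian_curve(2)[OF \<gamma>] momentum_unit[of \<gamma> 0, OF \<gamma>0] \<open>t \<ge> 0\<close>])
  have m: "momentum \<delta> u = momentum \<gamma> (t - u) o\<^sub>L \<sigma>" if "u \<in> {0..t}" for u
    by (rule vertical_unique[of t _ "\<lambda>u. momentum \<gamma> (t - u) o\<^sub>L \<sigma>" u, OF hamiltonian_curve(2)[OF \<delta>]
          reflected_curve[where R = "\<lambda>p. p o\<^sub>L \<sigma>", OF hamiltonian_curve(2)[OF \<gamma>] bounded_linear_compose_right V]])
      (use that in \<open>auto simp: momentum_unit[of \<delta> 0, OF \<delta>0]\<close>)
  have "fst (\<delta> t) \<otimes> T (fst (\<gamma> (t - t))) = fst (\<delta> 0) \<otimes> T (fst (\<gamma> (t - 0)))"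
  proof (rule velocity_product_constant[where \<eta> = "\<lambda>u. gradient (momentum \<delta> u)"])
    fix u assume u: "u \<in> {0..t}"
    show "left_velocity {0..t} (\<lambda>u. fst (\<delta> u)) u (gradient (momentum \<delta> u))"
      by (rule hamiltonian_curve(1)[OF \<delta> u])
    have "t - u \<in> {0..t}" using u by auto
    from left_velocity_anti_hom[OF T left_velocity_reflect[OF hamiltonian_curve(1)[OF \<gamma> this]] u]
    show "right_velocity {0..t} (\<lambda>u. T (fst (\<gamma> (t - u)))) u (- gradient (momentum \<delta> u))"
      by (simp add: m[OF u] gradient_dual_symmetry[OF H \<mu>] blinfun.minus_right)
  qed (rule \<open>t \<ge> 0\<close>)
  then have "fst (\<delta> t) = T (fst (\<gamma> t))"
    using anti_hom_unit_inverse(1)[of T, OF T(2)] by (simp add: \<gamma>0 \<delta>0)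
  then show ?thesis
    by (simp add: flow Exp_eq[OF \<gamma> \<gamma>0 \<open>t \<ge> 0\<close>] Exp_eq[OF \<delta> \<delta>0 \<open>t \<ge> 0\<close>])
qed

lemma diffeomorphism_linear_symmetry:
  fixes \<sigma> \<mu> :: "'e \<Rightarrow>\<^sub>L 'e"
  assumes inverse: "\<sigma> o\<^sub>L \<mu> = id_blinfun" "\<mu> o\<^sub>L \<sigma> = id_blinfun"
  shows "diffeomorphism_onto_self (UNIV \<times> {0<..}) (\<lambda>(p :: 'e \<Rightarrow>\<^sub>L real, t :: real). (p o\<^sub>L \<sigma>, t))"
proof (rule diffeomorphism_onto_selfI[where g = "\<lambda>(p, t). (p o\<^sub>L \<mu>, t)"])
  have "bounded_linear (\<lambda>(p :: 'e \<Rightarrow>\<^sub>L real, t :: real). (p o\<^sub>L \<kappa>, t))" for \<kappa> :: "'e \<Rightarrow>\<^sub>L 'e"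
    unfolding case_prod_beta
    by (intro bounded_linear_Pair bounded_linear_compose[OF bounded_linear_compose_right] bounded_linear_fst bounded_linear_snd)
  then show "smooth_on (UNIV \<times> {0<..}) (\<lambda>(p :: 'e \<Rightarrow>\<^sub>L real, t :: real). (p o\<^sub>L \<sigma>, t))"
    and "smooth_on (UNIV \<times> {0<..}) (\<lambda>(p :: 'e \<Rightarrow>\<^sub>L real, t :: real). (p o\<^sub>L \<mu>, t))"
    by (auto simp: smooth_on_def intro!: Ck_on_bounded_linear open_Times)
qed (auto simp: blinfun_compose_assoc inverse intro: open_Times)

text \<open>The inverse has the same form with \<mu> in place of \<sigma>: the vertical curve that
  starts at \<phi>(p, t) o \<sigma> retraces the image of the curve of p and arrives at p o \<sigma>
  after time t, and \<mu> takes this back to p. In the proof \<kappa> stands for either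
  operator.\<close>

lemma diffeomorphism_flow_symmetry:
  assumes V: "\<And>p. vertical_field G H p o\<^sub>L \<sigma> = - vertical_field G H (p o\<^sub>L \<sigma>)"
    and inverse: "\<sigma> o\<^sub>L \<mu> = id_blinfun" "\<mu> o\<^sub>L \<sigma> = id_blinfun"
  shows "diffeomorphism_onto_self (UNIV \<times> {0<..}) (\<lambda>(p, t). (vertical_flow G H t p o\<^sub>L \<sigma>, t))"
proof -
  note V' = vertical_anti_symmetry_inverse[OF V inverse]
  obtain \<phi> where smooth: "smooth_on UNIV \<phi>" and \<phi>0: "\<And>p. \<phi> (p, 0) = p"
    and \<phi>: "\<And>p t. ((\<lambda>t. \<phi> (p, t)) has_vector_derivative vertical_field G H (\<phi> (p, t))) (at t)"
    using smooth_vertical_flow[OF V inverse] by blast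
  have \<phi>_within: "((\<lambda>t. \<phi> (p, t)) has_vector_derivative vertical_field G H (\<phi> (p, t))) (at t within I)" for p t I
    using \<phi> by (rule has_vector_derivative_at_within)
  have flow: "vertical_flow G H t p = \<phi> (p, t)" if "t \<ge> 0" for p t
    by (rule vertical_flow_eq[OF \<phi>_within \<phi>0 that])
  have reverse: "\<phi> (\<phi> (p, t) o\<^sub>L \<kappa>, t) = p o\<^sub>L \<kappa>"
    if "\<And>p. vertical_field G H p o\<^sub>L \<kappa> = - vertical_field G H (p o\<^sub>L \<kappa>)" "t \<ge> 0" for \<kappa> p t
    using vertical_unique[of t "\<lambda>u. \<phi> (\<phi> (p, t) o\<^sub>L \<kappa>, u)" "\<lambda>u. \<phi> (p, t - u) o\<^sub>L \<kappa>" t, OF \<phi>_within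
        reflected_curve[where R = "\<lambda>p. p o\<^sub>L \<kappa>", OF \<phi>_within bounded_linear_compose_right that(1)]] that(2)
    by (simp add: \<phi>0)
  have smooth': "smooth_on (UNIV \<times> {0<..}) (\<lambda>z. (\<phi> z o\<^sub>L \<kappa>, snd z))" for \<kappa>
  proof -
    have op: "open (UNIV \<times> {0 :: real<..})" by (intro open_Times) auto
    have "Ck_on k (UNIV \<times> {0<..}) \<phi>" for k
      by (rule Ck_on_subset[OF smooth_on_Ck[OF smooth]]) simp
    then show ?thesis
      unfolding smooth_on_def
      by (intro allI Ck_on_Pair[OF op Ck_on_bounded_linear_comp[OF op bounded_linear_compose_right]
            Ck_on_bounded_linear[OF op bounded_linear_snd]])
  qed
  show ?thesis
  proof (rule diffeomorphism_onto_selfI[where g = "\<lambda>z. (\<phi> z o\<^sub>L \<mu>, snd z)"])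
    show "smooth_on (UNIV \<times> {0<..}) (\<lambda>(p, t). (vertical_flow G H t p o\<^sub>L \<sigma>, t))"
      by (rule smooth_on_transform[OF _ _ smooth'[of \<sigma>]]) (auto simp: flow intro: open_Times)
  qed (auto simp: flow reverse[OF V] reverse[OF V'] blinfun_compose_assoc inverse smooth' intro: open_Times)
qed

text \<open>Shared by both cases: the differentials \<sigma> of S and \<mu> of its inverse at the
  unit are mutually inverse by the chain rule. The facts particular to a case are asked for under
  these relations, so they are derived only once.\<close>

lemma exp_symmetryI:
  assumes S: "diffeomorphism (atlas G) S" "S \<one> = \<one>" "inv_into UNIV S \<one> = \<one>"
    and "\<sigma> = tangent_map (atlas G) (atlas G) S \<one>" "\<mu> = tangent_map (atlas G) (atlas G) (inv_into UNIV S) \<one>"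
    and s: "\<sigma> o\<^sub>L \<mu> = id_blinfun \<Longrightarrow> \<mu> o\<^sub>L \<sigma> = id_blinfun \<Longrightarrow> diffeomorphism_onto_self (UNIV \<times> {0<..}) s"
    and Exp: "\<And>p t. \<mu> o\<^sub>L \<sigma> = id_blinfun \<Longrightarrow> t > 0 \<Longrightarrow> Exp G H (s (p, t)) = inv_into UNIV S (Exp G H (p, t))"
  shows "exp_symmetry G H s (inv_into UNIV S)"
proof -
  have bij: "bij S" and Ss: "smooth_map (atlas G) (atlas G) S" "smooth_map (atlas G) (atlas G) (inv_into UNIV S)"
    using S(1) by (simp_all add: diffeomorphism_def)
  have inverse: "\<sigma> o\<^sub>L \<mu> = id_blinfun" "\<mu> o\<^sub>L \<sigma> = id_blinfun"
    unfolding assms(4,5) using bij S(2,3) Ss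
    by (auto intro!: tangent_map_unit_inverse simp: bij_is_inj bij_is_surj surj_f_inv_f)
  have "diffeomorphism (atlas G) (inv_into UNIV S)"
    unfolding diffeomorphism_def inv_inv_eq[OF bij] using bij_imp_bij_inv[OF bij] Ss by simp
  with s[OF inverse] Exp[OF inverse(2)] show ?thesis
    unfolding exp_symmetry_def by (intro exI[of _ UNIV]) auto
qed

end

theorem theorem1:
  fixes G :: "('g::{t2_space, second_countable_topology}, 'e::{real_inner, banach}) smooth_group"
    and H :: "'g \<times> ('e \<Rightarrow>\<^sub>L real) \<Rightarrow> real"
    and \<sigma> :: "'e \<Rightarrow>\<^sub>L 'e"
    and S :: "'g \<Rightarrow> 'g"
    and s :: "('e \<Rightarrow>\<^sub>L real) \<times> real \<Rightarrow> ('e \<Rightarrow>\<^sub>L real) \<times> real"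
  assumes "lie_group G"
    and "connected (UNIV :: 'g set)"
    and "generic_stabilizer_connected_dim_le_1 G"
    and "left_invariant_hamiltonian G H"
    and "forward_complete (cotangent_atlas (atlas G)) (hamiltonian_field H)"
    and "\<forall>p. H (\<one>\<^bsub>G\<^esub>, p o\<^sub>L \<sigma>) = H (\<one>\<^bsub>G\<^esub>, p)"
    and "tangent_map (atlas G) (atlas G) S \<one>\<^bsub>G\<^esub> = \<sigma>"
    and "((\<forall>p. vertical_field G H p o\<^sub>L \<sigma> = vertical_field G H (p o\<^sub>L \<sigma>)) \<and>
          lie_algebra_automorphism G \<sigma> \<and>
          lie_group_automorphism G S \<and>
          s = (\<lambda>(p, t). (p o\<^sub>L \<sigma>, t)))
       \<or> ((\<forall>p. vertical_field G H p o\<^sub>L \<sigma> = - vertical_field G H (p o\<^sub>L \<sigma>)) \<and>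
          lie_algebra_anti_automorphism G \<sigma> \<and>
          lie_group_anti_automorphism G S \<and>
          s = (\<lambda>(p, t). (vertical_flow G H t p o\<^sub>L \<sigma>, t)))"
  shows "exp_symmetry G H s (inv_into UNIV S)"
proof -
  interpret lie_group G by fact
  interpret complete_left_invariant_system G H
    by unfold_locales fact+
  have H: "H (\<one>\<^bsub>G\<^esub>, p o\<^sub>L \<sigma>) = H (\<one>\<^bsub>G\<^esub>, p)" for p using assms(6) by blast
  define T where "T = inv_into UNIV S"
  define \<mu> where "\<mu> = tangent_map (atlas G) (atlas G) T \<one>\<^bsub>G\<^esub>"
  have T: "smooth_map (atlas G) (atlas G) T" "S (T x) = x" "T (S x) = x" if "diffeomorphism (atlas G) S" for x
    using that by (auto simp: diffeomorphism_def T_def bij_is_inj bij_is_surj surj_f_inv_f)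
  from assms(8) show ?thesis
  proof
    assume a: "(\<forall>p. vertical_field G H p o\<^sub>L \<sigma> = vertical_field G H (p o\<^sub>L \<sigma>)) \<and>
          lie_algebra_automorphism G \<sigma> \<and> lie_group_automorphism G S \<and> s = (\<lambda>(p, t). (p o\<^sub>L \<sigma>, t))"
    then have V: "\<And>p. vertical_field G H p o\<^sub>L \<sigma> = vertical_field G H (p o\<^sub>L \<sigma>)"
      and S: "diffeomorphism (atlas G) S" "\<And>g h. S (g \<otimes>\<^bsub>G\<^esub> h) = S g \<otimes>\<^bsub>G\<^esub> S h"
      and s: "s = (\<lambda>(p, t). (p o\<^sub>L \<sigma>, t))"
      by (auto simp: lie_group_automorphism_def)
    have T_mult: "T (g \<otimes>\<^bsub>G\<^esub> h) = T g \<otimes>\<^bsub>G\<^esub> T h" for g h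
      using T(2,3)[OF S(1)] S(2) by metis
    show ?thesis
    proof (rule exp_symmetryI[OF S(1) hom_unit_inverse(1)[of S, OF S(2)] _ assms(7)[symmetric] \<mu>_def[unfolded T_def]])
      show "inv_into UNIV S \<one>\<^bsub>G\<^esub> = \<one>\<^bsub>G\<^esub>"
        using hom_unit_inverse(1)[of T, OF T_mult] by (simp add: T_def)
      fix p and t :: real assume \<mu>: "\<mu> o\<^sub>L \<sigma> = id_blinfun" and "t > 0"
      show "Exp G H (s (p, t)) = inv_into UNIV S (Exp G H (p, t))"
        using Exp_hom[OF T(1)[OF S(1)] T_mult H \<mu>[unfolded \<mu>_def] V, of t p] \<open>t > 0\<close> by (simp add: s T_def)
    qed (simp add: s diffeomorphism_linear_symmetry)
  next
    assume b: "(\<forall>p. vertical_field G H p o\<^sub>L \<sigma> = - vertical_field G H (p o\<^sub>L \<sigma>)) \<and>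
          lie_algebra_anti_automorphism G \<sigma> \<and> lie_group_anti_automorphism G S \<and>
          s = (\<lambda>(p, t). (vertical_flow G H t p o\<^sub>L \<sigma>, t))"
    then have V: "\<And>p. vertical_field G H p o\<^sub>L \<sigma> = - vertical_field G H (p o\<^sub>L \<sigma>)"
      and S: "diffeomorphism (atlas G) S" "\<And>g h. S (g \<otimes>\<^bsub>G\<^esub> h) = S h \<otimes>\<^bsub>G\<^esub> S g"
      and s: "s = (\<lambda>(p, t). (vertical_flow G H t p o\<^sub>L \<sigma>, t))"
      by (auto simp: lie_group_anti_automorphism_def)
    have T_mult: "T (g \<otimes>\<^bsub>G\<^esub> h) = T h \<otimes>\<^bsub>G\<^esub> T g" for g h
      using T(2,3)[OF S(1)] S(2) by metis
    show ?thesis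
    proof (rule exp_symmetryI[OF S(1) anti_hom_unit_inverse(1)[of S, OF S(2)] _ assms(7)[symmetric] \<mu>_def[unfolded T_def]])
      show "inv_into UNIV S \<one>\<^bsub>G\<^esub> = \<one>\<^bsub>G\<^esub>"
        using anti_hom_unit_inverse(1)[of T, OF T_mult] by (simp add: T_def)
      fix p and t :: real assume \<mu>: "\<mu> o\<^sub>L \<sigma> = id_blinfun" and "t > 0"
      show "Exp G H (s (p, t)) = inv_into UNIV S (Exp G H (p, t))"
        using Exp_anti_hom[OF T(1)[OF S(1)] T_mult H \<mu>[unfolded \<mu>_def] V, of t p] \<open>t > 0\<close> by (simp add: s T_def)
    qed (simp add: s diffeomorphism_flow_symmetry[OF V])
  qed
qed

end
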